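(* Consider the rescaled $q$-Racah ensembles with parameters $q,\alpha,\beta,\gamma,\delta$ described in the context, with $a(\xi),b(\xi)$ the limits of the recurrence coefficients and $\mu(x)=q^{-x}+\gamma\delta q^x$. Assume that either $\alpha\beta\le0$ or $\log_q(\alpha\beta)<2\log_q\gamma$. If $\mu'(x)\neq0$, then there are two real solutions $\xi_\pm(x)$ to $$4a(\xi)^2-(\mu(x)-b(\xi))^2=0,$$ ordered as $\xi_-(x)\le\xi_+(x)$. Then, as $n\to\infty$, the limiting density for the rescaled $q$-Racah ensemble is given by $$\rho(x)=\begin{cases}1,&\xi_-(x)<\xi_+(x)\le1,\\[2pt] \dfrac1\pi\arccos\left(\dfrac{2y(1)-y(\xi_-(x))-y(\xi_+(x))}{\left|y(\xi_-(x))-y(\xi_+(x))\right|}\right),&\xi_-(x)<1<\xi_+(x),\\[8pt] 0,&1\le\xi_-(x)<\xi_+(x),\end{cases}$$ where $y(\xi)=q^{-\xi}+\alpha\beta q^{\xi}$.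
   Context: Let $q\in(0,1)\cup(1,\infty)$, and for $n\in\mathbb N$ put $\mathbf q=q^{1/n}$. Let $M=M_n>n$ be integers, $\gamma_n=q^{-(M+1)/n}$ (so $\gamma_n\mathbf q^{M+1}=1$), and assume $\gamma_n\to\gamma$ as $n\to\infty$ with $-\log_q\gamma>1$. Let $\alpha,\beta,\delta$ be real and independent of $n$. The $q$-Racah ensemble of size $n$ is the probability measure on $y_1,\dots,y_n\in\{0,\dots,M\}$ proportional to $\prod_{i<j}(\nu_n(y_i)-\nu_n(y_j))^2\prod_jw(y_j)$ with $$\nu_n(y)=\mathbf q^{-y}+\delta\gamma_n\mathbf q^{y+1},\qquad w(y)=\frac{(\alpha\mathbf q,\beta\delta\mathbf q,\gamma_n\mathbf q,\gamma_n\delta\mathbf q;\mathbf q)_y\,(1-\gamma_n\delta\mathbf q^{2y+1})}{(\mathbf q,\alpha^{-1}\gamma_n\delta\mathbf q,\beta^{-1}\gamma_n\mathbf q,\delta\mathbf q;\mathbf q)_y\,(\alpha\beta\mathbf q)^y(1-\gamma_n\delta\mathbf q)},$$ where $(x_1,\dots,x_r;\mathbf q)_k=\prod_i\prod_{s=0}^{k-1}(1-x_i\mathbf q^s)$. The parameters are assumed such that $w$ is a well-defined nonnegative weight and $\nu_n$ is strictly monotone on $\{0,\dots,M\}$. The rescaled ensemble is $x_j=y_j/n$. The limits of the recurrence coefficients (of the orthonormal polynomials in $\nu_n$ with respect to $w$, at index $j$ with $j/n\to\xi$, $0<\xi<-\log_q\gamma$) are given by $a(\xi)=\sqrt{A(\xi)C(\xi)}$,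 $b(\xi)=1+\gamma\delta-A(\xi)-C(\xi)$, with $$A(\xi)=\frac{(1-\gamma q^\xi)(1-\alpha q^\xi)(1-\alpha\beta q^\xi)(1-\beta\delta q^\xi)}{(1-\alpha\beta q^{2\xi})^2},\qquad C(\xi)=\frac{(1-q^\xi)(1-\beta q^\xi)(\delta-\alpha q^\xi)(\gamma-\alpha\beta q^\xi)}{(1-\alpha\beta q^{2\xi})^2}.$$ Here $x$ ranges over $[0,-\log_q\gamma]$, and solutions $\xi$ are sought in $[0,-\log_q\gamma]$. "Limiting density $\rho$" means that, almost surely (the ensembles for different $n$ being defined on a common probability space), $\frac1n\sum_{j=1}^nf(x_j)\to\int_0^{-\log_q\gamma}f(x)\rho(x)\,dx$ for every continuous $f$.
   Formalization: The arccos denominator is y(ξ₋)−y(ξ₊) without the absolute value: for q<1, αβ≤0, y is increasing and the printed formula gives 1−ρ; otherwise both agree. Existence of the orthonormal polynomials at all indices j/n→ξ<−log_qγ is an explicit hypothesis. *)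

theory Defs
  imports "HOL-Probability.Probability"
begin

definition qpoch :: "real \<Rightarrow> real \<Rightarrow> nat \<Rightarrow> real" where
  "qpoch x p k = (\<Prod>s<k. 1 - x * p ^ s)"

definition qbase :: "real \<Rightarrow> nat \<Rightarrow> real" where
  "qbase q n = q powr (1 / real n)"

text \<open>\<open>M\<close> is the sequence of the numbers \<open>M\<^sub>n\<close>. As \<open>\<gamma>\<^sub>n\<close> is determined by
  \<open>q\<close>, \<open>n\<close> and \<open>M\<^sub>n\<close>, it is not a parameter of its own.\<close>

definition gam :: "real \<Rightarrow> (nat \<Rightarrow> nat) \<Rightarrow> nat \<Rightarrow> real" where
  "gam q M n = q powr (- (real (M n) + 1) / real n)"

definition node :: "real \<Rightarrow> real \<Rightarrow> (nat \<Rightarrow> nat) \<Rightarrow> nat \<Rightarrow> nat \<Rightarrow> real" where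
  "node q \<delta> M n y = inverse (qbase q n ^ y) + \<delta> * gam q M n * qbase q n ^ (y + 1)"

definition weight_num ::
  "real \<Rightarrow> real \<Rightarrow> real \<Rightarrow> real \<Rightarrow> (nat \<Rightarrow> nat) \<Rightarrow> nat \<Rightarrow> nat \<Rightarrow> real" where
  "weight_num q \<alpha> \<beta> \<delta> M n y = (let p = qbase q n; g = gam q M n in
     qpoch (\<alpha> * p) p y * qpoch (\<beta> * \<delta> * p) p y * qpoch (g * p) p y * qpoch (g * \<delta> * p) p y
     * (1 - g * \<delta> * p ^ (2 * y + 1)))"

definition weight_den ::
  "real \<Rightarrow> real \<Rightarrow> real \<Rightarrow> real \<Rightarrow> (nat \<Rightarrow> nat) \<Rightarrow> nat \<Rightarrow> nat \<Rightarrow> real" where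
  "weight_den q \<alpha> \<beta> \<delta> M n y = (let p = qbase q n; g = gam q M n in
     qpoch p p y * qpoch (inverse \<alpha> * g * \<delta> * p) p y * qpoch (inverse \<beta> * g * p) p y
     * qpoch (\<delta> * p) p y * (\<alpha> * \<beta> * p) ^ y * (1 - g * \<delta> * p))"

definition weight ::
  "real \<Rightarrow> real \<Rightarrow> real \<Rightarrow> real \<Rightarrow> (nat \<Rightarrow> nat) \<Rightarrow> nat \<Rightarrow> nat \<Rightarrow> real" where
  "weight q \<alpha> \<beta> \<delta> M n y = weight_num q \<alpha> \<beta> \<delta> M n y / weight_den q \<alpha> \<beta> \<delta> M n y"

text \<open>The standing assumption on the parameters, for one \<open>n\<close>. Division is total here, so that the
  weight is well-defined has to be said: \<open>\<alpha>\<^sup>-\<^sup>1\<close>, \<open>\<beta>\<^sup>-\<^sup>1\<close> exist and no denominator vanishes.\<close>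

definition admissible ::
  "real \<Rightarrow> real \<Rightarrow> real \<Rightarrow> real \<Rightarrow> (nat \<Rightarrow> nat) \<Rightarrow> nat \<Rightarrow> bool" where
  "admissible q \<alpha> \<beta> \<delta> M n \<longleftrightarrow>
     \<alpha> \<noteq> 0 \<and> \<beta> \<noteq> 0 \<and>
     (\<forall>y\<in>{0..M n}. weight_den q \<alpha> \<beta> \<delta> M n y \<noteq> 0 \<and> weight q \<alpha> \<beta> \<delta> M n y \<ge> 0) \<and>
     (strict_mono_on {0..M n} (node q \<delta> M n) \<or> strict_antimono_on {0..M n} (node q \<delta> M n))"

definition configs :: "(nat \<Rightarrow> nat) \<Rightarrow> nat \<Rightarrow> (nat \<Rightarrow> nat) set" where
  "configs M n = {1..n} \<rightarrow>\<^sub>E {0..M n}"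

definition joint_weight ::
  "real \<Rightarrow> real \<Rightarrow> real \<Rightarrow> real \<Rightarrow> (nat \<Rightarrow> nat) \<Rightarrow> nat \<Rightarrow> (nat \<Rightarrow> nat) \<Rightarrow> real" where
  "joint_weight q \<alpha> \<beta> \<delta> M n y =
     (\<Prod>j\<in>{1..n}. \<Prod>i\<in>{1..<j}. (node q \<delta> M n (y i) - node q \<delta> M n (y j))\<^sup>2)
     * (\<Prod>j\<in>{1..n}. weight q \<alpha> \<beta> \<delta> M n (y j))"

text \<open>If the normalising constant is \<open>0\<close> this is the zero measure, hence not the law of anything.\<close>

definition ensemble ::
  "real \<Rightarrow> real \<Rightarrow> real \<Rightarrow> real \<Rightarrow> (nat \<Rightarrow> nat) \<Rightarrow> nat \<Rightarrow> (nat \<Rightarrow> nat) measure" where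
  "ensemble q \<alpha> \<beta> \<delta> M n = point_measure (configs M n)
     (\<lambda>y. ennreal (joint_weight q \<alpha> \<beta> \<delta> M n y / (\<Sum>z\<in>configs M n. joint_weight q \<alpha> \<beta> \<delta> M n z)))"

definition coefA :: "real \<Rightarrow> real \<Rightarrow> real \<Rightarrow> real \<Rightarrow> real \<Rightarrow> real \<Rightarrow> real" where
  "coefA q \<alpha> \<beta> \<gamma> \<delta> \<xi> =
     (1 - \<gamma> * q powr \<xi>) * (1 - \<alpha> * q powr \<xi>) * (1 - \<alpha> * \<beta> * q powr \<xi>) * (1 - \<beta> * \<delta> * q powr \<xi>)
     / (1 - \<alpha> * \<beta> * q powr (2 * \<xi>))\<^sup>2"

definition coefC :: "real \<Rightarrow> real \<Rightarrow> real \<Rightarrow> real \<Rightarrow> real \<Rightarrow> real \<Rightarrow> real" where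
  "coefC q \<alpha> \<beta> \<gamma> \<delta> \<xi> =
     (1 - q powr \<xi>) * (1 - \<beta> * q powr \<xi>) * (\<delta> - \<alpha> * q powr \<xi>) * (\<gamma> - \<alpha> * \<beta> * q powr \<xi>)
     / (1 - \<alpha> * \<beta> * q powr (2 * \<xi>))\<^sup>2"

definition rec_a :: "real \<Rightarrow> real \<Rightarrow> real \<Rightarrow> real \<Rightarrow> real \<Rightarrow> real \<Rightarrow> real" where
  "rec_a q \<alpha> \<beta> \<gamma> \<delta> \<xi> = sqrt (coefA q \<alpha> \<beta> \<gamma> \<delta> \<xi> * coefC q \<alpha> \<beta> \<gamma> \<delta> \<xi>)"

definition rec_b :: "real \<Rightarrow> real \<Rightarrow> real \<Rightarrow> real \<Rightarrow> real \<Rightarrow> real \<Rightarrow> real" where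
  "rec_b q \<alpha> \<beta> \<gamma> \<delta> \<xi> = 1 + \<gamma> * \<delta> - coefA q \<alpha> \<beta> \<gamma> \<delta> \<xi> - coefC q \<alpha> \<beta> \<gamma> \<delta> \<xi>"

definition mu :: "real \<Rightarrow> real \<Rightarrow> real \<Rightarrow> real \<Rightarrow> real" where
  "mu q \<gamma> \<delta> x = q powr (- x) + \<gamma> * \<delta> * q powr x"

definition yy :: "real \<Rightarrow> real \<Rightarrow> real \<Rightarrow> real \<Rightarrow> real" where
  "yy q \<alpha> \<beta> \<xi> = q powr (- \<xi>) + \<alpha> * \<beta> * q powr \<xi>"

text \<open>The function of \<open>\<xi>\<close> whose zeros are \<open>\<xi>\<^sub>-(x)\<close> and \<open>\<xi>\<^sub>+(x)\<close>.\<close>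

definition char_fun :: "real \<Rightarrow> real \<Rightarrow> real \<Rightarrow> real \<Rightarrow> real \<Rightarrow> real \<Rightarrow> real \<Rightarrow> real" where
  "char_fun q \<alpha> \<beta> \<gamma> \<delta> x \<xi> =
     4 * (rec_a q \<alpha> \<beta> \<gamma> \<delta> \<xi>)\<^sup>2 - (mu q \<gamma> \<delta> x - rec_b q \<alpha> \<beta> \<gamma> \<delta> \<xi>)\<^sup>2"

text \<open>The density as a function of \<open>\<xi>\<^sub>-(x)\<close> (\<open>u\<close>) and \<open>\<xi>\<^sub>+(x)\<close> (\<open>v\<close>), with the value \<open>0\<close> if these
  coincide. The denominator is \<open>y(\<xi>\<^sub>-) - y(\<xi>\<^sub>+)\<close>, which equals \<open>\<bar>y(\<xi>\<^sub>-) - y(\<xi>\<^sub>+)\<bar>\<close> whenever the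
  function \<open>y\<close> is decreasing, that is, if \<open>q > 1\<close> or \<open>\<alpha>\<beta> > 0\<close>. For \<open>q < 1\<close> and \<open>\<alpha>\<beta> \<le> 0\<close> it is
  increasing, and the absolute value would turn the density \<open>\<rho>\<close> into \<open>1 - \<rho>\<close> where
  \<open>\<xi>\<^sub>- < 1 < \<xi>\<^sub>+\<close>; the density has to tend to \<open>1\<close> as \<open>\<xi>\<^sub>+\<close> decreases to \<open>1\<close>.\<close>

definition rho_of :: "real \<Rightarrow> real \<Rightarrow> real \<Rightarrow> real \<Rightarrow> real \<Rightarrow> real" where
  "rho_of q \<alpha> \<beta> u v =
     (if u < v \<and> v \<le> 1 then 1
      else if u < 1 \<and> 1 < v then
        1 / pi * arccos ((2 * yy q \<alpha> \<beta> 1 - yy q \<alpha> \<beta> u - yy q \<alpha> \<beta> v) / (yy q \<alpha> \<beta> u - yy q \<alpha> \<beta> v))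
      else 0)"

text \<open>\<open>Y n \<omega> j\<close> is the \<open>j\<close>-th particle, \<open>j \<in> {1..n}\<close>, of the unscaled ensemble of size \<open>n\<close>.
  Rescaled particles may lie outside \<open>[0, L]\<close>, so test functions are defined on the whole line.\<close>

definition limiting_density ::
  "'w measure \<Rightarrow> (nat \<Rightarrow> 'w \<Rightarrow> nat \<Rightarrow> nat) \<Rightarrow> real \<Rightarrow> (real \<Rightarrow> real) \<Rightarrow> bool" where
  "limiting_density P Y L \<rho> \<longleftrightarrow>
     set_integrable lborel {0..L} \<rho> \<and>
     (AE \<omega> in P. \<forall>f :: real \<Rightarrow> real. continuous_on UNIV f \<longrightarrow>
        (\<lambda>n. 1 / real n * (\<Sum>j=1..n. f (real (Y n \<omega> j) / real n)))
          \<longlonglongrightarrow> (LBINT x:{0..L}. f x * \<rho> x))"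

end

theory Submission
  imports Defs "Jordan_Normal_Form.Determinant"
begin

text \<open>The orthonormal \<open>q\<close>-Racah polynomials \<open>e\<^sub>k\<close> are also the eigenvectors of a second order \<open>q\<close>-difference
  operator in the variable \<open>y\<close>. With \<open>p = qbase q n\<close>, the eigenvalues \<open>1 / p ^ k + \<alpha>\<beta> p ^ (k + 1)\<close> are monotone in
  \<open>k\<close>. Hence the expected number \<open>w(y) \<Sum>\<^sub>k e\<^sub>k(y)\<^sup>2\<close>, \<open>k < n\<close>, of particles at \<open>y\<close> is the mass that the spectral measure
  of this operator at \<open>y\<close> gives to one side of the \<open>n\<close>-th eigenvalue. The coefficients vary slowly, so around
  \<open>y = xn\<close> the moments of the spectral measure converge to those of \<open>c(x) + 2d(x) cos \<theta>\<close> with \<open>\<theta>\<close> uniform on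
  \<open>[0, \<pi>]\<close>, while the \<open>n\<close>-th eigenvalue tends to \<open>y(1)\<close>; this gives the arccosine.

  By the duality of the \<open>q\<close>-Racah polynomials, \<open>4a\<^sup>2 - (\<mu> - b)\<^sup>2\<close> is a positive multiple of \<open>4d\<^sup>2 - (y(\<xi>) - c)\<^sup>2\<close>, so
  that \<open>\<xi>\<^sub>+\<close>, \<open>\<xi>\<^sub>-\<close> solve \<open>y(\<xi>) = c \<plusminus> 2d\<close>. These values are in the range of \<open>y\<close>: so is the diagonal coefficient \<open>c\<close>,
  because the eigenvalues are, and the end points of the range cannot lie strictly between \<open>c - 2d\<close> and
  \<open>c + 2d\<close>, because the discriminant is not positive at \<open>\<xi> = 0\<close> and \<open>\<xi> = L\<close>.

  Multiplication by a polynomial in the nodes is a band matrix in the basis \<open>e\<^sub>k\<close>, so the variance of the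
  corresponding linear statistic is bounded. Almost sure convergence follows by Chebyshev, Borel-Cantelli and
  the Weierstrass approximation theorem.\<close>

section \<open>Determinants of orthogonal polynomials\<close>

text \<open>The recurrence coefficients of the orthonormal polynomials are never computed. For a
  fixed point \<open>y\<close> the density is a partial sum over the degree, so an operator that is
  diagonal in the degree is wanted, and the difference operator is one; A and C enter only through
  the identity of discriminants. The obstacle is that every fact about the limit has to be extracted
  from the standing assumptions for finite \<open>n\<close>: that 1 - \<gamma>\<delta> q^(2x) has no
  zero inside (0, L) comes from monotone nodes, that B D \<ge> 0 comes from positive weights, and
  that A C \<ge> 0 comes from computing the trace of a function of the operator in two ways. The
  strict inequality on \<alpha>\<beta> leaves room beyond L, where eigenvalues of finite size may
  lie. If q < 1 and \<alpha>\<beta> \<le> 0, the function y increases, the first \<open>n\<close>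
  eigenvalues are the lowest ones, and the density is the mass of the other side. The finitely many
  x in (0, L) with d = 0 are discarded, because only integrals of the density matter.\<close>

lemma poly_triangular_expansion:
  fixes E :: "nat \<Rightarrow> 'a :: field poly"
  assumes "\<And>j. j \<le> k \<Longrightarrow> degree (E j) = j \<and> E j \<noteq> 0" and "degree P \<le> k"
  shows "\<exists>c. P = (\<Sum>j\<le>k. Polynomial.smult (c j) (E j)) \<and> coeff P k = c k * coeff (E k) k"
  using assms
proof (induction k arbitrary: P)
  case 0
  obtain a where a: "P = [:a:]" using 0 by (metis degree_eq_zeroE le_zero_eq)
  obtain b where b: "E 0 = [:b:]" using 0(1)[of 0] by (metis degree_eq_zeroE le_refl)
  have "b \<noteq> 0" using 0(1)[of 0] b by auto
  then show ?case using a b by (intro exI[of _ "\<lambda>_. a / b"]) auto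
next
  case (Suc k)
  let ?l = "coeff (E (Suc k)) (Suc k)"
  have l: "?l \<noteq> 0" using Suc.prems(1)[of "Suc k"] by (metis leading_coeff_neq_0 le_refl)
  define t where "t = coeff P (Suc k) / ?l"
  let ?R = "P - Polynomial.smult t (E (Suc k))"
  have "degree ?R \<le> Suc k"
    using Suc.prems(1)[of "Suc k"] Suc.prems(2) by (intro degree_diff_le) auto
  moreover have "coeff ?R (Suc k) = 0" using l by (simp add: t_def)
  ultimately have "degree ?R \<le> k"
    by (metis le_Suc_eq le_zero_eq leading_coeff_0_iff degree_0 zero_le)
  then obtain c where c: "?R = (\<Sum>j\<le>k. Polynomial.smult (c j) (E j))"
    using Suc.IH[of ?R] Suc.prems(1) by auto
  have "P = (\<Sum>j\<le>Suc k. Polynomial.smult ((c(Suc k := t)) j) (E j))"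
    using c by (simp add: algebra_simps)
  then show ?case using l by (intro exI[of _ "c(Suc k := t)"]) (simp add: t_def)
qed

text \<open>The alternating sum is the determinant of a lower triangular matrix times the matrix of
  the Newton polynomials of the points, which is again triangular.\<close>

lemma vandermonde_polys:
  fixes E :: "nat \<Rightarrow> real poly"
  assumes "\<And>k. k < n \<Longrightarrow> degree (E k) = k \<and> E k \<noteq> 0"
  shows "(\<Sum>s\<in>{s. s permutes {0..<n}}. signof s * (\<Prod>i=0..<n. poly (E (s i)) (x i)))
    = (\<Prod>k=0..<n. coeff (E k) k) * (\<Prod>j=0..<n. \<Prod>i=0..<j. x j - x i)"
proof -
  define N where "N k = (\<Prod>i=0..<k. [:- x i, 1:])" for k
  have N: "degree (N k) = k \<and> coeff (N k) k = 1" for k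
  proof (induction k)
    case (Suc k)
    have S: "N (Suc k) = N k * [:- x k, 1:]" by (simp add: N_def)
    have "N k \<noteq> 0" using Suc by auto
    then have "degree (N (Suc k)) = Suc k" using Suc unfolding S by (subst degree_mult_eq) auto
    moreover have "lead_coeff (N (Suc k)) = 1" unfolding S using Suc by (simp only: lead_coeff_mult) auto
    ultimately show ?case by simp
  qed (simp add: N_def)
  have "\<exists>c. E k = (\<Sum>j\<le>k. Polynomial.smult (c j) (N j)) \<and> coeff (E k) k = c k * coeff (N k) k" if "k < n" for k
    using poly_triangular_expansion[of k N "E k"] N assms that by (metis order_refl zero_neq_one coeff_0)
  then obtain c where c: "\<And>k. k < n \<Longrightarrow> E k = (\<Sum>j\<le>k. Polynomial.smult (c k j) (N j)) \<and> coeff (E k) k = c k k"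
    using N by (metis mult.right_neutral)
  define C where "C = mat n n (\<lambda>(k, j). if j \<le> k then c k j else 0)"
  define V where "V = mat n n (\<lambda>(j, i). poly (N j) (x i))"
  have Cc: "C \<in> carrier_mat n n" and Vc: "V \<in> carrier_mat n n" by (auto simp: C_def V_def)
  have CV: "(C * V) $$ (k, i) = poly (E k) (x i)" if "k < n" "i < n" for k i
  proof -
    have "(C * V) $$ (k, i) = (\<Sum>j = 0..<n. (if j \<le> k then c k j else 0) * poly (N j) (x i))"
      using that by (simp add: C_def V_def scalar_prod_def)
    also have "\<dots> = (\<Sum>j\<in>{0..<n}. if j \<in> {..k} then c k j * poly (N j) (x i) else 0)"
      by (intro sum.cong) auto
    also have "\<dots> = (\<Sum>j\<in>{0..<n} \<inter> {..k}. c k j * poly (N j) (x i))"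
      by (subst sum.inter_restrict) auto
    also have "{0..<n} \<inter> {..k} = {..k}" using that by auto
    finally show ?thesis using c[OF that(1)] by (simp add: poly_sum)
  qed
  have "det C = (\<Prod>k=0..<n. c k k)"
  proof (subst det_lower_triangular[OF _ Cc])
    show "prod_list (diag_mat C) = (\<Prod>k=0..<n. c k k)"
      by (simp add: diag_mat_def C_def prod.distinct_set_conv_list flip: prod.distinct_set_conv_list)
  qed (simp add: C_def)
  moreover have "det V = (\<Prod>j=0..<n. poly (N j) (x j))"
  proof (subst det_upper_triangular[OF _ Vc])
    show "upper_triangular V"
      by (auto simp: upper_triangular_def V_def N_def poly_prod intro!: bexI prod_zero)
    show "prod_list (diag_mat V) = (\<Prod>j=0..<n. poly (N j) (x j))"
      by (simp add: diag_mat_def V_def flip: prod.distinct_set_conv_list)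
  qed
  moreover have "det (C * V) = (\<Sum>s\<in>{s. s permutes {0..<n}}. signof s * (\<Prod>i=0..<n. poly (E (s i)) (x i)))"
  proof (subst det_col[of _ n])
    show "C * V \<in> carrier_mat n n" using Cc Vc by simp
    have "(\<Prod>i<n. (C * V) $$ (s i, i)) = (\<Prod>i=0..<n. poly (E (s i)) (x i))" if "s permutes {0..<n}" for s
      unfolding lessThan_atLeast0 using that by (intro prod.cong refl CV) auto
    then show "(\<Sum>s | s permutes {0..<n}. signof s * (\<Prod>j<n. (C * V) $$ (s j, j)))
      = (\<Sum>s | s permutes {0..<n}. signof s * (\<Prod>i=0..<n. poly (E (s i)) (x i)))"
      by (intro sum.cong) auto
  qed
  moreover have "(\<Prod>k=0..<n. c k k) = (\<Prod>k=0..<n. coeff (E k) k)"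
    by (intro prod.cong refl) (metis c atLeastLessThan_iff)
  ultimately show ?thesis
    using det_mult[OF Cc Vc] by (simp add: N_def poly_prod)
qed

lemma sum_PiE_prod:
  fixes f :: "nat \<Rightarrow> nat \<Rightarrow> real"
  assumes "finite X"
  shows "(\<Sum>y\<in>{1..n} \<rightarrow>\<^sub>E X. \<Prod>i=0..<n. f i (y (Suc i))) = (\<Prod>i=0..<n. \<Sum>v\<in>X. f i v)"
proof -
  have "(\<Prod>i=0..<n. \<Sum>v\<in>X. f i v) = (\<Prod>i\<in>{1..n}. \<Sum>v\<in>X. f (i - 1) v)"
    by (rule prod.reindex_bij_witness[of _ "\<lambda>i. i - 1" Suc]) auto
  also have "\<dots> = (\<Sum>y\<in>{1..n} \<rightarrow>\<^sub>E X. \<Prod>i\<in>{1..n}. f (i - 1) (y i))"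
    using assms by (intro prod_sum_PiE) auto
  also have "\<dots> = (\<Sum>y\<in>{1..n} \<rightarrow>\<^sub>E X. \<Prod>i=0..<n. f i (y (Suc i)))"
    by (intro sum.cong refl prod.reindex_bij_witness[of _ Suc "\<lambda>i. i - 1"]) auto
  finally show ?thesis ..
qed

text \<open>The Slater determinant of \<open>e k (y (Suc i))\<close> as its Leibniz sum. Functions
  are numbered from 0 and particles from 1, hence the \<open>Suc\<close>.\<close>

definition slater :: "(nat \<Rightarrow> nat \<Rightarrow> real) \<Rightarrow> nat \<Rightarrow> (nat \<Rightarrow> nat) \<Rightarrow> real" where
  "slater e n y = (\<Sum>s\<in>{s. s permutes {0..<n}}. of_int (sign s) * (\<Prod>i=0..<n. e (s i) (y (Suc i))))"

definition slater_weight :: "(nat \<Rightarrow> real) \<Rightarrow> (nat \<Rightarrow> nat \<Rightarrow> real) \<Rightarrow> nat \<Rightarrow> (nat \<Rightarrow> nat) \<Rightarrow> real" where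
  "slater_weight w e n y = (slater e n y)\<^sup>2 * (\<Prod>i=0..<n. w (y (Suc i)))"

text \<open>The matrix of multiplication by \<open>h\<close> in the family \<open>e\<close>; for the
  constant 1 it is the Gram matrix.\<close>

definition gram :: "nat set \<Rightarrow> (nat \<Rightarrow> real) \<Rightarrow> (nat \<Rightarrow> nat \<Rightarrow> real) \<Rightarrow> (nat \<Rightarrow> real) \<Rightarrow> nat \<Rightarrow> nat \<Rightarrow> real" where
  "gram X w e h k l = (\<Sum>v\<in>X. h v * e k v * e l v * w v)"

text \<open>Andreief's identity before its collapse: both determinants are expanded, and the sum
  over configurations factors over the particles because the test function is a product.\<close>

lemma slater_sum_prod:
  assumes "finite X"
  shows "(\<Sum>y\<in>{1..n} \<rightarrow>\<^sub>E X. slater_weight w e n y * (\<Prod>i=0..<n. h i (y (Suc i))))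
   = (\<Sum>s\<in>{s. s permutes {0..<n}}. \<Sum>t\<in>{t. t permutes {0..<n}}.
       of_int (sign s) * of_int (sign t) * (\<Prod>i=0..<n. gram X w e (h i) (s i) (t i)))"
proof -
  have "(\<Sum>y\<in>{1..n} \<rightarrow>\<^sub>E X. slater_weight w e n y * (\<Prod>i=0..<n. h i (y (Suc i))))
   = (\<Sum>y\<in>{1..n} \<rightarrow>\<^sub>E X. \<Sum>s\<in>{s. s permutes {0..<n}}. \<Sum>t\<in>{t. t permutes {0..<n}}.
       of_int (sign s) * of_int (sign t) *
       (\<Prod>i=0..<n. h i (y (Suc i)) * e (s i) (y (Suc i)) * e (t i) (y (Suc i)) * w (y (Suc i))))"
    unfolding slater_weight_def slater_def power2_eq_square sum_product
    by (simp add: prod.distrib sum_distrib_right sum_distrib_left algebra_simps)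
  also have "\<dots> = (\<Sum>s\<in>{s. s permutes {0..<n}}. \<Sum>t\<in>{t. t permutes {0..<n}}. of_int (sign s) * of_int (sign t) *
       (\<Sum>y\<in>{1..n} \<rightarrow>\<^sub>E X. \<Prod>i=0..<n. h i (y (Suc i)) * e (s i) (y (Suc i)) * e (t i) (y (Suc i)) * w (y (Suc i))))"
    unfolding sum_distrib_left
    by (subst sum.swap, rule sum.cong[OF refl], subst sum.swap) simp
  also have "\<dots> = (\<Sum>s\<in>{s. s permutes {0..<n}}. \<Sum>t\<in>{t. t permutes {0..<n}}.
       of_int (sign s) * of_int (sign t) * (\<Prod>i=0..<n. gram X w e (h i) (s i) (t i)))"
    unfolding gram_def
    by (subst sum_PiE_prod[OF assms, symmetric]) simp
  finally show ?thesis .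
qed

text \<open>Permutations that agree off two indices differ by at most the transposition of these.\<close>

lemma permutes_agree_off_pair:
  assumes "s permutes A" "t permutes A" "\<And>i. i \<in> A \<Longrightarrow> i \<noteq> a \<Longrightarrow> i \<noteq> b \<Longrightarrow> t i = s i" "a \<in> A" "b \<in> A"
  shows "t = s \<or> t = s \<circ> Transposition.transpose a b"
proof -
  define r where "r = inv_into UNIV s \<circ> t"
  have r: "r permutes {a, b}"
  proof (rule permutes_superset)
    show "r permutes A" unfolding r_def using assms by (intro permutes_compose permutes_inv)
    show "\<And>x. x \<in> A - {a, b} \<Longrightarrow> r x = x" 
      using assms(3) permutes_inverses(2)[OF assms(1)] by (simp add: r_def)
  qed
  have t: "t = s \<circ> r" unfolding r_def using assms(1) by (auto simp: fun_eq_iff permutes_inverses)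
  have "r = id \<or> r = Transposition.transpose a b"
    using r by (metis permutes_doubleton_iff)
  then show ?thesis using t by auto
qed

section \<open>Determinantal formulas for one and two particles\<close>

locale orthonormal_family =
  fixes X :: "nat set" and w :: "nat \<Rightarrow> real" and e :: "nat \<Rightarrow> nat \<Rightarrow> real" and n :: nat
  assumes fin: "finite X"
    and orth: "\<And>k l. k < n \<Longrightarrow> l < n \<Longrightarrow> gram X w e (\<lambda>_. 1) k l = (if k = l then 1 else 0)"
begin

abbreviation "S \<equiv> {s. s permutes {0..<n}}"

lemma finite_S: "finite S" by (rule finite_permutations) simp

text \<open>If only the particles a and b are tested, every other factor is a Kronecker delta and
  forces \<open>t i = s i\<close>, so two permutations survive. For \<open>a = b\<close> both sets
  collapse, which gives the one-particle case.\<close>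

lemma sum_two_factors:
  assumes ab: "a < n" "b < n" and h: "\<And>i. i \<noteq> a \<Longrightarrow> i \<noteq> b \<Longrightarrow> h i = (\<lambda>_. 1)"
  shows "(\<Sum>y\<in>{1..n} \<rightarrow>\<^sub>E X. slater_weight w e n y * (\<Prod>i\<in>{a, b}. h i (y (Suc i))))
    = (\<Sum>s\<in>S. \<Sum>t\<in>{s, s \<circ> Transposition.transpose a b}.
        of_int (sign s) * of_int (sign t) * (\<Prod>i\<in>{a, b}. gram X w e (h i) (s i) (t i)))"
proof -
  let ?G = "\<lambda>A s t. of_int (sign s) * of_int (sign t) * (\<Prod>i\<in>A. gram X w e (h i) (s i) (t i))"
  have "(\<Prod>i=0..<n. h i (y (Suc i))) = (\<Prod>i\<in>{a, b}. h i (y (Suc i)))" for y :: "nat \<Rightarrow> nat"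
    using ab h by (intro prod.mono_neutral_right) auto
  then have "(\<Sum>y\<in>{1..n} \<rightarrow>\<^sub>E X. slater_weight w e n y * (\<Prod>i\<in>{a, b}. h i (y (Suc i))))
     = (\<Sum>s\<in>S. \<Sum>t\<in>S. ?G {0..<n} s t)"
    using slater_sum_prod[OF fin, of w e n h] by (simp only:)
  also have "\<dots> = (\<Sum>s\<in>S. \<Sum>t\<in>{s, s \<circ> Transposition.transpose a b}. ?G {a, b} s t)"
  proof (rule sum.cong[OF refl])
    fix s assume s: "s \<in> S"
    let ?r = "s \<circ> Transposition.transpose a b"
    have lt: "t i < n" if "i < n" "t \<in> S" for t i using that permutes_in_image[of t "{0..<n}" i] by auto
    have rS: "?r \<in> S" using s ab by (auto intro!: permutes_compose permutes_swap_id)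
    have zero: "?G {0..<n} s t = 0" if t: "t \<in> S - {s, ?r}" for t
    proof -
      obtain i where i: "i < n" "i \<noteq> a" "i \<noteq> b" "t i \<noteq> s i"
        using permutes_agree_off_pair[of s "{0..<n}" t a b] s t ab by auto
      then have "gram X w e (h i) (s i) (t i) = 0" using orth[of "s i" "t i"] lt s t h by simp
      then show ?thesis using i by auto
    qed
    have "?G {0..<n} s t = ?G {a, b} s t" if t: "t \<in> {s, ?r}" for t
    proof -
      have "t i = s i" if "i \<noteq> a" "i \<noteq> b" for i using t that by (auto simp: transpose_apply_other)
      then have "(\<Prod>i=0..<n. gram X w e (h i) (s i) (t i)) = (\<Prod>i\<in>{a, b}. gram X w e (h i) (s i) (t i))"
        using ab h lt[OF _ s] orth by (intro prod.mono_neutral_right) auto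
      then show ?thesis by simp
    qed
    then have "(\<Sum>t\<in>{s, ?r}. ?G {0..<n} s t) = (\<Sum>t\<in>{s, ?r}. ?G {a, b} s t)" by (rule sum.cong[OF refl])
    moreover have "(\<Sum>t\<in>S. ?G {0..<n} s t) = (\<Sum>t\<in>{s, ?r}. ?G {0..<n} s t)"
      using zero s rS finite_S by (intro sum.mono_neutral_right) auto
    ultimately show "(\<Sum>t\<in>S. ?G {0..<n} s t) = (\<Sum>t\<in>{s, ?r}. ?G {a, b} s t)" by (rule trans[rotated])
  qed
  finally show ?thesis .
qed

text \<open>The two surviving permutations have opposite signs, so each \<open>s\<close> contributes
  a 2 by 2 minor, as in the two-point function of a determinantal process.\<close>

lemma sum_pair:
  assumes "a < n" "b < n" "a \<noteq> b"
  shows "(\<Sum>y\<in>{1..n} \<rightarrow>\<^sub>E X. slater_weight w e n y * (f (y (Suc a)) * g (y (Suc b))))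
    = (\<Sum>s\<in>S. gram X w e f (s a) (s a) * gram X w e g (s b) (s b)
             - gram X w e f (s a) (s b) * gram X w e g (s b) (s a))"
proof -
  define h where "h i = (if i = a then f else if i = b then g else (\<lambda>_. 1))" for i
  have h: "h a = f" "h b = g" using assms by (auto simp: h_def)
  have "(\<Sum>t\<in>{s, s \<circ> Transposition.transpose a b}. of_int (sign s) * of_int (sign t) * (\<Prod>i\<in>{a, b}. gram X w e (h i) (s i) (t i)))
    = gram X w e f (s a) (s a) * gram X w e g (s b) (s b) - gram X w e f (s a) (s b) * gram X w e g (s b) (s a)"
    if s: "s \<in> S" for s
  proof -
    have "sign (s \<circ> Transposition.transpose a b) = - sign s"
      using s assms by (subst sign_compose) (auto simp: sign_swap_id permutation_swap_id
          intro: permutation_permutes[THEN iffD2, OF exI[of _ "{0..<n}"]])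
    moreover have "inj s" using s permutes_inj by auto
    then have "s \<noteq> s \<circ> Transposition.transpose a b" using assms by (metis comp_apply injD transpose_apply_first)
    ultimately show ?thesis using assms by (simp add: h sign_def)
  qed
  moreover have "(\<Prod>i\<in>{a, b}. h i (y (Suc i))) = f (y (Suc a)) * g (y (Suc b))" for y :: "nat \<Rightarrow> nat"
    using assms by (simp add: h)
  ultimately show ?thesis using sum_two_factors[of a b h] assms by (simp add: h_def)
qed

lemma sum_single:
  assumes "a < n"
  shows "(\<Sum>y\<in>{1..n} \<rightarrow>\<^sub>E X. slater_weight w e n y * f (y (Suc a))) = (\<Sum>s\<in>S. gram X w e f (s a) (s a))"
proof -
  have "of_int (sign s) * of_int (sign s) = (1::real)" for s :: "nat \<Rightarrow> nat" by (simp add: sign_def)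
  then show ?thesis
    using sum_two_factors[of a a "\<lambda>i. if i = a then f else (\<lambda>_. 1)"] assms by simp
qed

lemma sum_total: "(\<Sum>y\<in>{1..n} \<rightarrow>\<^sub>E X. slater_weight w e n y) = fact n"
proof (cases "n = 0")
  case True
  then show ?thesis by (simp add: slater_weight_def slater_def)
next
  case False
  have "gram X w e (\<lambda>_. 1) (s 0) (s 0) = 1" if "s \<in> S" for s
    using that False orth permutes_in_image[of s "{0..<n}" 0] by auto
  then have "(\<Sum>s\<in>S. gram X w e (\<lambda>_. 1) (s 0) (s 0)) = fact n"
    using card_permutations[of "{0..<n}" n] by simp
  then show ?thesis using sum_single[of 0 "\<lambda>_. 1"] False by simp
qed

text \<open>For each \<open>s\<close> the sum over the particles is the trace of the matrix of
  \<open>f\<close>, and there are \<open>fact n\<close> permutations.\<close>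

lemma sum_linear:
  "(\<Sum>y\<in>{1..n} \<rightarrow>\<^sub>E X. slater_weight w e n y * (\<Sum>j=1..n. f (y j)))
    = fact n * (\<Sum>k<n. gram X w e f k k)"
proof -
  have r: "(\<Sum>j=1..n. f (y j)) = (\<Sum>a=0..<n. f (y (Suc a)))" for y :: "nat \<Rightarrow> nat" and f :: "nat \<Rightarrow> real"
    by (rule sum.reindex_bij_witness[of _ Suc "\<lambda>i. i - 1"]) auto
  have "(\<Sum>y\<in>{1..n} \<rightarrow>\<^sub>E X. slater_weight w e n y * (\<Sum>j=1..n. f (y j)))
    = (\<Sum>a=0..<n. \<Sum>y\<in>{1..n} \<rightarrow>\<^sub>E X. slater_weight w e n y * f (y (Suc a)))"
    unfolding r sum_distrib_left by (rule sum.swap)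
  also have "\<dots> = (\<Sum>a=0..<n. \<Sum>s\<in>S. gram X w e f (s a) (s a))"
    by (rule sum.cong[OF refl], rule sum_single) simp
  also have "\<dots> = (\<Sum>s\<in>S. \<Sum>a=0..<n. gram X w e f (s a) (s a))" by (rule sum.swap)
  also have "\<dots> = (\<Sum>s\<in>S. \<Sum>k=0..<n. gram X w e f k k)"
    by (rule sum.cong[OF refl], rule sum.permute[symmetric, unfolded o_def]) simp
  also have "\<dots> = fact n * (\<Sum>k<n. gram X w e f k k)"
    using card_permutations[of "{0..<n}" n] by (simp add: lessThan_atLeast0)
  finally show ?thesis .
qed

text \<open>Particles paired with themselves give the trace of the matrix of f^2, distinct pairs
  give 2 by 2 minors. Without the square of the mean this is the determinantal variance: that trace
  minus the squared Hilbert-Schmidt norm of the truncated matrix of \<open>f\<close>.\<close>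

lemma sum_quadratic:
  "(\<Sum>y\<in>{1..n} \<rightarrow>\<^sub>E X. slater_weight w e n y * (\<Sum>j=1..n. f (y j))\<^sup>2)
    = fact n * ((\<Sum>k<n. gram X w e (\<lambda>v. (f v)\<^sup>2) k k) + (\<Sum>k<n. gram X w e f k k)\<^sup>2
        - (\<Sum>k<n. \<Sum>l<n. (gram X w e f k l)\<^sup>2))"
proof -
  let ?F = "gram X w e f"
  let ?D = "{0..<n} \<times> {0..<n} - Id"
  let ?Phi = "\<lambda>k l. ?F k k * ?F l l - ?F k l * ?F l k"
  have sym: "?F k l = ?F l k" for k l by (simp add: gram_def mult_ac)
  have r: "(\<Sum>j=1..n. f (y j)) = (\<Sum>a=0..<n. f (y (Suc a)))" for y :: "nat \<Rightarrow> nat" and f :: "nat \<Rightarrow> real"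
    by (rule sum.reindex_bij_witness[of _ Suc "\<lambda>i. i - 1"]) auto
  have sq: "(\<Sum>j=1..n. f (y j))\<^sup>2 = (\<Sum>j=1..n. (f (y j))\<^sup>2) + (\<Sum>(a, b)\<in>?D. f (y (Suc a)) * f (y (Suc b)))"
    for y :: "nat \<Rightarrow> nat"
  proof -
    have U: "{0..<n} \<times> {0..<n} = ?D \<union> (\<lambda>a. (a, a)) ` {0..<n}" by auto
    have "(\<Sum>j=1..n. f (y j))\<^sup>2 = (\<Sum>(a, b)\<in>{0..<n} \<times> {0..<n}. f (y (Suc a)) * f (y (Suc b)))"
      unfolding r power2_eq_square sum_product by (simp add: sum.cartesian_product)
    also have "\<dots> = (\<Sum>(a, b)\<in>?D. f (y (Suc a)) * f (y (Suc b))) + (\<Sum>(a, b)\<in>(\<lambda>a. (a, a)) ` {0..<n}. f (y (Suc a)) * f (y (Suc b)))"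
      by (subst U, rule sum.union_disjoint) auto
    also have "(\<Sum>(a, b)\<in>(\<lambda>a. (a, a)) ` {0..<n}. f (y (Suc a)) * f (y (Suc b))) = (\<Sum>a=0..<n. (f (y (Suc a)))\<^sup>2)"
      by (subst sum.reindex) (auto simp: inj_on_def power2_eq_square)
    finally show ?thesis using r[of "\<lambda>v. (f v)\<^sup>2" y] by simp
  qed
  have "(\<Sum>y\<in>{1..n} \<rightarrow>\<^sub>E X. slater_weight w e n y * (\<Sum>j=1..n. f (y j))\<^sup>2)
     = fact n * (\<Sum>k<n. gram X w e (\<lambda>v. (f v)\<^sup>2) k k)
     + (\<Sum>y\<in>{1..n} \<rightarrow>\<^sub>E X. \<Sum>(a, b)\<in>?D. slater_weight w e n y * (f (y (Suc a)) * f (y (Suc b))))"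
    unfolding sq distrib_left sum.distrib sum_linear[of "\<lambda>v. (f v)\<^sup>2"]
    by (simp add: case_prod_unfold sum_distrib_left)
  also have "(\<Sum>y\<in>{1..n} \<rightarrow>\<^sub>E X. \<Sum>(a, b)\<in>?D. slater_weight w e n y * (f (y (Suc a)) * f (y (Suc b))))
    = (\<Sum>(a, b)\<in>?D. \<Sum>s\<in>S. ?Phi (s a) (s b))"
    unfolding case_prod_unfold by (subst sum.swap, rule sum.cong[OF refl], rule sum_pair) auto
  also have "\<dots> = (\<Sum>s\<in>S. \<Sum>(a, b)\<in>?D. ?Phi (s a) (s b))"
    unfolding case_prod_unfold by (rule sum.swap)
  also have "\<dots> = (\<Sum>s\<in>S. \<Sum>(k, l)\<in>?D. ?Phi k l)"
  proof (rule sum.cong[OF refl])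
    fix s assume s: "s \<in> S"
    have inv: "s (inv_into UNIV s a) = a" "inv_into UNIV s (s a) = a" for a using s by (auto simp: permutes_inverses)
    have m: "s a < n \<longleftrightarrow> a < n" "inv_into UNIV s a < n \<longleftrightarrow> a < n" for a
      using s permutes_in_image[of s "{0..<n}" a] permutes_in_image[OF permutes_inv, of s "{0..<n}" a] by auto
    show "(\<Sum>(a, b)\<in>?D. ?Phi (s a) (s b)) = (\<Sum>(k, l)\<in>?D. ?Phi k l)"
      by (rule sum.reindex_bij_witness[of _ "\<lambda>(k, l). (inv_into UNIV s k, inv_into UNIV s l)" "\<lambda>(a, b). (s a, s b)"])
        (auto simp: inv m; metis inv)+
  qed
  also have "\<dots> = fact n * (\<Sum>(k, l)\<in>?D. ?Phi k l)"
    using card_permutations[of "{0..<n}" n] by simp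
  \<comment> \<open>The minor vanishes for k = l, so the diagonal may be put back.\<close>
  also have "(\<Sum>(k, l)\<in>?D. ?Phi k l) = (\<Sum>(k, l)\<in>{0..<n} \<times> {0..<n}. ?Phi k l)"
    by (rule sum.mono_neutral_left) auto
  also have "\<dots> = (\<Sum>k<n. ?F k k)\<^sup>2 - (\<Sum>k<n. \<Sum>l<n. (?F k l)\<^sup>2)"
    unfolding power2_eq_square sum_product lessThan_atLeast0
    by (simp add: sum.cartesian_product[symmetric] sum_subtractf sym)
  finally show ?thesis by (simp add: algebra_simps)
qed

end

section \<open>Orthogonal polynomials on a finite set\<close>

locale op_system =
  fixes S :: "nat set" and nu w :: "nat \<Rightarrow> real"
  assumes fin: "finite S" and inj: "inj_on nu S" and pos: "\<And>v. v \<in> S \<Longrightarrow> w v > 0"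
begin

definition ip :: "(nat \<Rightarrow> real) \<Rightarrow> (nat \<Rightarrow> real) \<Rightarrow> real" where
  "ip f g = (\<Sum>v\<in>S. f v * g v * w v)"

abbreviation ev :: "real poly \<Rightarrow> nat \<Rightarrow> real" where "ev P v \<equiv> poly P (nu v)"

lemma ip_cong: "(\<And>v. v \<in> S \<Longrightarrow> f v = f' v) \<Longrightarrow> (\<And>v. v \<in> S \<Longrightarrow> g v = g' v) \<Longrightarrow> ip f g = ip f' g'"
  by (simp add: ip_def)

lemma ip_commute: "ip f g = ip g f"
  by (simp add: ip_def mult_ac)

lemma ip_sum: "ip (\<lambda>v. \<Sum>k\<in>A. a k * f k v) g = (\<Sum>k\<in>A. a k * ip (f k) g)"
proof -
  have "ip (\<lambda>v. \<Sum>k\<in>A. a k * f k v) g = (\<Sum>v\<in>S. \<Sum>k\<in>A. a k * (f k v * g v * w v))"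
    by (simp add: ip_def sum_distrib_right sum_distrib_left mult_ac)
  also have "\<dots> = (\<Sum>k\<in>A. a k * ip (f k) g)"
    unfolding ip_def sum_distrib_left by (rule sum.swap)
  finally show ?thesis .
qed

lemma ip_diff: "ip (\<lambda>v. f v - g v) h = ip f h - ip g h"
  by (simp add: ip_def left_diff_distrib sum_subtractf)

text \<open>A nonzero polynomial of degree below \<open>card S\<close> cannot vanish at
  \<open>card S\<close> distinct nodes.\<close>

lemma ip_pos:
  assumes "P \<noteq> 0" "degree P < card S"
  shows "ip (ev P) (ev P) > 0"
proof -
  have "\<exists>v\<in>S. ev P v \<noteq> 0"
  proof (rule ccontr)
    assume "\<not> ?thesis"
    then have "nu ` S \<subseteq> {x. poly P x = 0}" by auto
    then have "card (nu ` S) \<le> card {x. poly P x = 0}" using assms by (intro card_mono poly_roots_finite)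
    then show False using card_poly_roots_bound[OF assms(1)] assms(2) by (simp add: card_image[OF inj])
  qed
  then obtain v where "v \<in> S" "ev P v \<noteq> 0" by auto
  then show ?thesis unfolding ip_def using pos fin
    by (intro sum_pos2[of _ v]) (auto simp: less_imp_le zero_less_mult_iff)
qed

text \<open>Gram-Schmidt on the monomials; by \<open>ip_pos\<close> the norms stay positive as long
  as the degree is below \<open>card S\<close>.\<close>

lemma orthonormal_polys_exist:
  "\<exists>E. (\<forall>k<card S. degree (E k) = k \<and> E k \<noteq> 0) \<and>
       (\<forall>k<card S. \<forall>l<card S. ip (ev (E k)) (ev (E l)) = (if k = l then 1 else 0))"
proof -
  have "\<exists>E. (\<forall>k<n. degree (E k) = k \<and> E k \<noteq> 0) \<and>
       (\<forall>k<n. \<forall>l<n. ip (ev (E k)) (ev (E l)) = (if k = l then 1 else 0))" if "n \<le> card S" for n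
    using that
  proof (induction n)
    case (Suc n)
    then obtain E where E: "\<And>k. k < n \<Longrightarrow> degree (E k) = k \<and> E k \<noteq> 0"
      and o: "\<And>k l. k < n \<Longrightarrow> l < n \<Longrightarrow> ip (ev (E k)) (ev (E l)) = (if k = l then 1 else 0)" by auto
    define R where "R = (\<Sum>k<n. Polynomial.smult (ip (\<lambda>v. nu v ^ n) (ev (E k))) (E k))"
    define P where "P = Polynomial.monom 1 n - R"
    have dR: "coeff R j = 0" if "j \<ge> n" for j
      unfolding R_def coeff_sum using E that by (auto intro!: sum.neutral simp: coeff_eq_0)
    have cP: "coeff P n = 1" unfolding P_def using dR by simp
    have "degree P \<le> n" by (rule degree_le) (auto simp: P_def dR)
    then have dP: "degree P = n" using cP by (simp add: le_antisym le_degree)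
    have P0: "P \<noteq> 0" using cP by auto
    have oP: "ip (ev P) (ev (E l)) = 0" if "l < n" for l
    proof -
      have "ev P = (\<lambda>v. nu v ^ n - (\<Sum>k<n. ip (\<lambda>v. nu v ^ n) (ev (E k)) * ev (E k) v))"
        by (simp add: P_def R_def poly_monom poly_sum)
      then have "ip (ev P) (ev (E l)) = ip (\<lambda>v. nu v ^ n) (ev (E l))
          - (\<Sum>k<n. ip (\<lambda>v. nu v ^ n) (ev (E k)) * ip (ev (E k)) (ev (E l)))"
        by (simp only: ip_diff ip_sum)
      also have "(\<Sum>k<n. ip (\<lambda>v. nu v ^ n) (ev (E k)) * ip (ev (E k)) (ev (E l)))
         = (\<Sum>k<n. if k = l then ip (\<lambda>v. nu v ^ n) (ev (E k)) else 0)"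
        using o that by (intro sum.cong) auto
      finally show ?thesis using that by simp
    qed
    define s where "s = 1 / sqrt (ip (ev P) (ev P))"
    have N: "ip (ev P) (ev P) > 0" using ip_pos[OF P0] dP Suc.prems by simp
    have s: "s * s * ip (ev P) (ev P) = 1" "s \<noteq> 0" using N by (auto simp: s_def)
    have sc: "ip (\<lambda>v. s * f v) g = s * ip f g" "ip g (\<lambda>v. s * f v) = s * ip g f" for f g
      by (simp_all add: ip_def sum_distrib_left mult_ac)
    let ?E = "E(n := Polynomial.smult s P)"
    have "degree (?E k) = k \<and> ?E k \<noteq> 0" if "k < Suc n" for k
      using that E dP P0 s(2) by (auto simp: less_Suc_eq)
    moreover have "ip (ev (?E k)) (ev (?E l)) = (if k = l then 1 else 0)" if "k < Suc n" "l < Suc n" for k l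
      using that o oP oP[THEN trans[OF ip_commute]] s by (auto simp: less_Suc_eq sc)
    ultimately show ?case by blast
  qed simp
  then show ?thesis by blast
qed

end

section \<open>Completeness, eigenvectors and variance in a basis of orthonormal polynomials\<close>

locale op_basis = op_system +
  fixes E :: "nat \<Rightarrow> real poly" and e :: "nat \<Rightarrow> nat \<Rightarrow> real"
  assumes deg: "\<And>k. k < card S \<Longrightarrow> degree (E k) = k \<and> E k \<noteq> 0"
    and e_def: "e = (\<lambda>k v. poly (E k) (nu v))"
    and orthonormal: "\<And>k l. k < card S \<Longrightarrow> l < card S \<Longrightarrow> ip (e k) (e l) = (if k = l then 1 else 0)"
begin

lemma expansion:
  assumes "degree P \<le> k" "k < card S"
  shows "P = (\<Sum>j\<le>k. Polynomial.smult (ip (ev P) (e j)) (E j))"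
    and "coeff P k = ip (ev P) (e k) * coeff (E k) k"
proof -
  obtain c where c: "P = (\<Sum>j\<le>k. Polynomial.smult (c j) (E j))" "coeff P k = c k * coeff (E k) k"
    using poly_triangular_expansion[of k E P] deg assms by auto
  have "ip (ev P) (e l) = c l" if "l \<le> k" for l
  proof -
    have "ev P = (\<lambda>v. \<Sum>j\<le>k. c j * e j v)"
      by (subst c(1)) (simp add: e_def poly_sum)
    then have "ip (ev P) (e l) = (\<Sum>j\<le>k. c j * ip (e j) (e l))" by (simp only: ip_sum)
    also have "\<dots> = (\<Sum>j\<le>k. if j = l then c j else 0)"
      using orthonormal assms that by (intro sum.cong) auto
    finally show ?thesis using that by simp
  qed
  then have *: "(\<Sum>j\<le>k. Polynomial.smult (ip (ev P) (e j)) (E j)) = (\<Sum>j\<le>k. Polynomial.smult (c j) (E j))"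
    "ip (ev P) (e k) = c k" by auto
  show "P = (\<Sum>j\<le>k. Polynomial.smult (ip (ev P) (e j)) (E j))" by (rule trans[OF c(1) *(1)[symmetric]])
  show "coeff P k = ip (ev P) (e k) * coeff (E k) k" by (simp only: c(2) *(2))
qed

lemma orth_lower:
  assumes "degree P < k" "k < card S"
  shows "ip (ev P) (e k) = 0"
proof -
  have "coeff P k = 0" using assms by (simp add: coeff_eq_0)
  moreover have "coeff (E k) k \<noteq> 0" using deg[OF assms(2)] by (metis leading_coeff_0_iff)
  ultimately show ?thesis using expansion(2)[of P k] assms by simp
qed

text \<open>The matrix of the \<open>e k y\<close>, scaled by the weights, is square, so orthonormal
  rows give orthonormal columns. Concretely, \<open>P\<close> is the Lagrange polynomial that is 1
  at \<open>y\<close> and 0 on the rest of \<open>S\<close>; its expansion in \<open>E\<close>,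
  evaluated at \<open>z\<close>, is the claim.\<close>

lemma complete:
  assumes "y \<in> S" "z \<in> S"
  shows "(\<Sum>k<card S. e k y * e k z * w y) = (if y = z then 1 else 0)"
proof -
  define P where "P = Polynomial.smult (inverse (\<Prod>u\<in>S - {y}. nu y - nu u)) (\<Prod>u\<in>S - {y}. [:- nu u, 1:])"
  have nz: "(\<Prod>u\<in>S - {y}. nu y - nu u) \<noteq> 0" using fin inj assms by (auto simp: inj_on_def)
  have evP: "ev P v = (if v = y then 1 else 0)" if "v \<in> S" for v
    using nz that fin by (auto simp: P_def poly_prod intro!: bexI[of _ v])
  have c0: "card S > 0" using assms fin by (auto simp: card_gt_0_iff)
  have "degree (\<Prod>u\<in>S - {y}. [:- nu u, 1:]) \<le> (\<Sum>u\<in>S - {y}. degree [:- nu u, 1:])"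
    using degree_prod_sum_le[of "S - {y}" "\<lambda>u. [:- nu u, 1:]"] fin by (simp add: o_def)
  then have "degree P \<le> card S - 1" using assms fin unfolding P_def by (intro order.trans[OF degree_smult_le]) simp
  then have "P = (\<Sum>j\<le>card S - 1. Polynomial.smult (ip (ev P) (e j)) (E j))"
    using c0 by (intro expansion) auto
  then have "ev P z = poly (\<Sum>j\<le>card S - 1. Polynomial.smult (ip (ev P) (e j)) (E j)) (nu z)" by (rule arg_cong)
  also have "\<dots> = (\<Sum>j\<le>card S - 1. ip (ev P) (e j) * e j z)"
    by (simp add: e_def poly_sum)
  also have "{..card S - 1} = {..<card S}" using c0 by auto
  also have "(\<Sum>j<card S. ip (ev P) (e j) * e j z) = (\<Sum>k<card S. e k y * e k z * w y)"
  proof (rule sum.cong[OF refl])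
    fix j
    have "ip (ev P) (e j) = (\<Sum>v\<in>S. if v = y then e j v * w v else 0)"
      unfolding ip_def by (intro sum.cong) (auto simp: evP)
    then show "ip (ev P) (e j) * e j z = e j y * e j z * w y" using fin assms by simp
  qed
  finally show ?thesis using evP[OF assms(2)] by (simp add: eq_commute)
qed

lemma parseval: "(\<Sum>k<card S. (ip f (e k))\<^sup>2) = ip f f"
proof -
  have "(\<Sum>k<card S. (ip f (e k))\<^sup>2) = (\<Sum>k<card S. \<Sum>y\<in>S. \<Sum>z\<in>S. f y * f z * w z * (e k y * e k z * w y))"
    unfolding ip_def power2_eq_square sum_product by (simp add: mult_ac)
  also have "\<dots> = (\<Sum>y\<in>S. \<Sum>z\<in>S. f y * f z * w z * (\<Sum>k<card S. e k y * e k z * w y))"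
    unfolding sum_distrib_left
    by (subst sum.swap, rule sum.cong[OF refl], rule sum.swap)
  also have "\<dots> = (\<Sum>y\<in>S. \<Sum>z\<in>S. if y = z then f y * f z * w z else 0)"
    by (intro sum.cong) (auto simp: complete)
  also have "\<dots> = ip f f" using fin by (simp add: ip_def cong: sum.cong)
  finally show ?thesis .
qed

text \<open>A self-adjoint operator that preserves the filtration by degree also preserves the
  orthogonal complement of the lower degrees in degree at most k. This complement is spanned by
  \<open>e k\<close>, and the leading coefficient gives the eigenvalue.\<close>

lemma eigenvector:
  assumes tri: "\<And>k P. k < card S \<Longrightarrow> degree P \<le> k \<Longrightarrow>
      \<exists>Q. degree Q \<le> k \<and> coeff Q k = Lam k * coeff P k \<and> (\<forall>v\<in>S. T (ev P) v = ev Q v)"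
    and sa: "\<And>f g. ip (T f) g = ip f (T g)"
    and k: "k < card S" and v: "v \<in> S"
  shows "T (e k) v = Lam k * e k v"
proof -
  obtain Q where Q: "degree Q \<le> k" "coeff Q k = Lam k * coeff (E k) k" "\<And>v. v \<in> S \<Longrightarrow> T (e k) v = ev Q v"
    using tri[of k "E k"] deg[OF k] k unfolding e_def by auto
  have z: "ip (ev Q) (e j) = 0" if "j < k" for j
  proof -
    obtain R where R: "degree R \<le> j" "\<And>v. v \<in> S \<Longrightarrow> T (e j) v = ev R v"
      using tri[of j "E j"] deg[of j] k \<open>j < k\<close> unfolding e_def by auto
    have "ip (ev Q) (e j) = ip (T (e k)) (e j)" using Q by (intro ip_cong) auto
    also have "\<dots> = ip (T (e j)) (e k)" by (simp add: sa ip_commute[of "e k"])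
    also have "\<dots> = ip (ev R) (e k)" using R by (intro ip_cong) auto
    also have "\<dots> = 0" using R that k by (intro orth_lower) auto
    finally show ?thesis .
  qed
  have l: "coeff (E k) k \<noteq> 0" using deg[OF k] by (metis leading_coeff_0_iff)
  have "ip (ev Q) (e k) = Lam k" using expansion(2)[OF Q(1) k] Q(2) l by simp
  moreover have "Q = (\<Sum>j\<le>k. Polynomial.smult (ip (ev Q) (e j)) (E j))" using expansion(1)[OF Q(1) k] .
  moreover have "(\<Sum>j\<le>k. Polynomial.smult (ip (ev Q) (e j)) (E j)) = Polynomial.smult (ip (ev Q) (e k)) (E k)"
    by (subst sum.mono_neutral_right[of _ "{k}"]) (auto simp: z)
  ultimately show ?thesis using Q(3)[OF v] by (metis e_def poly_smult)
qed

lemma gram_ip: "gram S w e f k l = ip (\<lambda>v. f v * e k v) (e l)"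
  by (simp add: gram_def ip_def)

text \<open>Multiplication by \<open>nu ^ r\<close> is a band matrix in the basis \<open>e\<close>, so only \<open>r\<close> rows contribute.\<close>

lemma linear_statistic_variance:
  assumes n: "n \<le> card S" and F: "\<And>v. v \<in> S \<Longrightarrow> \<bar>nu v ^ r\<bar> \<le> F"
  shows "(\<Sum>k<n. gram S w e (\<lambda>v. (nu v ^ r)\<^sup>2) k k) - (\<Sum>k<n. \<Sum>l<n. (gram S w e (\<lambda>v. nu v ^ r) k l)\<^sup>2)
     \<le> real r * F\<^sup>2"
proof -
  let ?f = "\<lambda>v. nu v ^ r" and ?m = "card S"
  let ?g = "\<lambda>k l. (gram S w e ?f k l)\<^sup>2"
  have par: "gram S w e (\<lambda>v. (?f v)\<^sup>2) k k = (\<Sum>l<?m. ?g k l)" for k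
  proof -
    have "gram S w e (\<lambda>v. (?f v)\<^sup>2) k k = ip (\<lambda>v. ?f v * e k v) (\<lambda>v. ?f v * e k v)"
      by (simp add: gram_def ip_def power2_eq_square mult_ac)
    then show ?thesis unfolding gram_ip parseval .
  qed
  have zero: "?g k l = 0" if "k + r < l" "l < ?m" for k l
  proof -
    have "degree (Polynomial.monom 1 r * E k) \<le> r + k"
      using degree_mult_le[of "Polynomial.monom 1 r" "E k"] deg[of k] degree_monom_le[of "1::real" r] that by auto
    then have "ip (ev (Polynomial.monom 1 r * E k)) (e l) = 0" using that by (intro orth_lower) auto
    then show ?thesis unfolding gram_ip by (simp add: e_def poly_monom)
  qed
  have bound: "(\<Sum>l<?m. ?g k l) \<le> F\<^sup>2" if "k < n" for k
  proof -
    have "(\<Sum>l<?m. ?g k l) = gram S w e (\<lambda>v. (?f v)\<^sup>2) k k" by (rule par[symmetric])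
    also have "\<dots> = (\<Sum>v\<in>S. (?f v)\<^sup>2 * (e k v * e k v * w v))"
      unfolding gram_def by (simp add: mult_ac)
    also have "\<dots> \<le> (\<Sum>v\<in>S. F\<^sup>2 * (e k v * e k v * w v))"
      using F pos by (intro sum_mono mult_right_mono) (auto simp: abs_le_square_iff[symmetric] less_imp_le intro: order.trans[OF _ abs_ge_self])
    also have "\<dots> = F\<^sup>2 * ip (e k) (e k)" by (simp add: ip_def sum_distrib_left)
    finally show ?thesis using orthonormal[of k k] that n by simp
  qed
  \<comment> \<open>By Parseval the difference is the squared norm of the block with
    \<open>k < n \<le> l\<close>.\<close>
  have "(\<Sum>k<n. gram S w e (\<lambda>v. (?f v)\<^sup>2) k k) - (\<Sum>k<n. \<Sum>l<n. ?g k l) = (\<Sum>k<n. \<Sum>l\<in>{n..<?m}. ?g k l)"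
  proof -
    have "{..<?m} = {..<n} \<union> {n..<?m}" using n by auto
    then have "(\<Sum>l<?m. ?g k l) = (\<Sum>l<n. ?g k l) + (\<Sum>l\<in>{n..<?m}. ?g k l)" for k
      by (simp add: sum.union_disjoint ivl_disj_int)
    then show ?thesis unfolding par by (simp add: sum.distrib)
  qed
  also have "\<dots> = (\<Sum>k\<in>{n - r..<n}. \<Sum>l\<in>{n..<?m}. ?g k l)"
    by (intro sum.mono_neutral_right) (auto intro!: sum.neutral zero)
  also have "\<dots> \<le> (\<Sum>k\<in>{n - r..<n}. F\<^sup>2)"
  proof (intro sum_mono)
    fix k assume k: "k \<in> {n - r..<n}"
    have "(\<Sum>l\<in>{n..<?m}. ?g k l) \<le> (\<Sum>l<?m. ?g k l)" by (intro sum_mono2) auto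
    then show "(\<Sum>l\<in>{n..<?m}. ?g k l) \<le> F\<^sup>2" using bound[of k] k by auto
  qed
  also have "\<dots> \<le> real r * F\<^sup>2" by (auto intro!: mult_right_mono)
  finally show ?thesis .
qed

end

section \<open>The q-Racah difference operator\<close>

text \<open>The coefficients of the \<open>q\<close>-difference equation of the \<open>q\<close>-Racah polynomials, as functions of
  \<open>X = p\<^sup>y\<close>. The denominator of \<open>qD\<close> may vanish at \<open>y = 0\<close> and that of \<open>qB\<close> at \<open>y = M n\<close>; the numerators vanish
  there as well, so the value is \<open>0\<close>, as it has to be.\<close>

definition qB :: "real \<Rightarrow> real \<Rightarrow> real \<Rightarrow> real \<Rightarrow> real \<Rightarrow> real \<Rightarrow> real" where
  "qB \<alpha> \<beta> \<delta> p g X = (1 - \<alpha> * p * X) * (1 - \<beta> * \<delta> * p * X) * (1 - g * p * X) * (1 - g * \<delta> * p * X)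
     / ((1 - g * \<delta> * p * X\<^sup>2) * (1 - g * \<delta> * p\<^sup>2 * X\<^sup>2))"

definition qD :: "real \<Rightarrow> real \<Rightarrow> real \<Rightarrow> real \<Rightarrow> real \<Rightarrow> real \<Rightarrow> real" where
  "qD \<alpha> \<beta> \<delta> p g X = p * (1 - X) * (1 - \<delta> * X) * (\<beta> - g * X) * (\<alpha> - g * \<delta> * X)
     / ((1 - g * \<delta> * X\<^sup>2) * (1 - g * \<delta> * p * X\<^sup>2))"

text \<open>The constant makes constant functions eigenvectors, with eigenvalue
  \<open>1 + \<alpha> * \<beta> * p\<close>. Since \<open>p\<close> and \<open>g\<close> are
  arguments, the limiting coefficients are the same functions at \<open>p = 1\<close>.\<close>

definition qc :: "real \<Rightarrow> real \<Rightarrow> real \<Rightarrow> real \<Rightarrow> real \<Rightarrow> real \<Rightarrow> real" where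
  "qc \<alpha> \<beta> \<delta> p g X = 1 + \<alpha> * \<beta> * p - qB \<alpha> \<beta> \<delta> p g X - qD \<alpha> \<beta> \<delta> p g X"

lemma qpoch_0 [simp]: "qpoch x p 0 = 1"
  by (simp add: qpoch_def)

lemma qpoch_Suc: "qpoch x p (Suc k) = qpoch x p k * (1 - x * p ^ k)"
  by (simp add: qpoch_def)

lemma qpoch_Suc_shift: "qpoch x p (Suc k) = (1 - x) * qpoch (x * p) p k"
  unfolding qpoch_def prod.lessThan_Suc_shift by (simp add: mult_ac)

text \<open>With X = p^y and P = p^(j+1), this is what remains of the action of the operator on a
  basis polynomial after the common q-shifted factorials are removed and the denominators of even
  index have cancelled.\<close>

lemma q_racah_operator_identity:
  fixes \<alpha> \<beta> \<delta> p g X P :: real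
  assumes "X \<noteq> 0" "p \<noteq> 0" "P \<noteq> 0" "1 - g * \<delta> * p * X\<^sup>2 \<noteq> 0"
  shows "- (1 - P) / (1 - g * \<delta> * p * X\<^sup>2) *
     ((1 - \<alpha> * p * X) * (1 - \<beta> * \<delta> * p * X) * (1 - g * p * X) * (1 - g * \<delta> * X * P) / (p * X)
       + p * (1 - \<delta> * X) * (\<beta> - g * X) * (\<alpha> - g * \<delta> * X) * (1 - P / (p * X)))
    = (1 / P + \<alpha> * \<beta> * p * P - 1 - \<alpha> * \<beta> * p) * (1 - P / (p * X)) * (1 - g * \<delta> * X * P)
      - (1 - P) * (1 - \<alpha> * P) * (1 - \<beta> * \<delta> * P) * (1 - g * P) / P"
proof -
  define h where "h = 1 - g * \<delta> * p * X\<^sup>2"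
  have h: "h \<noteq> 0" using assms by (simp add: h_def)
  have "- (P * ((1 - \<alpha> * p * X) * (1 - \<beta> * \<delta> * p * X) * (1 - g * p * X) * (1 - g * \<delta> * X * P))
       + P * (p * (1 - \<delta> * X) * (\<beta> - g * X) * (\<alpha> - g * \<delta> * X) * (p * X - P)))
    = ((1 - \<alpha> * \<beta> * p * P) * (p * X - P) * (1 - g * \<delta> * X * P)
      - p * X * ((1 - \<alpha> * P) * (1 - \<beta> * \<delta> * P) * (1 - g * P))) * h"
    unfolding h_def by Groebner_Basis.algebra
  then have "- (1 - P) * ((1 - \<alpha> * p * X) * (1 - \<beta> * \<delta> * p * X) * (1 - g * p * X) * (1 - g * \<delta> * X * P) / (p * X)
       + p * (1 - \<delta> * X) * (\<beta> - g * X) * (\<alpha> - g * \<delta> * X) * (1 - P / (p * X)))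
    = (1 - P) * (((1 - \<alpha> * \<beta> * p * P) / P * (1 - P / (p * X)) * (1 - g * \<delta> * X * P)
      - (1 - \<alpha> * P) * (1 - \<beta> * \<delta> * P) * (1 - g * P) / P) * h)"
    using assms(1-3) by (simp add: divide_simps) Groebner_Basis.algebra
  moreover have "1 / P + \<alpha> * \<beta> * p * P - 1 - \<alpha> * \<beta> * p = (1 - P) * ((1 - \<alpha> * \<beta> * p * P) / P)"
    using assms(3) by (simp add: field_simps)
  moreover have "- (1 - P) / h * Z = (1 - P) * V" if "- (1 - P) * Z = (1 - P) * (V * h)" for Z V
  proof -
    have "- (1 - P) / h * Z = (- (1 - P) * Z) / h" by simp
    then show ?thesis unfolding that using h by simp
  qed
  moreover have "k * a * b * c - k * x * y * z / P = k * (a * b * c - x * y * z / P)" for k a b c x y z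
    by (simp add: algebra_simps)
  ultimately show ?thesis unfolding h_def[symmetric] by presburger
qed

lemma downward_closed_nat_eq_lessThan:
  fixes S :: "nat set"
  assumes "finite S" "\<And>x y. x \<in> S \<Longrightarrow> y < x \<Longrightarrow> y \<in> S"
  shows "S = {..<card S}"
proof (cases "S = {}")
  case False
  have "S = {..Max S}"
  proof (intro subset_antisym subsetI)
    fix y assume "y \<in> {..Max S}"
    then show "y \<in> S" using assms(2)[OF Max_in[OF assms(1) False], of y] Max_in[OF assms(1) False]
      by (cases "y = Max S") auto
  qed (use assms(1) in auto)
  then have "card S = Suc (Max S)" by (metis card_atMost)
  then show ?thesis using \<open>S = {..Max S}\<close> by (simp add: lessThan_Suc_atMost)
qed simp

section \<open>Denominators, support and reversibility of the q-Racah weight\<close>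

locale racah =
  fixes q \<alpha> \<beta> \<delta> :: real and M :: "nat \<Rightarrow> nat" and n :: nat
  assumes q: "q > 0" "q \<noteq> 1" and n: "n \<ge> 1" and N: "M n \<ge> 1" and adm: "admissible q \<alpha> \<beta> \<delta> M n"
begin

abbreviation "p \<equiv> qbase q n"
abbreviation "g \<equiv> gam q M n"
abbreviation "w \<equiv> weight q \<alpha> \<beta> \<delta> M n"
abbreviation "nu \<equiv> node q \<delta> M n"

definition S where "S = {y\<in>{0..M n}. w y > 0}"
definition Bc where "Bc y = qB \<alpha> \<beta> \<delta> p g (p ^ y)"
definition Dc where "Dc y = qD \<alpha> \<beta> \<delta> p g (p ^ y)"
definition Cc where "Cc y = qc \<alpha> \<beta> \<delta> p g (p ^ y)"
definition Lam where "Lam k = inverse (p ^ k) + \<alpha> * \<beta> * p ^ Suc k"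
definition T where "T f y = Bc y * f (Suc y) + Cc y * f y + Dc y * f (y - 1)"
definition h where "h j = 1 - g * \<delta> * p ^ j"

lemma p: "p > 0" "p \<noteq> 1"
  using q n by (auto simp: qbase_def powr_eq_one_iff_gen)

lemma p_pow: "p ^ y = q powr (real y / real n)"
  using q p(1) by (simp add: qbase_def powr_powr flip: powr_realpow)

lemma gp: "g * p ^ Suc (M n) = 1"
  unfolding p_pow gam_def using n q by (simp add: powr_add[symmetric] divide_simps add.commute)

lemma nz: "\<alpha> \<noteq> 0" "\<beta> \<noteq> 0" and den: "y \<le> M n \<Longrightarrow> weight_den q \<alpha> \<beta> \<delta> M n y \<noteq> 0"
  and w_nonneg: "y \<le> M n \<Longrightarrow> w y \<ge> 0"
  using adm by (auto simp: admissible_def)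

lemma node_diff: "nu (Suc y) - nu y = (1 - p) / p ^ Suc y * h (2 * y + 2)"
  using p unfolding node_def h_def by (simp add: divide_simps power_add power2_eq_square power_mult) Groebner_Basis.algebra

text \<open>By \<open>node_diff\<close> consecutive nodes differ by \<open>h (2 * y + 2)\<close>
  times a factor of fixed sign, so monotone nodes mean that these values share one sign, carried by
  \<open>s\<close>.\<close>

lemma h_sign: obtains s :: real where "s \<noteq> 0" "\<And>y. y < M n \<Longrightarrow> s * h (2 * y + 2) > 0"
proof -
  consider "strict_mono_on {0..M n} nu" | "strict_antimono_on {0..M n} nu"
    using adm by (auto simp: admissible_def)
  then show ?thesis
  proof cases
    case 1
    have "(1 - p) * h (2 * y + 2) > 0" if "y < M n" for y
    proof -
      have "nu y < nu (Suc y)" using 1 that by (auto simp: monotone_on_def)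
      then have "(1 - p) * h (2 * y + 2) / p ^ Suc y > 0" using node_diff[of y] by simp
      then show ?thesis using p(1) zero_less_power[OF p(1), of "Suc y"]
        by (auto simp: zero_less_divide_iff simp del: power_Suc)
    qed
    then show ?thesis using that[of "1 - p"] p by auto
  next
    case 2
    have "(p - 1) * h (2 * y + 2) > 0" if "y < M n" for y
    proof -
      have "nu y > nu (Suc y)" using 2 that by (auto simp: monotone_on_def)
      then have "(p - 1) * h (2 * y + 2) / p ^ Suc y > 0" 
      proof -
        have "(p - 1) * h (2 * y + 2) / p ^ Suc y = - (nu (Suc y) - nu y)"
          unfolding node_diff by (simp add: divide_inverse algebra_simps)
        then show ?thesis using \<open>nu (Suc y) < nu y\<close> by simp
      qed
      then show ?thesis using p(1) zero_less_power[OF p(1), of "Suc y"]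
        by (auto simp: zero_less_divide_iff simp del: power_Suc)
    qed
    then show ?thesis using that[of "p - 1"] p by auto
  qed
qed

lemma inj_nu: "inj_on nu {0..M n}"
proof (rule inj_onI, rule ccontr)
  fix x y assume xy: "x \<in> {0..M n}" "y \<in> {0..M n}" "nu x = nu y" "x \<noteq> y"
  have "nu a \<noteq> nu b" if "a < b" "a \<in> {0..M n}" "b \<in> {0..M n}" for a b
    using adm that unfolding admissible_def monotone_on_def by (metis less_irrefl)
  then show False using xy by (metis linorder_neqE_nat)
qed

text \<open>\<open>h\<close> is monotone in its index because \<open>p ^ j\<close> is, so it keeps a
  sign that it has at both ends.\<close>

lemma h_between:
  assumes "s * h i > 0" "s * h k > 0" "i \<le> j" "j \<le> k"
  shows "s * h j > 0"
proof -
  have "(p ^ i \<le> p ^ j \<and> p ^ j \<le> p ^ k) \<or> (p ^ k \<le> p ^ j \<and> p ^ j \<le> p ^ i)"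
    using p assms by (cases "p < 1") (auto intro: power_decreasing power_increasing)
  then have "(s * (g * \<delta>)) * p ^ j \<le> (s * (g * \<delta>)) * p ^ i \<or> (s * (g * \<delta>)) * p ^ j \<le> (s * (g * \<delta>)) * p ^ k"
    by (cases "s * (g * \<delta>) \<ge> 0") (auto intro: mult_left_mono mult_left_mono_neg)
  then show ?thesis using assms by (auto simp: h_def algebra_simps)
qed

text \<open>These indices cover every \<open>h\<close> in a denominator of the weight or the
  operator, except in \<open>Dc 0\<close> and \<open>Bc (M n)\<close>. Interior indices lie between
  even ones whose sign is fixed by the monotone nodes; the two ends come from the well-definedness
  of the weight.\<close>

lemma h_nonzero:
  assumes "1 \<le> j" "j \<le> 2 * M n + 1"
  shows "h j \<noteq> 0"
proof -
  obtain s where s: "s \<noteq> 0" "\<And>y. y < M n \<Longrightarrow> s * h (2 * y + 2) > 0" using h_sign by blast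
  consider "j = 1" | "j = 2 * M n + 1" | "2 \<le> j" "j \<le> 2 * M n" using assms by linarith
  then show ?thesis
  proof cases
    case 1
    then show ?thesis using den[of 0] by (simp add: weight_den_def Let_def h_def)
  next
    \<comment> \<open>As \<open>g * p ^ Suc (M n) = 1\<close>, this \<open>h j\<close> is 1 -
      \<delta> p^(M n), the last factor of a shifted factorial in the denominator of the weight at
      \<open>M n\<close>.\<close>
    case 2
    have "qpoch (\<delta> * p) p (M n) \<noteq> 0" using den[of "M n"] by (simp add: weight_den_def Let_def)
    then have "1 - \<delta> * p * p ^ (M n - 1) \<noteq> 0" using N unfolding qpoch_def by auto
    moreover have "\<delta> * p * p ^ (M n - 1) = \<delta> * p ^ M n" using N by (cases "M n") auto
    moreover have "g * \<delta> * p ^ j = \<delta> * p ^ M n * (g * p ^ Suc (M n))"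
      unfolding 2 by (simp add: mult_2 power_add)
    ultimately show ?thesis unfolding h_def gp by (simp only: mult_1_right) (metis eq_iff_diff_eq_0)
  next
    case 3
    obtain m where "M n = Suc m" using N by (cases "M n") auto
    then have "s * h 2 > 0" "s * h (2 * M n) > 0" using s(2)[of 0] s(2)[of m]
      by (simp_all add: numeral_2_eq_2)
    then show ?thesis using h_between[of s 2 "2 * M n" j] 3 by auto
  qed
qed

definition Nq where "Nq y = qpoch (\<alpha> * p) p y * qpoch (\<beta> * \<delta> * p) p y * qpoch (g * p) p y * qpoch (g * \<delta> * p) p y"
definition Dq where "Dq y = qpoch p p y * qpoch (inverse \<alpha> * g * \<delta> * p) p y * qpoch (inverse \<beta> * g * p) p y
     * qpoch (\<delta> * p) p y * (\<alpha> * \<beta> * p) ^ y"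

lemma w_eq: "w y = Nq y * h (2 * y + 1) / (Dq y * h 1)"
  by (simp add: weight_def weight_num_def weight_den_def Let_def Nq_def Dq_def h_def)

lemma Dq_nonzero: "y \<le> M n \<Longrightarrow> Dq y \<noteq> 0"
  using den[of y] by (simp add: weight_den_def Let_def Dq_def)

text \<open>This reversibility is what makes \<open>T\<close> symmetric with respect to
  \<open>w\<close>.\<close>

lemma detailed_balance:
  assumes "y < M n"
  shows "w y * Bc y = w (Suc y) * Dc (Suc y)"
proof -
  define nf where "nf = (1 - \<alpha> * p * p ^ y) * (1 - \<beta> * \<delta> * p * p ^ y) * (1 - g * p * p ^ y) * (1 - g * \<delta> * p * p ^ y)"
  define df where "df = p * (1 - p ^ Suc y) * (1 - \<delta> * p ^ Suc y) * (\<beta> - g * p ^ Suc y) * (\<alpha> - g * \<delta> * p ^ Suc y)"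
  have N1: "Nq (Suc y) = Nq y * nf" by (simp add: Nq_def qpoch_Suc nf_def mult_ac)
  have D1: "Dq (Suc y) = Dq y * df"
    using nz by (simp add: Dq_def qpoch_Suc df_def field_simps)
  have H: "h (2 * y + 1) \<noteq> 0" "h (2 * y + 2) \<noteq> 0" "h (2 * Suc y + 1) \<noteq> 0" "h 1 \<noteq> 0"
    using assms by (simp_all add: h_nonzero)
  have D0: "Dq y \<noteq> 0" "df \<noteq> 0" using Dq_nonzero[of y] Dq_nonzero[of "Suc y"] assms D1 by auto
  have B: "Bc y = nf / (h (2 * y + 1) * h (2 * y + 2))"
    by (simp add: Bc_def qB_def nf_def h_def power_add power_mult power2_eq_square mult_ac)
  have D: "Dc (Suc y) = df / (h (2 * y + 2) * h (2 * Suc y + 1))"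
    by (simp add: Dc_def qD_def df_def h_def power_add power_mult power2_eq_square mult_ac)
  show ?thesis unfolding w_eq N1 D1 B D using H D0 by (simp add: field_simps)
qed

text \<open>The numerator \<open>Nq\<close> consists of products over initial ranges, so once it
  vanishes it stays 0 and the support is an initial segment.\<close>

lemma S_eq: "S = {..<card S}"
proof (rule downward_closed_nat_eq_lessThan)
  fix x y assume x: "x \<in> S" and y: "y < x"
  have "Nq x \<noteq> 0" using x by (auto simp: S_def w_eq)
  then have "Nq y \<noteq> 0" using y unfolding Nq_def qpoch_def by (auto dest!: order.strict_trans)
  then have "w y \<noteq> 0" using x y h_nonzero[of "2 * y + 1"] h_nonzero[of 1] Dq_nonzero[of y]
    by (auto simp: w_eq S_def)
  then show "y \<in> S" using w_nonneg[of y] x y by (auto simp: S_def)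
qed (simp add: S_def)

lemma S_le: "y \<in> S \<Longrightarrow> y \<le> M n" and w_pos: "y \<in> S \<Longrightarrow> w y > 0" and finite_S: "finite S"
  by (auto simp: S_def)

lemma S_sub: "S \<subseteq> {0..M n}"
  by (auto simp: S_def)

lemma w_zero: "y \<le> M n \<Longrightarrow> y \<notin> S \<Longrightarrow> w y = 0"
  using w_nonneg[of y] by (auto simp: S_def)

lemma zero_in_S: "0 \<in> S"
  using h_nonzero[of 1] by (simp add: S_def w_eq Nq_def Dq_def)

lemma card_S_le: "card S \<le> Suc (M n)"
  using card_mono[of "{0..M n}" S] by (simp add: S_sub)

text \<open>The support ends either at \<open>M n\<close>, where
  \<open>g * p ^ Suc (M n) = 1\<close> makes a factor of the numerator vanish, or earlier, where the
  next weight is 0 and detailed balance forces the coefficient to be 0.\<close>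

lemma Bc_boundary:
  assumes "y \<in> S" "Suc y \<notin> S"
  shows "Bc y = 0"
proof (cases "y = M n")
  case True
  have "g * p * p ^ y = 1" using gp True by (simp add: mult_ac)
  then show ?thesis by (simp add: Bc_def qB_def)
next
  case False
  then have "w y * Bc y = 0" using detailed_balance[of y] S_le[OF assms(1)] w_zero[of "Suc y"] assms(2) by simp
  then show ?thesis using w_pos[OF assms(1)] by simp
qed

lemma Dc_0: "Dc 0 = 0"
  by (simp add: Dc_def qD_def)

text \<open>The individual signs are not controlled, but by detailed balance the product is a
  positive multiple of a square.\<close>

lemma Bc_Dc_nonneg:
  assumes "Suc y \<in> S"
  shows "Bc y * Dc (Suc y) \<ge> 0"
proof -
  have y: "y \<in> S" "y < M n" using assms S_eq S_le[OF assms] by (metis Suc_lessD lessThan_iff, simp)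
  have "w (Suc y) * (Bc y * Dc (Suc y)) = w y * (Bc y)\<^sup>2"
    using detailed_balance[OF y(2)] by (simp add: power2_eq_square)
  also have "\<dots> \<ge> 0" using w_pos[OF y(1)] by simp
  finally show ?thesis using w_pos[OF assms] by (simp add: zero_le_mult_iff)
qed

sublocale op: op_system S nu w
  by unfold_locales (use finite_S w_pos inj_on_subset[OF inj_nu S_sub] in auto)

text \<open>Summation by parts: \<open>U\<close> collects the upward steps, and detailed balance
  turns the downward steps into \<open>U\<close> with exchanged arguments. The boundary terms carry
  \<open>Dc 0\<close> and \<open>Bc\<close> at the last point, both 0; this also disposes of the
  truncated \<open>v - 1\<close> at 0.\<close>

lemma T_selfadjoint: "op.ip (T f) k = op.ip f (T k)"
proof -
  define m where "m = card S"
  have "S = {..<m}" unfolding m_def by (rule S_eq)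
  moreover have "m \<ge> 1" unfolding m_def using zero_in_S finite_S by (auto simp: Suc_le_eq card_gt_0_iff)
  ultimately have m: "S = {..<m}" "m \<ge> 1" by auto
  have "m - 1 \<in> S" "Suc (m - 1) \<notin> S" unfolding m(1) using m(2) by auto
  then have Bz: "Bc (m - 1) = 0" by (rule Bc_boundary)
  define U where "U f k = (\<Sum>v<m - 1. w v * Bc v * f (Suc v) * k v)" for f k :: "nat \<Rightarrow> real"
  have m': "{..<m} = {..<Suc (m - 1)}" using m(2) by simp
  have up: "(\<Sum>v<m. Bc v * f (Suc v) * k v * w v) = U f k" for f k :: "nat \<Rightarrow> real"
    unfolding m' U_def sum.lessThan_Suc Bz by (simp add: mult_ac)
  have down: "(\<Sum>v<m. Dc v * f (v - 1) * k v * w v) = U k f" for f k :: "nat \<Rightarrow> real"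
  proof -
    have "(\<Sum>v<m. Dc v * f (v - 1) * k v * w v) = (\<Sum>v<m - 1. Dc (Suc v) * f v * k (Suc v) * w (Suc v))"
      unfolding m' sum.lessThan_Suc_shift by (simp add: Dc_0)
    also have "\<dots> = U k f" unfolding U_def
    proof (rule sum.cong[OF refl])
      fix v assume "v \<in> {..<m - 1}"
      then have "Suc v \<in> S" unfolding m(1) by auto
      from S_le[OF this] have "v < M n" by simp
      from detailed_balance[OF this]
      show "Dc (Suc v) * f v * k (Suc v) * w (Suc v) = w v * Bc v * k (Suc v) * f v" by simp
    qed
    finally show ?thesis .
  qed
  have ipT: "op.ip (T f) k = U f k + (\<Sum>v<m. Cc v * f v * k v * w v) + U k f" for f k
  proof -
    have "op.ip (T f) k = (\<Sum>v<m. Bc v * f (Suc v) * k v * w v + Cc v * f v * k v * w v + Dc v * f (v - 1) * k v * w v)"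
      unfolding op.ip_def T_def by (rule sum.cong[OF m(1)]) (simp add: distrib_right)
    then show ?thesis by (simp only: sum.distrib up down)
  qed
  have "op.ip f (T k) = op.ip (T k) f" by (rule op.ip_commute)
  then show ?thesis unfolding ipT by (simp add: mult_ac)
qed

section \<open>Triangularity of the difference operator on polynomials\<close>

definition Phi where "Phi k = (\<Prod>s<k. [:1 + g * \<delta> * p ^ (2 * s + 1), - (p ^ s):])"

text \<open>These products are the variable part of the hypergeometric series of the q-Racah
  polynomials. The factors with the same power p^s in the two factorials multiply to an affine
  function of \<open>nu y\<close>, so the product is a polynomial in the node.\<close>

lemma ev_Phi: "op.ev (Phi k) y = qpoch (inverse (p ^ y)) p k * qpoch (g * \<delta> * p * p ^ y) p k"
proof -
  define X where "X = p ^ y"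
  have X: "X * inverse X = 1" using p by (simp add: X_def)
  have nu: "nu y = inverse X + \<delta> * g * (p * X)" by (simp add: node_def X_def mult_ac)
  have "1 + g * \<delta> * p ^ (2 * s + 1) - p ^ s * nu y = (1 - inverse X * p ^ s) * (1 - g * \<delta> * p * X * p ^ s)" for s
  proof -
    have "(1 - inverse X * t) * (1 - g * \<delta> * p * X * t) = 1 - t * (inverse X + \<delta> * g * (p * X)) + g * \<delta> * (t * t * p) * (X * inverse X)" for t
      by (simp add: algebra_simps)
    then show ?thesis unfolding nu X by (simp add: power_add power_mult power2_eq_square power_mult_distrib mult_2)
  qed
  then show ?thesis unfolding Phi_def qpoch_def poly_prod X_def[symmetric]
    by (simp add: prod.distrib[symmetric] mult_ac)
qed

lemma degree_Phi: "degree (Phi k) = k \<and> Phi k \<noteq> 0"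
proof (induction k)
  case (Suc k)
  let ?l = "[:1 + g * \<delta> * p ^ (2 * k + 1), - (p ^ k):]"
  have "p ^ k \<noteq> 0" using p by simp
  then have l: "degree ?l = 1" "?l \<noteq> 0" by auto
  have S: "Phi (Suc k) = Phi k * ?l" by (simp only: Phi_def prod.lessThan_Suc)
  have "degree (Phi (Suc k)) = Suc k" unfolding S using Suc l by (subst degree_mult_eq) simp_all
  moreover have "Phi (Suc k) \<noteq> 0" unfolding S using Suc l by (simp only: mult_eq_0_iff) simp
  ultimately show ?case by simp
qed (simp add: Phi_def)

text \<open>The operator is bidiagonal in this basis. As constants are eigenvectors, it suffices to
  compute the forward difference with \<open>Bc\<close> and the backward difference with
  \<open>Dc\<close>; both are multiples of \<open>a * c\<close>, and \<open>h2\<close> and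
  \<open>h0\<close> cancel.\<close>

lemma T_Phi:
  assumes "y \<le> M n"
  shows "T (op.ev (Phi (Suc j))) y = Lam (Suc j) * op.ev (Phi (Suc j)) y
     - (1 - p ^ Suc j) * (1 - \<alpha> * p ^ Suc j) * (1 - \<beta> * \<delta> * p ^ Suc j) * (1 - g * p ^ Suc j) / p ^ Suc j * op.ev (Phi j) y"
proof -
  define X where "X = p ^ y"
  define P where "P = p ^ Suc j"
  define a where "a = qpoch (inverse X) p j"
  define c where "c = qpoch (g * \<delta> * p * X) p j"
  define h0 where "h0 = 1 - g * \<delta> * X\<^sup>2"
  define h1 where "h1 = 1 - g * \<delta> * p * X\<^sup>2"
  define h2 where "h2 = 1 - g * \<delta> * p\<^sup>2 * X\<^sup>2"
  define B' where "B' = (1 - \<alpha> * p * X) * (1 - \<beta> * \<delta> * p * X) * (1 - g * p * X)"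
  define D' where "D' = p * (1 - \<delta> * X) * (\<beta> - g * X) * (\<alpha> - g * \<delta> * X)"
  let ?f = "op.ev (Phi (Suc j))"
  have X: "X \<noteq> 0" "P \<noteq> 0" "p \<noteq> 0" using p by (auto simp: X_def P_def)
  have pj: "p ^ j = P / p" using p by (simp add: P_def)
  have h1': "h1 = h (2 * y + 1)" and h2': "h2 = h (2 * y + 2)" and h0': "h0 = h (2 * y)"
    by (auto simp: h1_def h2_def h0_def h_def X_def power_add power_mult power2_eq_square mult_ac)
  have h1: "h1 \<noteq> 0" unfolding h1' using assms by (intro h_nonzero) auto
  have fj: "op.ev (Phi j) y = a * c" by (simp add: ev_Phi a_def c_def X_def)
  have f: "?f y = a * c * (1 - P / (p * X)) * (1 - g * \<delta> * X * P)"
    using X by (simp add: ev_Phi a_def c_def X_def[symmetric] qpoch_Suc pj field_simps)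
  \<comment> \<open>The factor on the left occurs in \<open>Bc\<close>; it prolongs the shifted
    factorial at its lower end, so that the result can be compared with \<open>c\<close>.\<close>
  have up: "(1 - g * \<delta> * p * X) * ?f (Suc y) = (1 - 1 / (p * X)) * a * c * (1 - g * \<delta> * X * P) * (1 - g * \<delta> * p * X * P)"
  proof -
    have "qpoch (inverse (p ^ Suc y)) p (Suc j) = (1 - 1 / (p * X)) * a"
      unfolding qpoch_Suc_shift a_def X_def using p by (simp add: field_simps)
    moreover have "(1 - g * \<delta> * p * X) * qpoch (g * \<delta> * p * p ^ Suc y) p (Suc j) = qpoch (g * \<delta> * p * X) p (Suc (Suc j))"
      unfolding qpoch_Suc_shift[of _ _ "Suc j"] X_def by (simp add: mult_ac)
    moreover have "qpoch (g * \<delta> * p * X) p (Suc (Suc j)) = c * (1 - g * \<delta> * X * P) * (1 - g * \<delta> * p * X * P)"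
      using X by (simp add: qpoch_Suc c_def pj)
    moreover have "r * (s * t) = s * (r * t)" for r s t :: real by simp
    ultimately show ?thesis unfolding ev_Phi by (simp only: mult.assoc)
  qed
  \<comment> \<open>At \<open>y = M n\<close> the denominator \<open>h2\<close> may vanish, but
    there \<open>B' = 0\<close> and both sides are 0.\<close>
  have "Bc y * (?f (Suc y) - ?f y) = - (1 - P) * B' * (1 - g * \<delta> * X * P) / (p * X) * a * c / h1"
  proof (cases "B' = 0")
    case True
    then show ?thesis by (auto simp: Bc_def qB_def X_def[symmetric] B'_def)
  next
    case False
    have "y \<noteq> M n"
    proof
      assume "y = M n"
      then have "g * p * X = 1" using gp by (simp add: X_def mult_ac)
      then show False using False by (simp add: B'_def)
    qed
    then have h2: "h2 \<noteq> 0" unfolding h2' using assms by (intro h_nonzero) auto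
    have "Bc y * (?f (Suc y) - ?f y) = B' / (h1 * h2) * ((1 - g * \<delta> * p * X) * ?f (Suc y) - (1 - g * \<delta> * p * X) * ?f y)"
      by (simp add: Bc_def qB_def X_def[symmetric] B'_def h1_def h2_def algebra_simps)
    also have "(1 - g * \<delta> * p * X) * ?f (Suc y) - (1 - g * \<delta> * p * X) * ?f y
      = - (1 - P) * (1 / (p * X)) * h2 * (a * c * (1 - g * \<delta> * X * P))"
    proof -
      have "(1 - 1 / (p * X)) * (1 - g * \<delta> * p * X * P) - (1 - g * \<delta> * p * X) * (1 - P / (p * X))
        = - (1 - P) * (1 / (p * X)) * h2"
        unfolding h2_def using X by (simp add: field_simps power2_eq_square)
      moreover have "u * a * c * m * v - r * (a * c * t * m) = (u * v - r * t) * (a * c * m)" for u v r t m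
        by (simp add: algebra_simps)
      ultimately show ?thesis unfolding up f by presburger
    qed
    also have "B' / (h1 * h2) * \<dots> = - (1 - P) * B' * (1 - g * \<delta> * X * P) / (p * X) * a * c / h1"
      using h2 by (simp add: mult_ac)
    finally show ?thesis .
  qed
  moreover have "Dc y * (?f (y - 1) - ?f y) = - (1 - P) * D' * (1 - P / (p * X)) * a * c / h1"
  proof (cases y)
    \<comment> \<open>Here \<open>h0\<close> may vanish. The left side is 0 by \<open>Dc_0\<close>,
      and on the right the shifted factorial contains the factor 1 - 1.\<close>
    case 0
    have "a * (1 - P / (p * X)) = qpoch 1 p (Suc j)" using X 0 by (simp add: a_def X_def qpoch_Suc pj)
    also have "\<dots> = 0" by (simp add: qpoch_Suc_shift)
    finally show ?thesis using X 0 by (auto simp: Dc_0)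
  next
    case (Suc z)
    have h0: "h0 \<noteq> 0" unfolding h0' using assms Suc by (intro h_nonzero) auto
    have Xz: "p ^ z = X / p" using p Suc by (simp add: X_def)
    have "qpoch (g * \<delta> * p * p ^ z) p (Suc j) = (1 - g * \<delta> * X) * c"
      unfolding qpoch_Suc_shift Xz c_def using p by (simp add: mult_ac)
    moreover have "(1 - X) * qpoch (inverse (p ^ z)) p (Suc j) = - X * (a * (1 - P / (p * X)) * (1 - P / X))"
    proof -
      have "(1 - X) * qpoch (inverse (p ^ z)) p (Suc j) = - X * ((1 - inverse X) * qpoch (inverse X * p) p (Suc j))"
        using X p by (simp add: Xz field_simps)
      also have "(1 - inverse X) * qpoch (inverse X * p) p (Suc j) = qpoch (inverse X) p (Suc (Suc j))"
        by (simp only: qpoch_Suc_shift[of _ _ "Suc j"])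
      also have "\<dots> = a * (1 - P / (p * X)) * (1 - P / X)"
        using X by (simp add: qpoch_Suc a_def pj field_simps)
      finally show ?thesis .
    qed
    ultimately have down: "(1 - X) * ?f z = - X * (a * (1 - P / (p * X)) * (1 - P / X)) * ((1 - g * \<delta> * X) * c)"
      unfolding ev_Phi by (simp only: mult.assoc[symmetric])
    have "Dc y = D' / (h0 * h1) * (1 - X)"
      unfolding Dc_def qD_def X_def[symmetric] D'_def h0_def h1_def by simp
    then have "Dc y * (?f (y - 1) - ?f y) = D' / (h0 * h1) * ((1 - X) * ?f z - (1 - X) * ?f y)"
      by (simp only: Suc diff_Suc_1 right_diff_distrib[symmetric] mult.assoc)
    also have "(1 - X) * ?f z - (1 - X) * ?f y = - (1 - P) * h0 * (a * c * (1 - P / (p * X)))"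
    proof -
      have "- X * (1 - P / X) * (1 - g * \<delta> * X) - (1 - X) * (1 - g * \<delta> * X * P) = - (1 - P) * h0"
        unfolding h0_def using X by (simp add: field_simps power2_eq_square)
      moreover have "u * (a * m * v) * (r * c) - t * (a * c * m * s) = (u * v * r - t * s) * (a * c * m)" for u v r t m s
        by (simp add: algebra_simps)
      ultimately show ?thesis unfolding down f by presburger
    qed
    also have "D' / (h0 * h1) * \<dots> = - (1 - P) * D' * (1 - P / (p * X)) * a * c / h1"
      using h0 by (simp add: mult_ac)
    finally show ?thesis .
  qed
  moreover have "T ?f y = (1 + \<alpha> * \<beta> * p) * ?f y + Bc y * (?f (Suc y) - ?f y) + Dc y * (?f (y - 1) - ?f y)"
    by (simp add: T_def Cc_def qc_def Bc_def Dc_def algebra_simps)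
  moreover have "- (1 - P) * B' * m / (p * X) * a * c / h1 + - (1 - P) * D' * t * a * c / h1
    = - (1 - P) / h1 * (B' * m / (p * X) + D' * t) * (a * c)" for m t
    by (simp add: divide_inverse algebra_simps)
  ultimately have "T ?f y = (1 + \<alpha> * \<beta> * p) * ?f y
     + - (1 - P) / h1 * (B' * (1 - g * \<delta> * X * P) / (p * X) + D' * (1 - P / (p * X))) * (a * c)"
    by (simp only: add.assoc)
  also have "- (1 - P) / h1 * (B' * (1 - g * \<delta> * X * P) / (p * X) + D' * (1 - P / (p * X)))
    = (1 / P + \<alpha> * \<beta> * p * P - 1 - \<alpha> * \<beta> * p) * (1 - P / (p * X)) * (1 - g * \<delta> * X * P)
      - (1 - P) * (1 - \<alpha> * P) * (1 - \<beta> * \<delta> * P) * (1 - g * P) / P"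
    unfolding B'_def D'_def h1_def
    by (rule q_racah_operator_identity) (use X h1 in \<open>auto simp: h1_def\<close>)
  finally have T1: "T ?f y = (1 + \<alpha> * \<beta> * p) * ?f y +
     ((1 / P + \<alpha> * \<beta> * p * P - 1 - \<alpha> * \<beta> * p) * (1 - P / (p * X)) * (1 - g * \<delta> * X * P)
      - (1 - P) * (1 - \<alpha> * P) * (1 - \<beta> * \<delta> * P) * (1 - g * P) / P) * (a * c)" .
  have "(K * s * m - L) * (a * c) = K * (a * c * s * m) - L * (a * c)" for K L s m
    by (simp add: algebra_simps)
  then have "T ?f y = (1 + \<alpha> * \<beta> * p) * ?f y + ((1 / P + \<alpha> * \<beta> * p * P - 1 - \<alpha> * \<beta> * p) * ?f y
      - (1 - P) * (1 - \<alpha> * P) * (1 - \<beta> * \<delta> * P) * (1 - g * P) / P * op.ev (Phi j) y)"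
    unfolding T1 fj by (simp only: f)
  moreover have "Lam (Suc j) = 1 / P + \<alpha> * \<beta> * p * P" by (simp add: Lam_def P_def divide_inverse mult_ac)
  ultimately show ?thesis unfolding P_def[symmetric] by (simp add: algebra_simps)
qed

lemma T_triangular:
  assumes "degree Q \<le> k"
  shows "\<exists>R. degree R \<le> k \<and> coeff R k = Lam k * coeff Q k \<and> (\<forall>v\<le>M n. T (op.ev Q) v = op.ev R v)"
  using assms
proof (induction k arbitrary: Q)
  case 0
  then obtain b where "Q = [:b:]" by (metis degree_eq_zeroE le_zero_eq)
  then show ?case by (intro exI[of _ "[:Lam 0 * b:]"]) (simp add: T_def Cc_def qc_def Bc_def Dc_def Lam_def algebra_simps)
next
  case (Suc k)
  let ?F = "Phi (Suc k)"
  define l where "l = coeff ?F (Suc k)"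
  have l: "l \<noteq> 0" using degree_Phi[of "Suc k"] by (metis l_def leading_coeff_0_iff)
  define t where "t = coeff Q (Suc k) / l"
  define U where "U = Q - Polynomial.smult t ?F"
  have d: "degree U \<le> Suc k" unfolding U_def using degree_Phi Suc.prems by (intro degree_diff_le) auto
  have c: "coeff U (Suc k) = 0" using l by (simp add: U_def t_def l_def)
  have dU: "degree U \<le> k"
  proof (rule degree_le, intro allI impI)
    fix i assume "k < i"
    then show "coeff U i = 0" using c d by (cases "i = Suc k") (auto intro!: coeff_eq_0)
  qed
  from Suc.IH[OF dU] obtain R where R0:
    "degree R \<le> k \<and> coeff R k = Lam k * coeff U k \<and> (\<forall>v\<le>M n. T (op.ev U) v = op.ev R v)" ..
  note R = R0[THEN conjunct1] R0[THEN conjunct2, THEN conjunct2, rule_format]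
  define kap where "kap = (1 - p ^ Suc k) * (1 - \<alpha> * p ^ Suc k) * (1 - \<beta> * \<delta> * p ^ Suc k) * (1 - g * p ^ Suc k) / p ^ Suc k"
  define V where "V = Polynomial.smult (t * Lam (Suc k)) ?F + (R - Polynomial.smult (t * kap) (Phi k))"
  have d: "degree (R - Polynomial.smult (t * kap) (Phi k)) \<le> k"
    using R(1) degree_Phi[of k] by (intro degree_diff_le) auto
  then have "coeff (R - Polynomial.smult (t * kap) (Phi k)) (Suc k) = 0" by (intro coeff_eq_0) simp
  then have "coeff V (Suc k) = Lam (Suc k) * coeff Q (Suc k)"
    unfolding V_def coeff_add using l by (simp add: t_def l_def[symmetric])
  moreover have "degree V \<le> Suc k"
    unfolding V_def using d degree_Phi[of "Suc k"] by (intro degree_add_le) auto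
  moreover have "T (op.ev Q) v = op.ev V v" if "v \<le> M n" for v
  proof -
    have "T (op.ev Q) v = T (op.ev U) v + t * T (op.ev ?F) v" by (simp add: U_def T_def algebra_simps)
    then show ?thesis unfolding R(2)[OF that] T_Phi[OF that] kap_def[symmetric]
      by (simp add: V_def algebra_simps)
  qed
  ultimately show ?case by blast
qed

end

locale racah_basis = racah +
  fixes E :: "nat \<Rightarrow> real poly" and e :: "nat \<Rightarrow> nat \<Rightarrow> real"
  assumes basis: "op_basis S nu w E e"
begin

sublocale ob: op_basis S nu w E e by (rule basis)

lemma eigen:
  assumes "k < card S" "v < card S"
  shows "Lam k * e k v = Bc v * e k (Suc v) + Cc v * e k v + Dc v * e k (v - 1)"
proof -
  have "v \<in> S" by (subst S_eq) (simp add: assms(2))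
  have "T (e k) v = Lam k * e k v"
  proof (rule ob.eigenvector[of Lam T, OF _ T_selfadjoint assms(1) \<open>v \<in> S\<close>])
    fix j and Q :: "real poly" assume "degree Q \<le> j"
    from T_triangular[OF this] S_le
    show "\<exists>R. degree R \<le> j \<and> coeff R j = Lam j * coeff Q j \<and> (\<forall>v\<in>S. T (op.ev Q) v = op.ev R v)" by meson
  qed
  then show ?thesis by (simp add: T_def)
qed

end

lemma (in racah) basis_exists: "\<exists>E e. racah_basis q \<alpha> \<beta> \<delta> M n E e"
proof -
  obtain E where E: "\<And>k. k < card S \<Longrightarrow> degree (E k) = k \<and> E k \<noteq> 0"
       "\<And>k l. k < card S \<Longrightarrow> l < card S \<Longrightarrow> op.ip (op.ev (E k)) (op.ev (E l)) = (if k = l then 1 else 0)"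
    using op.orthonormal_polys_exist by blast
  have "racah_basis q \<alpha> \<beta> \<delta> M n E (\<lambda>k. op.ev (E k))"
    using E by unfold_locales blast+
  then show ?thesis by blast
qed

section \<open>Linear statistics of the ensemble\<close>

text \<open>The sum of the squares has finite integral, so it is finite almost everywhere and its
  terms tend to 0. This is Chebyshev and Borel-Cantelli in one step, for any coupling of the
  variables.\<close>

lemma AE_tendsto_0_of_second_moments:
  fixes Z :: "nat \<Rightarrow> 'w \<Rightarrow> real"
  assumes meas: "\<And>n. n \<ge> n0 \<Longrightarrow> Z n \<in> borel_measurable P"
    and int: "\<And>n. n \<ge> n0 \<Longrightarrow> integrable P (\<lambda>x. (Z n x)\<^sup>2)"
    and bound: "\<And>n. n \<ge> n0 \<Longrightarrow> (\<integral>x. (Z n x)\<^sup>2 \<partial>P) \<le> C / (real n)\<^sup>2"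
  shows "AE x in P. (\<lambda>n. Z n x) \<longlonglongrightarrow> 0"
proof -
  define W where "W n x = (if n \<ge> n0 then (Z n x)\<^sup>2 else 0)" for n x
  have W0: "W n x \<ge> 0" for n x by (simp add: W_def)
  have [measurable]: "W n \<in> borel_measurable P" for n
    unfolding W_def using meas by (cases "n \<ge> n0") auto
  have C: "(\<integral>\<^sup>+x. ennreal (W n x) \<partial>P) \<le> ennreal (\<bar>C\<bar> / (real n)\<^sup>2)" for n
  proof (cases "n \<ge> n0")
    case True
    then have "(\<integral>\<^sup>+x. ennreal (W n x) \<partial>P) = ennreal (\<integral>x. (Z n x)\<^sup>2 \<partial>P)"
      using int by (simp add: W_def nn_integral_eq_integral)
    also have "\<dots> \<le> ennreal (\<bar>C\<bar> / (real n)\<^sup>2)"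
      using bound[OF True] by (intro ennreal_leI order.trans[OF bound[OF True]] divide_right_mono) auto
    finally show ?thesis .
  qed (simp add: W_def)
  have "summable (\<lambda>n. \<bar>C\<bar> / (real n)\<^sup>2)"
    using summable_mult[OF inverse_power_summable[of 2, where 'a = real], of "\<bar>C\<bar>"] by (simp add: divide_inverse)
  then have fin: "(\<Sum>n. ennreal (\<bar>C\<bar> / (real n)\<^sup>2)) < \<infinity>"
    by (subst suminf_ennreal2) auto
  have "(\<integral>\<^sup>+x. (\<Sum>n. ennreal (W n x)) \<partial>P) = (\<Sum>n. \<integral>\<^sup>+x. ennreal (W n x) \<partial>P)"
    by (rule nn_integral_suminf) simp
  also have "\<dots> \<le> (\<Sum>n. ennreal (\<bar>C\<bar> / (real n)\<^sup>2))" by (intro suminf_le C) auto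
  finally have "(\<integral>\<^sup>+x. (\<Sum>n. ennreal (W n x)) \<partial>P) \<noteq> \<infinity>" using fin by (auto simp: top_unique)
  then have "AE x in P. (\<Sum>n. ennreal (W n x)) \<noteq> \<infinity>"
    by (intro nn_integral_PInf_AE) auto
  then show ?thesis
  proof (rule AE_mp, intro AE_I2 impI)
    fix x assume "(\<Sum>n. ennreal (W n x)) \<noteq> \<infinity>"
    then have "summable (\<lambda>n. W n x)" using W0 by (intro summable_suminf_not_top) auto
    then have "(\<lambda>n. W n x) \<longlonglongrightarrow> 0" by (rule summable_LIMSEQ_zero)
    then have "(\<lambda>n. (Z n x)\<^sup>2) \<longlonglongrightarrow> 0"
      by (rule Lim_transform_eventually) (auto simp: W_def eventually_sequentially)
    then have "(\<lambda>n. sqrt ((Z n x)\<^sup>2)) \<longlonglongrightarrow> sqrt 0" by (rule tendsto_real_sqrt)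
    then show "(\<lambda>n. Z n x) \<longlonglongrightarrow> 0" by (simp add: tendsto_rabs_zero_iff)
  qed
qed

section \<open>The ensemble as a determinantal process\<close>

context racah_basis
begin

definition K where "K y = (\<Sum>k<n. (e k y)\<^sup>2) * w y"

lemma gram_eq: "gram {0..M n} w e f k l = gram S w e f k l"
  unfolding gram_def using S_sub by (intro sum.mono_neutral_right) (auto simp: w_zero)

context
  assumes nS: "n \<le> card S"
begin

interpretation of: orthonormal_family "{0..M n}" w e n
proof
  fix k l assume "k < n" "l < n"
  then have "op.ip (e k) (e l) = (if k = l then 1 else 0)" using nS by (intro ob.orthonormal) auto
  then show "gram {0..M n} w e (\<lambda>_. 1) k l = (if k = l then 1 else 0)"
    unfolding gram_eq by (simp add: gram_def op.ip_def)
qed simp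

definition lead where "lead = (\<Prod>k=0..<n. coeff (E k) k)"

lemma lead_nonzero: "lead \<noteq> 0"
proof -
  have "coeff (E k) k \<noteq> 0" if "k < n" for k
    using ob.deg[of k] that nS leading_coeff_0_iff[of "E k"] by auto
  then show ?thesis by (simp add: lead_def)
qed

text \<open>Up to the leading coefficients the determinant is a Vandermonde determinant of the
  nodes; squaring makes the order within each difference irrelevant.\<close>

lemma slater_weight_eq: "slater_weight w e n y = lead\<^sup>2 * joint_weight q \<alpha> \<beta> \<delta> M n y"
proof -
  have "slater e n y = lead * (\<Prod>j=0..<n. \<Prod>i=0..<j. nu (y (Suc j)) - nu (y (Suc i)))"
    unfolding slater_def ob.e_def lead_def using ob.deg nS by (intro vandermonde_polys) auto
  moreover have "(\<Prod>j=0..<n. \<Prod>i=0..<j. nu (y (Suc j)) - nu (y (Suc i)))\<^sup>2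
     = (\<Prod>j\<in>{1..n}. \<Prod>i\<in>{1..<j}. (nu (y i) - nu (y j))\<^sup>2)"
  proof -
    have "(\<Prod>j\<in>{1..n}. \<Prod>i\<in>{1..<j}. (nu (y i) - nu (y j))\<^sup>2)
      = (\<Prod>j=0..<n. \<Prod>i\<in>{1..<Suc j}. (nu (y i) - nu (y (Suc j)))\<^sup>2)"
      by (rule prod.reindex_bij_witness[of _ Suc "\<lambda>i. i - 1"]) auto
    also have "\<dots> = (\<Prod>j=0..<n. \<Prod>i=0..<j. (nu (y (Suc j)) - nu (y (Suc i)))\<^sup>2)"
      by (intro prod.cong refl prod.reindex_bij_witness[of _ Suc "\<lambda>i. i - 1"]) (auto simp: power2_commute)
    finally show ?thesis by (simp add: prod_power_distrib)
  qed
  moreover have "(\<Prod>i=0..<n. w (y (Suc i))) = (\<Prod>j\<in>{1..n}. w (y j))"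
    by (rule prod.reindex_bij_witness[of _ "\<lambda>i. i - 1" Suc]) auto
  ultimately show ?thesis
    by (simp add: slater_weight_def joint_weight_def power_mult_distrib)
qed

lemma joint_weight_nonneg: "y \<in> configs M n \<Longrightarrow> joint_weight q \<alpha> \<beta> \<delta> M n y \<ge> 0"
  unfolding joint_weight_def configs_def
  by (intro mult_nonneg_nonneg prod_nonneg) (auto intro!: w_nonneg)

lemma finite_configs: "finite (configs M n)"
  unfolding configs_def by (intro finite_PiE) auto

definition expect where
  "expect f = (\<Sum>y\<in>configs M n. slater_weight w e n y * f y) / fact n"

text \<open>The total mass of the squared determinants identifies the normalising constant as
  \<open>fact n / lead\<^sup>2\<close>. It is positive, so \<open>ensemble\<close> is a genuine
  probability measure.\<close>

lemma integral_ensemble: "(\<integral>y. f y \<partial>ensemble q \<alpha> \<beta> \<delta> M n) = expect f" for f :: "(nat \<Rightarrow> nat) \<Rightarrow> real"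
proof -
  define Z where "Z = (\<Sum>z\<in>configs M n. joint_weight q \<alpha> \<beta> \<delta> M n z)"
  have "lead\<^sup>2 * Z = fact n"
    unfolding Z_def sum_distrib_left slater_weight_eq[symmetric] configs_def by (rule of.sum_total)
  then have Z: "Z = fact n / lead\<^sup>2" using lead_nonzero by (simp add: field_simps)
  have "Z > 0" unfolding Z using lead_nonzero by simp
  then have "(\<integral>y. f y \<partial>ensemble q \<alpha> \<beta> \<delta> M n)
      = (\<Sum>y\<in>configs M n. (joint_weight q \<alpha> \<beta> \<delta> M n y / Z) *\<^sub>R f y)"
    unfolding ensemble_def Z_def[symmetric]
    by (intro lebesgue_integral_point_measure_finite finite_configs divide_nonneg_pos joint_weight_nonneg)
  also have "\<dots> = expect f"
    unfolding expect_def sum_divide_distrib slater_weight_eq Z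
    using lead_nonzero by (intro sum.cong) (auto simp: field_simps)
  finally show ?thesis .
qed

lemma measurable_ensemble: "f \<in> borel_measurable (ensemble q \<alpha> \<beta> \<delta> M n)" for f :: "(nat \<Rightarrow> nat) \<Rightarrow> real"
  by (simp add: ensemble_def)

lemma integrable_ensemble: "integrable (ensemble q \<alpha> \<beta> \<delta> M n) f" for f :: "(nat \<Rightarrow> nat) \<Rightarrow> real"
  unfolding ensemble_def by (intro integrable_point_measure_finite finite_configs)

lemma expect_linear: "expect (\<lambda>y. \<Sum>j=1..n. f (y j)) = (\<Sum>v\<in>S. f v * K v)"
proof -
  have "expect (\<lambda>y. \<Sum>j=1..n. f (y j)) = (\<Sum>k<n. gram S w e f k k)"
    unfolding expect_def configs_def of.sum_linear gram_eq by simp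
  also have "\<dots> = (\<Sum>v\<in>S. f v * K v)"
    unfolding gram_def by (subst sum.swap)
      (simp add: K_def sum_distrib_left sum_distrib_right power2_eq_square mult_ac)
  finally show ?thesis .
qed

lemma expect_square_diff:
  "expect (\<lambda>y. (A y - m)\<^sup>2) = expect (\<lambda>y. (A y)\<^sup>2) - 2 * m * expect A + m\<^sup>2 * expect (\<lambda>_. 1)"
proof -
  have "u * (a - m)\<^sup>2 = u * a\<^sup>2 - 2 * m * (u * a) + m\<^sup>2 * (u * 1)" for u a :: real
    by (simp add: power2_eq_square algebra_simps)
  then show ?thesis unfolding expect_def
    by (simp only: sum.distrib sum_subtractf sum_distrib_left[symmetric] add_divide_distrib
        diff_divide_distrib times_divide_eq_right)
qed

text \<open>The bound depends on \<open>n\<close> only through \<open>F\<close>, so averages over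
  \<open>n\<close> particles have second moments of order 1/n^2, which is summable.\<close>

lemma expect_variance:
  assumes F: "\<And>v. v \<in> S \<Longrightarrow> \<bar>nu v ^ r\<bar> \<le> F"
  shows "expect (\<lambda>y. ((\<Sum>j=1..n. nu (y j) ^ r) - (\<Sum>v\<in>S. nu v ^ r * K v))\<^sup>2) \<le> real r * F\<^sup>2"
proof -
  let ?f = "\<lambda>v. nu v ^ r"
  define m where "m = (\<Sum>v\<in>S. ?f v * K v)"
  have m: "m = (\<Sum>k<n. gram S w e ?f k k)"
    unfolding m_def expect_linear[of ?f, symmetric] unfolding expect_def configs_def of.sum_linear[of ?f] gram_eq by simp
  have "expect (\<lambda>y. ((\<Sum>j=1..n. ?f (y j)) - m)\<^sup>2)
    = expect (\<lambda>y. (\<Sum>j=1..n. ?f (y j))\<^sup>2) - 2 * m * expect (\<lambda>y. \<Sum>j=1..n. ?f (y j)) + m\<^sup>2 * expect (\<lambda>_. 1)"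
    by (rule expect_square_diff)
  also have "expect (\<lambda>_. 1) = 1" unfolding expect_def configs_def mult_1_right of.sum_total by simp
  also have "expect (\<lambda>y. \<Sum>j=1..n. ?f (y j)) = m" unfolding expect_linear[of ?f] m_def ..
  also have "expect (\<lambda>y. (\<Sum>j=1..n. ?f (y j))\<^sup>2) = (\<Sum>k<n. gram S w e (\<lambda>v. (?f v)\<^sup>2) k k) + m\<^sup>2
        - (\<Sum>k<n. \<Sum>l<n. (gram S w e ?f k l)\<^sup>2)"
    unfolding expect_def configs_def of.sum_quadratic[of ?f] gram_eq m by simp
  finally have "expect (\<lambda>y. ((\<Sum>j=1..n. ?f (y j)) - m)\<^sup>2)
    = (\<Sum>k<n. gram S w e (\<lambda>v. (?f v)\<^sup>2) k k) - (\<Sum>k<n. \<Sum>l<n. (gram S w e ?f k l)\<^sup>2)"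
    by (simp add: power2_eq_square[of m])
  then show ?thesis unfolding m_def[symmetric] using ob.linear_statistic_variance[OF nS F] by linarith
qed

end

end

section \<open>Arcsine laws and Riemann sums\<close>

text \<open>The mean under the law of \<open>c + 2 d cos \<theta>\<close> with \<open>\<theta>\<close> uniform on \<open>[0, \<pi>]\<close>.\<close>

definition arc_mean :: "real \<Rightarrow> real \<Rightarrow> (real \<Rightarrow> real) \<Rightarrow> real" where
  "arc_mean c d g = integral {0..pi} (\<lambda>t. g (c + 2 * d * cos t)) / pi"

text \<open>The matrix element between 0 and \<open>j\<close> of the r-th power of the operator on
  the integers with constant diagonal \<open>c\<close> and off-diagonal \<open>d\<close>, whose
  Fourier symbol is c + 2 d cos t.\<close>

definition arc_fourier :: "real \<Rightarrow> real \<Rightarrow> nat \<Rightarrow> int \<Rightarrow> real" where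
  "arc_fourier c d r j = integral {0..pi} (\<lambda>t. (c + 2 * d * cos t) ^ r * cos (of_int j * t)) / pi"

lemma arc_fourier_0: "arc_fourier c d 0 j = (if j = 0 then 1 else 0)"
proof (cases "j = 0")
  case False
  have "((\<lambda>t. cos (of_int j * t)) has_integral (sin (of_int j * pi) / of_int j - sin (of_int j * 0) / of_int j)) {0..pi}"
    by (rule fundamental_theorem_of_calculus)
       (use False in \<open>auto intro!: derivative_eq_intros simp: has_real_derivative_iff_has_vector_derivative[symmetric]\<close>)
  moreover have "sin (of_int j * pi) = 0" by (simp add: mult.commute[of _ pi] sin_npi_int)
  ultimately show ?thesis using False by (simp add: arc_fourier_def integral_unique)
qed (simp add: arc_fourier_def)

lemma arc_fourier_Suc:
  "arc_fourier c d (Suc r) j = d * arc_fourier c d r (j - 1) + c * arc_fourier c d r j + d * arc_fourier c d r (j + 1)"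
proof -
  let ?f = "\<lambda>j t. (c + 2 * d * cos t) ^ r * cos (of_int j * t)"
  have int: "?f j integrable_on {0..pi}" for j :: int
    by (intro integrable_continuous_real continuous_intros)
  have "integral {0..pi} (\<lambda>t. (c + 2 * d * cos t) ^ Suc r * cos (of_int j * t))
    = integral {0..pi} (\<lambda>t. d * ?f (j - 1) t + c * ?f j t + d * ?f (j + 1) t)"
  proof (rule integral_cong)
    fix t :: real
    have "cos (of_int (j - 1) * t) + cos (of_int (j + 1) * t) = 2 * cos t * cos (of_int j * t)"
      by (simp add: left_diff_distrib distrib_right cos_add cos_diff)
    then have "2 * d * cos t * cos (of_int j * t) = d * cos (of_int (j - 1) * t) + d * cos (of_int (j + 1) * t)"
      by (metis distrib_left mult.assoc mult.left_commute)
    then have "(c + 2 * d * cos t) * cos (of_int j * t)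
      = d * cos (of_int (j - 1) * t) + c * cos (of_int j * t) + d * cos (of_int (j + 1) * t)"
      by (simp add: distrib_right)
    then show "(c + 2 * d * cos t) ^ Suc r * cos (of_int j * t) = d * ?f (j - 1) t + c * ?f j t + d * ?f (j + 1) t"
      unfolding power_Suc2 mult.assoc by (simp add: distrib_left mult_ac)
  qed
  also have "\<dots> = d * integral {0..pi} (?f (j - 1)) + c * integral {0..pi} (?f j) + d * integral {0..pi} (?f (j + 1))"
  proof -
    have dint: "(\<lambda>t. u * ?f j t) integrable_on {0..pi}" for u and j :: int
      by (intro integrable_continuous_real continuous_intros)
    show ?thesis
      by (subst integral_add, intro integrable_add dint, rule dint, subst integral_add, rule dint, rule dint) simp
  qed
  finally show ?thesis by (simp add: arc_fourier_def add_divide_distrib)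
qed

lemma arc_integrable:
  fixes g :: "real \<Rightarrow> real"
  assumes "continuous_on UNIV g"
  shows "(\<lambda>t. g (c + 2 * d * cos t)) integrable_on {a..b}"
  by (intro integrable_continuous_real continuous_on_compose2[OF assms] continuous_intros) auto

lemma arc_mean_power: "arc_mean c d (\<lambda>x. x ^ r) = arc_fourier c d r 0"
  by (simp add: arc_mean_def arc_fourier_def)

lemma arc_mean_poly:
  "arc_mean c d (\<lambda>x. \<Sum>i\<le>N. a i * x ^ i) = (\<Sum>i\<le>N. a i * arc_fourier c d i 0)"
proof -
  have int: "(\<lambda>t. a i * (c + 2 * d * cos t) ^ i) integrable_on {0..pi}" for i
    by (intro integrable_continuous_real continuous_intros)
  show ?thesis unfolding arc_mean_power[symmetric] arc_mean_def
    by (subst integral_sum) (auto intro!: int simp: sum_divide_distrib)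
qed

lemma arc_range:
  assumes "\<bar>c\<bar> + 2 * \<bar>d\<bar> \<le> R"
  shows "c + 2 * d * cos (t::real) \<in> {-R..R}"
proof -
  have "\<bar>2 * d * cos t\<bar> \<le> 2 * \<bar>d\<bar>"
    using abs_cos_le_one[of t] mult_left_le[of "\<bar>cos t\<bar>" "2 * \<bar>d\<bar>"] by (simp add: abs_mult)
  then show ?thesis using assms unfolding atLeastAtMost_iff abs_le_iff by linarith
qed

lemma arc_mean_close:
  assumes g: "continuous_on UNIV g" and h: "continuous_on UNIV h"
    and "\<And>x. x \<in> {-R..R} \<Longrightarrow> \<bar>g x - h x\<bar> \<le> \<epsilon>" and R: "\<bar>c\<bar> + 2 * \<bar>d\<bar> \<le> R"
  shows "\<bar>arc_mean c d g - arc_mean c d h\<bar> \<le> \<epsilon>"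
proof -
  let ?x = "\<lambda>t. c + 2 * d * cos t"
  have "norm (integral {0..pi} (\<lambda>t. g (?x t) - h (?x t))) \<le> integral {0..pi} (\<lambda>t. \<epsilon>)"
    using assms(3) arc_range[OF R]
    by (intro integral_norm_bound_integral integrable_diff arc_integrable g h) auto
  also have "integral {0..pi} (\<lambda>t. g (?x t) - h (?x t)) = integral {0..pi} (\<lambda>t. g (?x t)) - integral {0..pi} (\<lambda>t. h (?x t))"
    by (intro integral_diff arc_integrable g h)
  finally have *: "\<bar>integral {0..pi} (\<lambda>t. g (?x t)) - integral {0..pi} (\<lambda>t. h (?x t))\<bar> \<le> \<epsilon> * pi"
    by (simp add: mult.commute)
  have "arc_mean c d g - arc_mean c d h = (integral {0..pi} (\<lambda>t. g (?x t)) - integral {0..pi} (\<lambda>t. h (?x t))) / pi"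
    by (simp add: arc_mean_def diff_divide_distrib)
  then have "\<bar>arc_mean c d g - arc_mean c d h\<bar> = \<bar>integral {0..pi} (\<lambda>t. g (?x t)) - integral {0..pi} (\<lambda>t. h (?x t))\<bar> / pi"
    by simp
  also have "\<dots> \<le> \<epsilon>" using * by (simp add: divide_simps)
  finally show ?thesis .
qed

text \<open>Clamping extends the tail mass arccos(u) / pi of the law of cos \<theta> to thresholds
  outside [-1, 1], where it has to be 0 or 1.\<close>

definition clamp1 :: "real \<Rightarrow> real" where "clamp1 u = max (-1) (min 1 u)"

lemma clamp1_bounds: "- 1 \<le> clamp1 u" "clamp1 u \<le> 1"
  by (auto simp: clamp1_def)

lemma arccos_clamp1: "0 \<le> arccos (clamp1 u)" "arccos (clamp1 u) \<le> pi"
  using clamp1_bounds[of u] by (auto intro: arccos_lbound arccos_ubound)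

lemma cos_le_of_arccos_clamp1:
  assumes "arccos (clamp1 u) < t" "t \<le> pi"
  shows "cos t \<le> u"
proof -
  have "cos t < cos (arccos (clamp1 u))" using assms arccos_clamp1[of u] by (intro cos_monotone_0_pi) auto
  then have "cos t < clamp1 u" using clamp1_bounds[of u] by simp
  then show ?thesis using cos_ge_minus_one[of t] unfolding clamp1_def by linarith
qed

lemma cos_ge_of_arccos_clamp1:
  assumes "t < arccos (clamp1 u)" "t \<ge> 0"
  shows "cos t \<ge> u"
proof -
  have "cos t > cos (arccos (clamp1 u))" using assms arccos_clamp1[of u] by (intro cos_monotone_0_pi) auto
  then have "cos t > clamp1 u" using clamp1_bounds[of u] by simp
  then show ?thesis using cos_le_one[of t] unfolding clamp1_def by linarith
qed

text \<open>The clamped arccos is the angle at which c + 2 d cos t falls to \<open>a\<close>: before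
  it \<open>g \<le> 1\<close>, after it \<open>g\<close> vanishes.\<close>

lemma arc_mean_upper:
  assumes "continuous_on UNIV g" "\<And>x. g x \<le> 1" "\<And>x. x \<le> a \<Longrightarrow> g x = 0" "d > 0"
  shows "arc_mean c d g \<le> arccos (clamp1 ((a - c) / (2 * d))) / pi"
proof -
  let ?T = "arccos (clamp1 ((a - c) / (2 * d)))" and ?g = "\<lambda>t. g (c + 2 * d * cos t)"
  have "integral {0..pi} ?g = integral {0..?T} ?g + integral {?T..pi} ?g"
    using arccos_clamp1 by (intro Henstock_Kurzweil_Integration.integral_combine[symmetric] arc_integrable assms(1)) auto
  moreover have "integral {0..?T} ?g \<le> integral {0..?T} (\<lambda>t. 1)"
    by (intro integral_le arc_integrable assms) auto
  moreover have "integral {?T..pi} ?g = integral {?T..pi} (\<lambda>t. 0)"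
  proof (rule integral_spike[of "{?T}"])
    fix t assume "t \<in> {?T..pi} - {?T}"
    then have "cos t \<le> (a - c) / (2 * d)" by (intro cos_le_of_arccos_clamp1) auto
    then show "0 = ?g t" using assms(4) by (intro assms(3)[symmetric]) (simp add: field_simps)
  qed simp
  ultimately have "integral {0..pi} ?g \<le> ?T" using arccos_clamp1[of "(a - c) / (2 * d)"] by simp
  then show ?thesis unfolding arc_mean_def by (rule divide_right_mono) simp
qed

lemma arc_mean_lower:
  assumes "continuous_on UNIV g" "\<And>x. g x \<ge> 0" "\<And>x. x \<ge> b \<Longrightarrow> g x = 1" "d > 0"
  shows "arc_mean c d g \<ge> arccos (clamp1 ((b - c) / (2 * d))) / pi"
proof -
  let ?T = "arccos (clamp1 ((b - c) / (2 * d)))" and ?g = "\<lambda>t. g (c + 2 * d * cos t)"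
  have "integral {0..pi} ?g = integral {0..?T} ?g + integral {?T..pi} ?g"
    using arccos_clamp1 by (intro Henstock_Kurzweil_Integration.integral_combine[symmetric] arc_integrable assms(1)) auto
  moreover have "integral {?T..pi} ?g \<ge> 0"
    by (intro integral_nonneg arc_integrable assms)
  moreover have "integral {0..?T} ?g = integral {0..?T} (\<lambda>t. 1)"
  proof (rule integral_spike[of "{?T}"])
    fix t assume "t \<in> {0..?T} - {?T}"
    then have "cos t \<ge> (b - c) / (2 * d)" by (intro cos_ge_of_arccos_clamp1) auto
    then show "1 = ?g t" using assms(4) by (intro assms(3)[symmetric]) (simp add: field_simps)
  qed simp
  ultimately have "integral {0..pi} ?g \<ge> ?T" using arccos_clamp1[of "(b - c) / (2 * d)"] by simp
  then show ?thesis unfolding arc_mean_def by (rule divide_right_mono) simp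
qed

section \<open>From convergence of moments to convergence of tail masses\<close>

locale arc_convergence =
  fixes m :: "nat \<Rightarrow> nat" and N Lam :: "nat \<Rightarrow> nat \<Rightarrow> real" and R c d :: real
  assumes nonneg: "\<forall>\<^sub>F n in sequentially. \<forall>k<m n. N n k \<ge> 0"
    and total: "\<forall>\<^sub>F n in sequentially. (\<Sum>k<m n. N n k) = 1"
    and bounded: "\<forall>\<^sub>F n in sequentially. \<forall>k<m n. \<bar>Lam n k\<bar> \<le> R"
    and moments: "\<And>r. (\<lambda>n. \<Sum>k<m n. N n k * Lam n k ^ r) \<longlonglongrightarrow> arc_fourier c d r 0"
begin

text \<open>The method of moments on a bounded interval: [-R', R'] contains both the points
  \<open>Lam n k\<close> and the support of the limit law, and there a polynomial replaces
  \<open>g\<close>.\<close>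

lemma continuous_mean:
  assumes g: "continuous_on UNIV g"
  shows "(\<lambda>n. \<Sum>k<m n. N n k * g (Lam n k)) \<longlonglongrightarrow> arc_mean c d g"
proof (rule tendstoI)
  fix \<epsilon> :: real assume \<epsilon>: "\<epsilon> > 0"
  define R' where "R' = max R (\<bar>c\<bar> + 2 * \<bar>d\<bar>)"
  obtain P where P: "real_polynomial_function P" "\<And>x. x \<in> {-R'..R'} \<Longrightarrow> \<bar>g x - P x\<bar> < \<epsilon> / 3"
    using Stone_Weierstrass_real_polynomial_function[of "{-R'..R'}" g "\<epsilon> / 3"] \<epsilon> continuous_on_subset[OF g]
    by auto
  obtain a K where aK: "P = (\<lambda>x. \<Sum>i\<le>K. a i * x ^ i)"
    using P(1) by (auto simp: real_polynomial_function_iff_sum)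
  have Pc: "continuous_on UNIV P" unfolding aK by (intro continuous_intros)
  have 1: "\<bar>arc_mean c d g - arc_mean c d P\<bar> \<le> \<epsilon> / 3"
    using P(2) by (intro arc_mean_close[of g P R'] g Pc) (auto simp: R'_def less_imp_le)
  have "(\<lambda>n. \<Sum>i\<le>K. a i * (\<Sum>k<m n. N n k * Lam n k ^ i)) \<longlonglongrightarrow> (\<Sum>i\<le>K. a i * arc_fourier c d i 0)"
    by (intro tendsto_intros moments)
  moreover have "(\<Sum>i\<le>K. a i * (\<Sum>k<m n. N n k * Lam n k ^ i)) = (\<Sum>k<m n. N n k * P (Lam n k))" for n
    unfolding aK sum_distrib_left by (subst sum.swap) (simp add: mult_ac)
  ultimately have "(\<lambda>n. \<Sum>k<m n. N n k * P (Lam n k)) \<longlonglongrightarrow> arc_mean c d P"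
    unfolding aK arc_mean_poly by simp
  then have 2: "\<forall>\<^sub>F n in sequentially. dist (\<Sum>k<m n. N n k * P (Lam n k)) (arc_mean c d P) < \<epsilon> / 3"
    using \<epsilon> by (intro tendstoD) auto
  show "\<forall>\<^sub>F n in sequentially. dist (\<Sum>k<m n. N n k * g (Lam n k)) (arc_mean c d g) < \<epsilon>"
    using 2 nonneg total bounded
  proof eventually_elim
    case (elim n)
    have "\<bar>(\<Sum>k<m n. N n k * g (Lam n k)) - (\<Sum>k<m n. N n k * P (Lam n k))\<bar>
      \<le> (\<Sum>k<m n. N n k * (\<epsilon> / 3))"
      unfolding sum_subtractf[symmetric]
    proof (rule order.trans[OF sum_abs], rule sum_mono)
      fix k assume k: "k \<in> {..<m n}"
      then have "Lam n k \<in> {-R'..R'}" using elim(4) by (force simp: R'_def abs_le_iff)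
      then have "\<bar>g (Lam n k) - P (Lam n k)\<bar> \<le> \<epsilon> / 3" using P(2) by (auto simp: less_imp_le)
      moreover have "N n k \<ge> 0" using elim(2) k by auto
      ultimately show "\<bar>N n k * g (Lam n k) - N n k * P (Lam n k)\<bar> \<le> N n k * (\<epsilon> / 3)"
        unfolding right_diff_distrib[symmetric] abs_mult by (simp only: abs_of_nonneg mult_left_mono)
    qed
    also have "\<dots> = \<epsilon> / 3" using elim(3) by (simp add: sum_distrib_right[symmetric] sum_divide_distrib[symmetric])
    finally show ?case using 1 elim(1) \<epsilon> unfolding dist_real_def by linarith
  qed
qed

text \<open>For \<open>d > 0\<close> the limit law has no atoms, so the indicator can be sandwiched
  between ramps. The indices with \<open>Lam n k = t n\<close> may be in \<open>A n\<close> or not,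
  and the threshold may move with \<open>n\<close>.\<close>

lemma threshold:
  assumes d: "d > 0" and tau: "t \<longlonglongrightarrow> \<tau>"
    and A: "\<forall>\<^sub>F n in sequentially. A n \<subseteq> {..<m n} \<and> (\<forall>k<m n. Lam n k > t n \<longrightarrow> k \<in> A n) \<and> (\<forall>k\<in>A n. Lam n k \<ge> t n)"
  shows "(\<lambda>n. \<Sum>k\<in>A n. N n k) \<longlonglongrightarrow> arccos (clamp1 ((\<tau> - c) / (2 * d))) / pi"
proof (rule tendstoI)
  fix \<epsilon> :: real assume \<epsilon>: "\<epsilon> > 0"
  define V where "V s = arccos (clamp1 ((s - c) / (2 * d))) / pi" for s
  have "continuous_on UNIV V"
    unfolding V_def clamp1_def
    by (intro continuous_intros continuous_on_compose2[OF continuous_on_arccos']) (use d in auto)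
  then have "isCont V \<tau>" by (simp add: continuous_on_eq_continuous_at)
  then obtain \<eta>' where \<eta>': "\<eta>' > 0" "\<And>s. \<bar>s - \<tau>\<bar> < \<eta>' \<Longrightarrow> \<bar>V s - V \<tau>\<bar> < \<epsilon> / 2"
    using \<epsilon> unfolding continuous_at_eps_delta by (metis dist_real_def half_gt_zero)
  \<comment> \<open>The lower ramp has reached 1 at \<tau> - \<eta>, the upper one leaves 0 at
    \<tau> + \<eta>, and \<open>t n\<close> lies between these. The outer ends are 2 \<eta> away
    from \<tau>, hence the division by 3.\<close>
  define \<eta> where "\<eta> = \<eta>' / 3"
  have \<eta>: "\<eta> > 0" "\<bar>V (\<tau> - 2 * \<eta>) - V \<tau>\<bar> < \<epsilon> / 2" "\<bar>V (\<tau> + 2 * \<eta>) - V \<tau>\<bar> < \<epsilon> / 2"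
    using \<eta>' by (auto simp: \<eta>_def)
  define ramp where "ramp a x = max 0 (min 1 ((x - a) / \<eta>))" for a x :: real
  have rc: "continuous_on UNIV (ramp a)" for a
    unfolding ramp_def using \<eta>(1) by (intro continuous_intros) auto
  have r01: "0 \<le> ramp a x" "ramp a x \<le> 1" for a x by (auto simp: ramp_def)
  have r0: "ramp a x = 0" if "x \<le> a" for a x using that \<eta>(1) by (auto simp: ramp_def divide_nonpos_pos)
  have r1: "ramp a x = 1" if "x \<ge> a + \<eta>" for a x using that \<eta>(1) by (auto simp: ramp_def field_simps)
  have up: "\<forall>\<^sub>F n in sequentially. (\<Sum>k<m n. N n k * ramp (\<tau> - 2 * \<eta>) (Lam n k)) < V \<tau> + \<epsilon>"
  proof (rule order_tendstoD(2)[OF continuous_mean[OF rc]])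
    have "arc_mean c d (ramp (\<tau> - 2 * \<eta>)) \<le> V (\<tau> - 2 * \<eta>)"
      unfolding V_def using r01 r0 d by (intro arc_mean_upper rc) auto
    then show "arc_mean c d (ramp (\<tau> - 2 * \<eta>)) < V \<tau> + \<epsilon>" using \<eta>(2) \<epsilon> unfolding abs_less_iff by linarith
  qed
  have lo: "\<forall>\<^sub>F n in sequentially. (\<Sum>k<m n. N n k * ramp (\<tau> + \<eta>) (Lam n k)) > V \<tau> - \<epsilon>"
  proof (rule order_tendstoD(1)[OF continuous_mean[OF rc]])
    have "arc_mean c d (ramp (\<tau> + \<eta>)) \<ge> V (\<tau> + 2 * \<eta>)"
      unfolding V_def using r01 r1[of "\<tau> + \<eta>"] d by (intro arc_mean_lower rc) auto
    then show "arc_mean c d (ramp (\<tau> + \<eta>)) > V \<tau> - \<epsilon>" using \<eta>(3) \<epsilon> unfolding abs_less_iff by linarith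
  qed
  have tn: "\<forall>\<^sub>F n in sequentially. dist (t n) \<tau> < \<eta>" using tau \<eta>(1) by (rule tendstoD)
  show "\<forall>\<^sub>F n in sequentially. dist (\<Sum>k\<in>A n. N n k) (arccos (clamp1 ((\<tau> - c) / (2 * d))) / pi) < \<epsilon>"
    using up lo tn nonneg A
  proof eventually_elim
    case (elim n)
    have sub: "A n \<subseteq> {..<m n}" using elim(5) by blast
    have "(\<Sum>k\<in>A n. N n k) = (\<Sum>k\<in>A n. N n k * ramp (\<tau> - 2 * \<eta>) (Lam n k))"
      using elim(3,5) by (intro sum.cong refl) (auto simp: r1 dist_real_def abs_less_iff)
    also have "\<dots> \<le> (\<Sum>k<m n. N n k * ramp (\<tau> - 2 * \<eta>) (Lam n k))"
      using sub elim(4) r01 by (intro sum_mono2) auto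
    finally have 1: "(\<Sum>k\<in>A n. N n k) < V \<tau> + \<epsilon>" using elim(1) by simp
    have "(\<Sum>k<m n. N n k * ramp (\<tau> + \<eta>) (Lam n k)) = (\<Sum>k\<in>A n. N n k * ramp (\<tau> + \<eta>) (Lam n k))"
    proof (rule sum.mono_neutral_right[OF _ sub])
      show "\<forall>k\<in>{..<m n} - A n. N n k * ramp (\<tau> + \<eta>) (Lam n k) = 0"
      proof
        fix k assume "k \<in> {..<m n} - A n"
        then have "Lam n k \<le> t n" using elim(5) by force
        then show "N n k * ramp (\<tau> + \<eta>) (Lam n k) = 0" using elim(3) by (simp add: r0 dist_real_def abs_less_iff)
      qed
    qed simp
    also have "\<dots> \<le> (\<Sum>k\<in>A n. N n k)" using elim(4) sub r01 by (intro sum_mono) (auto intro!: mult_left_le)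
    finally have "(\<Sum>k\<in>A n. N n k) > V \<tau> - \<epsilon>" using elim(2) by simp
    with 1 show ?case unfolding V_def[symmetric] by (simp add: dist_real_def abs_less_iff)
  qed
qed

end

section \<open>Riemann sums as integrals of step functions\<close>

lemma step_function_integral:
  assumes n: "n \<ge> 1"
  shows "has_bochner_integral lborel (\<lambda>x::real. if 0 \<le> x \<and> x < real m / real n then h (nat \<lfloor>x * real n\<rfloor>) else 0)
     (1 / real n * (\<Sum>y<m. h y :: real))"
proof -
  have eq: "(if 0 \<le> x \<and> x < real m / real n then h (nat \<lfloor>x * real n\<rfloor>) else 0)
     = (\<Sum>y<m. h y * indicator {real y / real n..<real (Suc y) / real n} x)" for x :: real
  proof -
    have iff: "x \<in> {real y / real n..<real (Suc y) / real n} \<longleftrightarrow> 0 \<le> x \<and> y = nat \<lfloor>x * real n\<rfloor>" for y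
    proof -
      have "x \<in> {real y / real n..<real (Suc y) / real n} \<longleftrightarrow> real y \<le> x * real n \<and> x * real n < real y + 1"
        using n by (auto simp: field_simps)
      also have "\<dots> \<longleftrightarrow> \<lfloor>x * real n\<rfloor> = int y" by (auto simp: floor_eq_iff)
      also have "\<dots> \<longleftrightarrow> 0 \<le> x \<and> y = nat \<lfloor>x * real n\<rfloor>"
      proof
        assume "\<lfloor>x * real n\<rfloor> = int y"
        moreover from this have "0 \<le> x * real n" by linarith
        then have "0 \<le> x" using n by (simp add: zero_le_mult_iff)
        ultimately show "0 \<le> x \<and> y = nat \<lfloor>x * real n\<rfloor>" by simp
      qed (use n in auto)
      finally show ?thesis .
    qed
    have "(\<Sum>y<m. h y * indicator {real y / real n..<real (Suc y) / real n} x)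
      = (\<Sum>y<m. if y = nat \<lfloor>x * real n\<rfloor> then (if 0 \<le> x then h y else 0) else 0)"
      unfolding indicator_def iff by (intro sum.cong refl) auto
    also have "\<dots> = (if nat \<lfloor>x * real n\<rfloor> < m \<and> 0 \<le> x then h (nat \<lfloor>x * real n\<rfloor>) else 0)"
      by simp
    also have "nat \<lfloor>x * real n\<rfloor> < m \<and> 0 \<le> x \<longleftrightarrow> 0 \<le> x \<and> x < real m / real n"
    proof (cases "0 \<le> x")
      case True
      then have "nat \<lfloor>x * real n\<rfloor> < m \<longleftrightarrow> x * real n < real m" using n by (simp add: nat_less_iff floor_less_iff)
      then show ?thesis using True n by (simp add: field_simps)
    qed simp
    finally show ?thesis by simp
  qed
  have "has_bochner_integral lborel (\<lambda>x. \<Sum>y<m. h y * indicator {real y / real n..<real (Suc y) / real n} x)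
     (\<Sum>y<m. h y * measure lborel {real y / real n..<real (Suc y) / real n})"
    by (intro has_bochner_integral_sum has_bochner_integral_mult_right has_bochner_integral_real_indicator)
       (auto simp: emeasure_lborel_Ico divide_right_mono)
  moreover have "measure lborel {real y / real n..<real (Suc y) / real n} = 1 / real n" for y
    using n by (subst measure_lborel_Ico) (auto simp: divide_right_mono diff_divide_distrib[symmetric])
  ultimately show ?thesis unfolding eq by (simp add: sum_distrib_left sum_divide_distrib)
qed

text \<open>Dominated convergence for the step function with value \<open>h n y\<close> on [y/n,
  (y+1)/n). \<open>H\<close> becomes measurable as an almost everywhere limit.\<close>

lemma riemann_sum_limit:
  fixes h :: "nat \<Rightarrow> nat \<Rightarrow> real" and H :: "real \<Rightarrow> real"
  assumes m: "(\<lambda>n. real (m n) / real n) \<longlonglongrightarrow> L" and Z: "finite Z"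
    and conv: "\<And>x. 0 < x \<Longrightarrow> x < L \<Longrightarrow> x \<notin> Z \<Longrightarrow> (\<lambda>n. h n (nat \<lfloor>x * real n\<rfloor>)) \<longlonglongrightarrow> H x"
    and bound: "\<forall>\<^sub>F n in sequentially. \<forall>y<m n. \<bar>h n y\<bar> \<le> C"
  shows "set_integrable lborel {0..L} H"
    and "(\<lambda>n. 1 / real n * (\<Sum>y<m n. h n y)) \<longlonglongrightarrow> (LBINT x:{0..L}. H x)"
proof -
  \<comment> \<open>Replacing the finitely many bad \<open>n\<close> by the zero function gives one
    dominating function for all \<open>n\<close>.\<close>
  define good where "good n \<longleftrightarrow> n \<ge> 1 \<and> (\<forall>y<m n. \<bar>h n y\<bar> \<le> C) \<and> real (m n) / real n < L + 1" for n
  have ev_good: "\<forall>\<^sub>F n in sequentially. good n"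
  proof -
    have "\<forall>\<^sub>F n in sequentially. real (m n) / real n < L + 1" by (rule order_tendstoD(2)[OF m]) simp
    with bound eventually_ge_at_top[of 1] show ?thesis unfolding good_def by eventually_elim auto
  qed
  define U where "U = insert 0 (insert L Z)"
  have U: "countable U" using Z by (auto simp: U_def intro: countable_finite)
  define F where "F n x = (if 0 \<le> x \<and> x < real (m n) / real n then h n (nat \<lfloor>x * real n\<rfloor>) else 0)" for n x
  define G where "G n x = (if good n then indicator (- U) x * F n x else 0)" for n x
  define H' where "H' x = (if 0 < x \<and> x < L \<and> x \<notin> U then H x else 0)" for x
  have Fi: "has_bochner_integral lborel (F n) (1 / real n * (\<Sum>y<m n. h n y))" if "good n" for n
    using step_function_integral[of n "m n" "h n"] that unfolding F_def[abs_def] good_def by auto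
  have Gm [measurable]: "G n \<in> borel_measurable lborel" for n
  proof (cases "good n")
    case True
    have [measurable]: "F n \<in> borel_measurable lborel" using Fi[OF True] by (auto simp: has_bochner_integral_iff)
    have [measurable]: "U \<in> sets borel" using U by (rule sets.countable[rotated]) auto
    show ?thesis unfolding G_def using True by simp
  next
    case False
    then have "G n = (\<lambda>x. 0)" by (auto simp: G_def)
    then show ?thesis by simp
  qed
  have GH: "(\<lambda>n. G n x) \<longlonglongrightarrow> H' x" for x
  proof -
    consider "x \<in> U" | "x < 0" | "x > L" | "0 < x" "x < L" "x \<notin> U" by (force simp: U_def)
    then show ?thesis
    proof cases
      case 3
      have "\<forall>\<^sub>F n in sequentially. real (m n) / real n < x" using m 3 by (rule order_tendstoD)
      then have "\<forall>\<^sub>F n in sequentially. G n x = 0" by eventually_elim (auto simp: G_def F_def)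
      then show ?thesis using 3 by (simp add: H'_def tendsto_eventually)
    next
      case 4
      have "\<forall>\<^sub>F n in sequentially. real (m n) / real n > x" using m 4(2) by (rule order_tendstoD)
      with ev_good have "\<forall>\<^sub>F n in sequentially. h n (nat \<lfloor>x * real n\<rfloor>) = G n x"
        by eventually_elim (use 4 in \<open>auto simp: G_def F_def\<close>)
      then have "(\<lambda>n. G n x) \<longlonglongrightarrow> H x"
        using conv[of x] 4 by (intro Lim_transform_eventually[OF conv]) (auto simp: U_def)
      then show ?thesis using 4 by (simp add: H'_def)
    next
      case 1
      then have "G n x = 0" for n by (simp add: G_def)
      then show ?thesis using 1 by (simp add: H'_def)
    next
      case 2
      then have "G n x = 0" for n by (simp add: G_def F_def)
      then show ?thesis using 2 by (simp add: H'_def)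
    qed
  qed
  have dom: "norm (G n x) \<le> \<bar>C\<bar> * indicator {0..L + 1} x" for n x
  proof (cases "good n \<and> 0 \<le> x \<and> x < real (m n) / real n")
    case True
    then have n: "n \<ge> 1" by (auto simp: good_def)
    have "nat \<lfloor>x * real n\<rfloor> < m n"
      using True n by (simp add: nat_less_iff floor_less_iff field_simps)
    then have "\<bar>h n (nat \<lfloor>x * real n\<rfloor>)\<bar> \<le> \<bar>C\<bar>" using True unfolding good_def by force
    then show ?thesis using True by (auto simp: G_def F_def good_def indicator_def)
  qed (auto simp: G_def F_def)
  have Hm [measurable]: "H' \<in> borel_measurable lborel"
    by (rule borel_measurable_LIMSEQ_real[OF GH Gm])
  have di: "integrable lborel (\<lambda>x. \<bar>C\<bar> * indicator {0..L + 1} x)"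
    by (intro integrable_mult_right integrable_real_indicator) (auto simp: emeasure_lborel_Icc_eq)
  have Hi: "integrable lborel H'" and lim: "(\<lambda>n. integral\<^sup>L lborel (G n)) \<longlonglongrightarrow> integral\<^sup>L lborel H'"
    by (rule integrable_dominated_convergence[OF Hm Gm di _ AE_I2[OF dom]],
        rule AE_I2[OF GH], rule integral_dominated_convergence[OF Hm Gm di _ AE_I2[OF dom]], rule AE_I2[OF GH])
  have same: "indicator {0..L} x *\<^sub>R H x = H' x" if "x \<notin> U" for x
    using that by (auto simp: H'_def U_def indicator_def)
  show "set_integrable lborel {0..L} H"
    unfolding set_integrable_def
    by (subst integrable_discrete_difference[OF U, of _ _ H']) (use Hi same in auto)
  have I: "(LBINT x:{0..L}. H x) = integral\<^sup>L lborel H'"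
    unfolding set_lebesgue_integral_def
    by (rule integral_discrete_difference[OF U]) (use same in auto)
  have "\<forall>\<^sub>F n in sequentially. integral\<^sup>L lborel (G n) = 1 / real n * (\<Sum>y<m n. h n y)"
    using ev_good
  proof eventually_elim
    case (elim n)
    have "integral\<^sup>L lborel (G n) = integral\<^sup>L lborel (F n)"
      by (rule integral_discrete_difference[OF U]) (use elim in \<open>auto simp: G_def\<close>)
    then show ?case using Fi[OF elim] by (simp add: has_bochner_integral_iff)
  qed
  then show "(\<lambda>n. 1 / real n * (\<Sum>y<m n. h n y)) \<longlonglongrightarrow> (LBINT x:{0..L}. H x)"
    unfolding I by (rule Lim_transform_eventually[OF lim])
qed

section \<open>Duality of the discriminants\<close>

text \<open>The substitution of 1/(a b z) for z fixes y and exchanges A and C. So A + C is a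
  rational function of y, and A - C is one times (1 - a b z^2)/z, whose square is y^2 - 4ab. Writing
  4AC - (m+A+C)^2 as -((A-C)^2 + 2m(A+C) + m^2) leaves a polynomial in m and y.\<close>

lemma dual_discriminant_half:
  fixes a b g d z y m A C :: real
  assumes z: "z \<noteq> 0" "1 - a * b * z\<^sup>2 \<noteq> 0"
    and y: "y = inverse z + a * b * z"
    and A: "A = (1 - g * z) * (1 - a * z) * (1 - a * b * z) * (1 - b * d * z) / (1 - a * b * z\<^sup>2)\<^sup>2"
    and C: "C = (1 - z) * (1 - b * z) * (d - a * z) * (g - a * b * z) / (1 - a * b * z\<^sup>2)\<^sup>2"
  shows "(4 * A * C - (m + A + C)\<^sup>2) * (y\<^sup>2 - 4 * a * b) =
     - (((1 - g * d) * y + (g * d + b * g * d + a * g + a * b * d - g - a - a * b - b * d))\<^sup>2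
       + 2 * m * ((1 + g * d) * (y\<^sup>2 - 2 * a * b) - (g + a + a * b + b * d + g * d + b * g * d + a * g + a * b * d) * y
           + (g * a + g * a * b + g * b * d + a * a * b + a * b * d + a * b * b * d
              + a * a * b + (1 + b) * (a * g + a * b * d) + b * d * g))
       + m\<^sup>2 * (y\<^sup>2 - 4 * a * b))"
proof -
  define u where "u = 1 - a * b * z\<^sup>2"
  define N1 where "N1 = (1 - g * z) * (1 - a * z) * (1 - a * b * z) * (1 - b * d * z)"
  define N2 where "N2 = (1 - z) * (1 - b * z) * (d - a * z) * (g - a * b * z)"
  define e1 where "e1 = g * d + b * g * d + a * g + a * b * d - g - a - a * b - b * d"
  define s where "s = (1 + g * d) * (y\<^sup>2 - 2 * a * b) - (g + a + a * b + b * d + g * d + b * g * d + a * g + a * b * d) * y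
           + (g * a + g * a * b + g * b * d + a * a * b + a * b * d + a * b * b * d
              + a * a * b + (1 + b) * (a * g + a * b * d) + b * d * g)"
  have u: "u \<noteq> 0" using z by (simp add: u_def)
  have zy: "z * y = 1 + a * b * z\<^sup>2" using z y by (simp add: field_simps power2_eq_square)
  have disc: "z\<^sup>2 * (y\<^sup>2 - 4 * a * b) = u\<^sup>2"
    using zy unfolding u_def by Groebner_Basis.algebra
  have diff: "N1 - N2 = u * (z * ((1 - g * d) * y + e1))"
    using zy unfolding N1_def N2_def u_def e1_def by Groebner_Basis.algebra
  have sum: "N1 + N2 = z\<^sup>2 * s"
    using zy unfolding N1_def N2_def s_def by Groebner_Basis.algebra
  have A': "A = N1 / u\<^sup>2" and C': "C = N2 / u\<^sup>2" using A C by (simp_all add: N1_def N2_def u_def)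
  have AmC: "A - C = z * ((1 - g * d) * y + e1) / u"
    unfolding A' C' diff_divide_distrib[symmetric] diff using u by (simp add: power2_eq_square)
  have ApC: "A + C = z\<^sup>2 * s / u\<^sup>2" unfolding A' C' add_divide_distrib[symmetric] sum ..
  have D: "y\<^sup>2 - 4 * a * b = u\<^sup>2 / z\<^sup>2" using disc z by (simp add: field_simps)
  have "4 * A * C - (m + A + C)\<^sup>2 = - ((A - C)\<^sup>2 + 2 * m * (A + C) + m\<^sup>2)"
    by (simp add: power2_eq_square algebra_simps)
  then have "(4 * A * C - (m + A + C)\<^sup>2) * (y\<^sup>2 - 4 * a * b)
    = - ((A - C)\<^sup>2 * (u\<^sup>2 / z\<^sup>2) + 2 * m * ((A + C) * (u\<^sup>2 / z\<^sup>2)) + m\<^sup>2 * (y\<^sup>2 - 4 * a * b))"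
    unfolding D by (simp only: distrib_right mult_minus_left mult.assoc)
  also have "(A - C)\<^sup>2 * (u\<^sup>2 / z\<^sup>2) = ((1 - g * d) * y + e1)\<^sup>2"
    unfolding AmC using u z by (simp add: power_mult_distrib power_divide)
  also have "(A + C) * (u\<^sup>2 / z\<^sup>2) = s" unfolding ApC using u z by simp
  finally show ?thesis unfolding e1_def s_def .
qed

text \<open>Up to the factors \<open>y\<^sup>2 - 4\<alpha>\<beta>\<close> and \<open>\<mu>\<^sup>2 - 4\<gamma>\<delta>\<close>, the recurrence in the degree and the difference equation
  in the variable have the same discriminant, as they are exchanged by swapping \<open>\<alpha>\<close>, \<open>\<gamma>\<close> and \<open>\<beta>\<close>, \<open>\<delta>\<close>.\<close>

lemma dual_discriminants:
  fixes \<alpha> \<beta> \<gamma> \<delta> z X :: real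
  assumes z: "z \<noteq> 0" "1 - \<alpha> * \<beta> * z\<^sup>2 \<noteq> 0" and X: "X \<noteq> 0" "1 - \<gamma> * \<delta> * X\<^sup>2 \<noteq> 0"
    and y: "y = inverse z + \<alpha> * \<beta> * z" and mu: "\<mu> = inverse X + \<gamma> * \<delta> * X"
    and A: "A = (1 - \<gamma> * z) * (1 - \<alpha> * z) * (1 - \<alpha> * \<beta> * z) * (1 - \<beta> * \<delta> * z) / (1 - \<alpha> * \<beta> * z\<^sup>2)\<^sup>2"
    and C: "C = (1 - z) * (1 - \<beta> * z) * (\<delta> - \<alpha> * z) * (\<gamma> - \<alpha> * \<beta> * z) / (1 - \<alpha> * \<beta> * z\<^sup>2)\<^sup>2"
  shows "(4 * A * C - (\<mu> - (1 + \<gamma> * \<delta> - A - C))\<^sup>2) * (y\<^sup>2 - 4 * \<alpha> * \<beta>)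
     = (4 * (qB \<alpha> \<beta> \<delta> 1 \<gamma> X * qD \<alpha> \<beta> \<delta> 1 \<gamma> X) - (y - qc \<alpha> \<beta> \<delta> 1 \<gamma> X)\<^sup>2) * (\<mu>\<^sup>2 - 4 * \<gamma> * \<delta>)"
proof -
  have 1: "\<mu> - (1 + \<gamma> * \<delta> - A - C) = (\<mu> - 1 - \<gamma> * \<delta>) + A + C"
    and 2: "y - qc \<alpha> \<beta> \<delta> 1 \<gamma> X = (y - 1 - \<alpha> * \<beta>) + qB \<alpha> \<beta> \<delta> 1 \<gamma> X + qD \<alpha> \<beta> \<delta> 1 \<gamma> X"
    by (simp_all add: qc_def)
  have B: "qB \<alpha> \<beta> \<delta> 1 \<gamma> X = (1 - \<alpha> * X) * (1 - \<gamma> * X) * (1 - \<gamma> * \<delta> * X) * (1 - \<delta> * \<beta> * X) / (1 - \<gamma> * \<delta> * X\<^sup>2)\<^sup>2"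
    unfolding qB_def by (simp add: power2_eq_square mult_ac)
  have D: "qD \<alpha> \<beta> \<delta> 1 \<gamma> X = (1 - X) * (1 - \<delta> * X) * (\<beta> - \<gamma> * X) * (\<alpha> - \<gamma> * \<delta> * X) / (1 - \<gamma> * \<delta> * X\<^sup>2)\<^sup>2"
    unfolding qD_def by (simp add: power2_eq_square mult_ac)
  \<comment> \<open>Each side is now a polynomial in y and \<mu>, one with the exchanged parameters,
    and the two coincide.\<close>
  show ?thesis
    unfolding 1 2 dual_discriminant_half[OF z y A C] mult.assoc[of 4, symmetric]
      dual_discriminant_half[OF X mu B D]
    by Groebner_Basis.algebra
qed

text \<open>For coinciding roots, where the characteristic function is the square of y - y(u) times
  a smooth factor. The derivative is taken within \<open>S\<close> because \<open>u\<close> may be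
  an end point.\<close>

lemma has_real_derivative_0_of_square_factor:
  fixes f h k :: "real \<Rightarrow> real"
  assumes "\<And>t. t \<in> S \<Longrightarrow> f t = (h t - h u)\<^sup>2 * k t" "u \<in> S"
    "(h has_real_derivative h') (at u within S)" "(k has_real_derivative k') (at u within S)"
  shows "(f has_real_derivative 0) (at u within S)"
proof -
  have "((\<lambda>t. (h t - h u)\<^sup>2 * k t) has_real_derivative 0) (at u within S)"
    by (auto intro!: derivative_eq_intros assms(3,4))
  then show ?thesis
    using assms(1,2) by (subst has_field_derivative_cong_eventually[where g = "\<lambda>t. (h t - h u)\<^sup>2 * k t"])
      (auto simp: eventually_at_filter)
qed

text \<open>For k > 0 the logarithmic condition makes \<open>k * q powr t\<close> a power of q with
  negative exponent: below 1 if q > 1, above 1 if q < 1.\<close>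

lemma q_factor_sign:
  fixes q k :: real
  assumes q: "q > 0" "q \<noteq> 1" and k: "k \<le> 0 \<or> log q k < - T" and "t \<le> T"
  shows "if q > 1 \<or> k \<le> 0 then 1 - k * q powr t > 0 else 1 - k * q powr t < 0"
proof (cases "k \<le> 0")
  case True
  then have "k * q powr t \<le> 0" by (rule mult_nonpos_nonneg) simp
  then show ?thesis using True by simp
next
  case False
  then have l: "log q k < - T" using k by simp
  have eq: "k * q powr t = q powr (log q k + t)"
    using False q by (simp add: powr_add powr_log_cancel)
  show ?thesis
  proof (cases "q > 1")
    case True
    then have "q powr (log q k + t) < q powr 0" using l assms by (intro powr_less_mono) auto
    then show ?thesis using True eq q by simp
  next
    case F: False
    then have "q powr (log q k + t) > q powr 0" using l assms q by (intro powr_less_mono') auto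
    then show ?thesis using F False eq q by simp
  qed
qed

text \<open>A difference of two values of y factors, and \<open>q_factor_sign\<close> controls the
  second factor while \<open>s + t\<close> is at most 2 T. The bound T is left open because it is
  also used beyond L.\<close>

lemma yy_strict_mono:
  assumes q: "q > 0" "q \<noteq> 1" and ab: "\<alpha> * \<beta> \<le> 0 \<or> log q (\<alpha> * \<beta>) < - 2 * T"
    and "s < t" "t \<le> T"
  shows "if q > 1 \<or> \<alpha> * \<beta> > 0 then yy q \<alpha> \<beta> t < yy q \<alpha> \<beta> s else yy q \<alpha> \<beta> s < yy q \<alpha> \<beta> t"
proof -
  let ?y = "yy q \<alpha> \<beta>"
  have "?y s - ?y t = (q powr (- s) - q powr (- t)) * (1 - \<alpha> * \<beta> * q powr (s + t))"
    using q by (simp add: yy_def powr_add powr_minus field_simps)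
  moreover have "if q > 1 \<or> \<alpha> * \<beta> \<le> 0 then 1 - \<alpha> * \<beta> * q powr (s + t) > 0 else 1 - \<alpha> * \<beta> * q powr (s + t) < 0"
    using assms by (intro q_factor_sign[where T = "2 * T"]) auto
  moreover have "if q > 1 then q powr (- t) < q powr (- s) else q powr (- s) < q powr (- t)"
    using assms q powr_less_mono[of "- t" "- s" q] powr_less_mono'[of q "- t" "- s"] by auto
  moreover have "if (1::real) < Q \<or> 0 < k then a * b > 0 else a * b < 0"
    if "if 1 < Q \<or> k \<le> 0 then 0 < b else b < 0" "if 1 < Q then 0 < a else a < 0" for Q k a b :: real
    using that by (auto simp: zero_less_mult_iff mult_less_0_iff split: if_splits)
  ultimately have "if q > 1 \<or> \<alpha> * \<beta> > 0 then ?y s - ?y t > 0 else ?y s - ?y t < 0"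
    by (smt (verit, best))
  then show ?thesis by auto
qed

section \<open>The limiting characteristic equation\<close>

locale racah_limit =
  fixes q \<alpha> \<beta> \<gamma> \<delta> L :: real
  assumes q: "q > 0" "q \<noteq> 1" and gam: "\<gamma> = q powr (- L)" and L: "L > 1"
    and ab: "\<alpha> * \<beta> \<le> 0 \<or> log q (\<alpha> * \<beta>) < - 2 * L"
begin

abbreviation "y \<equiv> yy q \<alpha> \<beta>"
definition Bt where "Bt x = qB \<alpha> \<beta> \<delta> 1 \<gamma> (q powr x)"
definition Dt where "Dt x = qD \<alpha> \<beta> \<delta> 1 \<gamma> (q powr x)"
definition ct where "ct x = qc \<alpha> \<beta> \<delta> 1 \<gamma> (q powr x)"
definition dt where "dt x = sqrt (Bt x * Dt x)"

definition decreasing where "decreasing \<longleftrightarrow> q > 1 \<or> \<alpha> * \<beta> > 0"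

lemma yy_factor_nonzero: "t \<le> 2 * L \<Longrightarrow> 1 - \<alpha> * \<beta> * q powr t \<noteq> 0"
  using q_factor_sign[OF q, of "\<alpha> * \<beta>" "2 * L" t] ab by (auto split: if_splits)

lemma yy_less:
  assumes "s < t" "t \<le> L"
  shows "if decreasing then y t < y s else y s < y t"
  unfolding decreasing_def by (rule yy_strict_mono[OF q ab assms])

lemma yy_le_iff:
  assumes "s \<le> L" "t \<le> L"
  shows "y s \<le> y t \<longleftrightarrow> (if decreasing then t \<le> s else s \<le> t)"
  using yy_less[of s t] yy_less[of t s] assms by (cases s t rule: linorder_cases) auto

lemma yy_eq_iff: "s \<le> L \<Longrightarrow> t \<le> L \<Longrightarrow> y s = y t \<longleftrightarrow> s = t"
  using yy_less[of s t] yy_less[of t s] by (cases s t rule: linorder_cases) (auto split: if_splits)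

lemma isCont_yy: "isCont y t"
  unfolding yy_def using q by (intro continuous_intros) auto

lemma continuous_yy: "continuous_on A y"
  using isCont_yy by (simp add: continuous_at_imp_continuous_on)

lemma yy_onto:
  assumes "y 0 \<le> v \<and> v \<le> y L \<or> y L \<le> v \<and> v \<le> y 0"
  shows "\<exists>t\<in>{0..L}. y t = v"
proof -
  have "connected (y ` {0..L})" by (intro connected_continuous_image continuous_yy) auto
  moreover have "y 0 \<in> y ` {0..L}" "y L \<in> y ` {0..L}" using L by auto
  ultimately have "v \<in> y ` {0..L}" using assms unfolding connected_iff_interval by meson
  then show ?thesis by auto
qed

lemma derivative_mu: "deriv (mu q \<gamma> \<delta>) x = - ln q * q powr (- x) * (1 - \<gamma> * \<delta> * q powr (2 * x))"
proof -
  have "((\<lambda>x. q powr (- x) + \<gamma> * \<delta> * q powr x) has_real_derivative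
     (- ln q * q powr (- x) + \<gamma> * \<delta> * (ln q * q powr x))) (at x)"
    using q by (auto intro!: derivative_eq_intros)
  then have "deriv (mu q \<gamma> \<delta>) x = - ln q * q powr (- x) + \<gamma> * \<delta> * (ln q * q powr x)"
    unfolding mu_def[abs_def] by (rule DERIV_imp_deriv)
  also have "q powr x = q powr (- x) * q powr (2 * x)" using q by (simp add: powr_add[symmetric])
  finally show ?thesis by (simp add: algebra_simps)
qed

lemma derivative_mu_nonzero_iff: "deriv (mu q \<gamma> \<delta>) x \<noteq> 0 \<longleftrightarrow> 1 - \<gamma> * \<delta> * q powr (2 * x) \<noteq> 0"
  using q unfolding derivative_mu by simp

abbreviation "AC \<xi> \<equiv> coefA q \<alpha> \<beta> \<gamma> \<delta> \<xi> * coefC q \<alpha> \<beta> \<gamma> \<delta> \<xi>"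
text \<open>\<open>char_fun\<close> with A C in place of \<open>rec_a\<close> squared. The two agree
  only where A C \<ge> 0, and the proof of that inequality itself uses \<open>Fc\<close>.\<close>

definition Fc where "Fc x \<xi> = 4 * AC \<xi> - (mu q \<gamma> \<delta> x - rec_b q \<alpha> \<beta> \<gamma> \<delta> \<xi>)\<^sup>2"

text \<open>Both extra factors in the identity of discriminants are squares of nonzero numbers, so
  the two discriminants have the same sign and the same zeros in \<xi>.\<close>

lemma Fc_dual:
  assumes x: "1 - \<gamma> * \<delta> * q powr (2 * x) \<noteq> 0"
  shows "\<exists>K. K > 0 \<and> (\<forall>\<xi>\<le>L. (y \<xi>)\<^sup>2 - 4 * \<alpha> * \<beta> > 0 \<and>
    Fc x \<xi> = (4 * (Bt x * Dt x) - (y \<xi> - ct x)\<^sup>2) * (K / ((y \<xi>)\<^sup>2 - 4 * \<alpha> * \<beta>)))"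
proof -
  define X where "X = q powr x"
  define K where "K = (mu q \<gamma> \<delta> x)\<^sup>2 - 4 * \<gamma> * \<delta>"
  have X: "X \<noteq> 0" "X\<^sup>2 = q powr (2 * x)" "q powr (- x) = inverse X"
    using q by (auto simp: X_def power2_eq_square powr_add[symmetric] powr_minus)
  have Xn: "1 - \<gamma> * \<delta> * X\<^sup>2 \<noteq> 0" using x X by simp
  have "K = (inverse X - \<gamma> * \<delta> * X)\<^sup>2"
    unfolding K_def mu_def X(3) X_def[symmetric] using X(1) by (simp add: power2_eq_square field_simps)
  moreover have "inverse X - \<gamma> * \<delta> * X = (1 - \<gamma> * \<delta> * X\<^sup>2) / X" using X(1) by (simp add: field_simps power2_eq_square)
  ultimately have K: "K > 0" using Xn X(1) by simp
  have "(y \<xi>)\<^sup>2 - 4 * \<alpha> * \<beta> > 0 \<and> Fc x \<xi> = (4 * (Bt x * Dt x) - (y \<xi> - ct x)\<^sup>2) * (K / ((y \<xi>)\<^sup>2 - 4 * \<alpha> * \<beta>))"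
    if "\<xi> \<le> L" for \<xi>
  proof -
    define z where "z = q powr \<xi>"
    have z: "z \<noteq> 0" "q powr (2 * \<xi>) = z\<^sup>2" "q powr (- \<xi>) = inverse z"
      using q by (auto simp: z_def power2_eq_square powr_add[symmetric] powr_minus)
    have zn: "1 - \<alpha> * \<beta> * z\<^sup>2 \<noteq> 0" using yy_factor_nonzero[of "2 * \<xi>"] that z by simp
    have y: "y \<xi> = inverse z + \<alpha> * \<beta> * z" by (simp add: yy_def z z_def[symmetric])
    have "(y \<xi>)\<^sup>2 - 4 * \<alpha> * \<beta> = (inverse z - \<alpha> * \<beta> * z)\<^sup>2"
      unfolding y using z(1) by (simp add: power2_eq_square field_simps)
    moreover have "inverse z - \<alpha> * \<beta> * z = (1 - \<alpha> * \<beta> * z\<^sup>2) / z" using z(1) by (simp add: field_simps power2_eq_square)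
    ultimately have yp: "(y \<xi>)\<^sup>2 - 4 * \<alpha> * \<beta> > 0" using zn z(1) by simp
    have "Fc x \<xi> * ((y \<xi>)\<^sup>2 - 4 * \<alpha> * \<beta>) = (4 * (Bt x * Dt x) - (y \<xi> - ct x)\<^sup>2) * K"
      unfolding Fc_def K_def rec_b_def Bt_def Dt_def ct_def X_def[symmetric] mult.assoc[of 4, symmetric]
      unfolding mult.assoc[of 4 "qB _ _ _ _ _ _"]
      by (rule dual_discriminants[OF z(1) zn X(1) Xn y])
         (simp_all add: mu_def X coefA_def coefC_def z X_def[symmetric] z_def[symmetric])
    then show ?thesis using yp by (simp add: field_simps)
  qed
  then show ?thesis using K by blast
qed

lemma coefC_0: "coefC q \<alpha> \<beta> \<gamma> \<delta> 0 = 0"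
  using q by (simp add: coefC_def)

lemma coefA_L: "coefA q \<alpha> \<beta> \<gamma> \<delta> L = 0"
  using q by (simp add: coefA_def gam powr_add[symmetric])

text \<open>The last clause equates unordered pairs, since it depends on the direction of y which of
  the two values belongs to the smaller root.\<close>

definition roots_ok where
  "roots_ok x u v \<longleftrightarrow> 0 \<le> u \<and> u \<le> v \<and> v \<le> L \<and>
     {\<xi>\<in>{0..L}. char_fun q \<alpha> \<beta> \<gamma> \<delta> x \<xi> = 0} = {u, v} \<and>
     (u = v \<longrightarrow> (char_fun q \<alpha> \<beta> \<gamma> \<delta> x has_real_derivative 0) (at u within {0..L})) \<and>
     {y u, y v} = {ct x - 2 * dt x, ct x + 2 * dt x}"

lemma roots_exist:
  assumes x: "1 - \<gamma> * \<delta> * q powr (2 * x) \<noteq> 0"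
    and nonneg: "Bt x * Dt x \<ge> 0"
    and hull: "y 0 \<le> ct x \<and> ct x \<le> y L \<or> y L \<le> ct x \<and> ct x \<le> y 0"
    and ac: "\<And>\<xi>. \<xi> \<in> {0..L} \<Longrightarrow> AC \<xi> \<ge> 0"
  shows "\<exists>u v. roots_ok x u v"
proof -
  obtain K where K: "K > 0" "\<And>\<xi>. \<xi> \<le> L \<Longrightarrow> (y \<xi>)\<^sup>2 - 4 * \<alpha> * \<beta> > 0"
    "\<And>\<xi>. \<xi> \<le> L \<Longrightarrow> Fc x \<xi> = (4 * (Bt x * Dt x) - (y \<xi> - ct x)\<^sup>2) * (K / ((y \<xi>)\<^sup>2 - 4 * \<alpha> * \<beta>))"
    using Fc_dual[OF x] by auto
  have d: "dt x \<ge> 0" "Bt x * Dt x = (dt x)\<^sup>2" using nonneg by (auto simp: dt_def)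
  have cF: "char_fun q \<alpha> \<beta> \<gamma> \<delta> x \<xi> = Fc x \<xi>" if "\<xi> \<in> {0..L}" for \<xi>
    using ac[OF that] by (simp add: char_fun_def Fc_def rec_a_def)
  \<comment> \<open>At such a point \<open>Fc\<close> is minus a square. Both ends qualify, because
    C vanishes at 0 and A vanishes at L.\<close>
  have out: "2 * dt x \<le> \<bar>y \<xi> - ct x\<bar>" if "AC \<xi> = 0" "\<xi> \<le> L" for \<xi>
  proof -
    have "Fc x \<xi> \<le> 0" unfolding Fc_def that(1) by simp
    then have "4 * (Bt x * Dt x) - (y \<xi> - ct x)\<^sup>2 \<le> 0"
      using K(1,3) K(2)[OF that(2)] that(2) by (simp add: mult_le_0_iff divide_le_0_iff)
    then have "(2 * dt x)\<^sup>2 \<le> \<bar>y \<xi> - ct x\<bar>\<^sup>2" unfolding d(2) by (simp add: power_mult_distrib)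
    then show ?thesis by (rule power2_le_imp_le) simp
  qed
  have o: "2 * dt x \<le> \<bar>y 0 - ct x\<bar>" "2 * dt x \<le> \<bar>y L - ct x\<bar>" using out L coefC_0 coefA_L by auto
  have "\<exists>t\<in>{0..L}. y t = ct x - 2 * dt x" "\<exists>t\<in>{0..L}. y t = ct x + 2 * dt x"
    using o d(1) hull by (intro yy_onto; linarith)+
  then obtain t1 t2 where t: "t1 \<in> {0..L}" "y t1 = ct x - 2 * dt x" "t2 \<in> {0..L}" "y t2 = ct x + 2 * dt x" by auto
  have zero: "char_fun q \<alpha> \<beta> \<gamma> \<delta> x \<xi> = 0 \<longleftrightarrow> \<xi> = t1 \<or> \<xi> = t2" if "\<xi> \<in> {0..L}" for \<xi>
  proof -
    have "char_fun q \<alpha> \<beta> \<gamma> \<delta> x \<xi> = 0 \<longleftrightarrow> 4 * (Bt x * Dt x) - (y \<xi> - ct x)\<^sup>2 = 0"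
    proof -
      have "K / ((y \<xi>)\<^sup>2 - 4 * \<alpha> * \<beta>) \<noteq> 0" using K(1) K(2)[of \<xi>] that by auto
      moreover have "\<xi> \<le> L" using that by simp
      ultimately show ?thesis unfolding cF[OF that] by (simp only: K(3) mult_eq_0_iff simp_thms)
    qed
    also have "\<dots> \<longleftrightarrow> (y \<xi> - y t1) * (y \<xi> - y t2) = 0"
      unfolding d(2) t by (auto simp: power2_eq_square algebra_simps)
    also have "\<dots> \<longleftrightarrow> \<xi> = t1 \<or> \<xi> = t2" using yy_eq_iff[of \<xi> t1] yy_eq_iff[of \<xi> t2] t(1,3) that by auto
    finally show ?thesis .
  qed
  define u where "u = min t1 t2"
  define v where "v = max t1 t2"
  have uv: "{u, v} = {t1, t2}" by (auto simp: u_def v_def min_def max_def)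
  have "{\<xi>\<in>{0..L}. char_fun q \<alpha> \<beta> \<gamma> \<delta> x \<xi> = 0} = {u, v}" unfolding uv using zero t by auto
  moreover have "{y u, y v} = {ct x - 2 * dt x, ct x + 2 * dt x}"
    using uv t by (metis image_empty image_insert)
  moreover have "(char_fun q \<alpha> \<beta> \<gamma> \<delta> x has_real_derivative 0) (at u within {0..L})" if "u = v"
  proof -
    have "t1 = t2" using that by (auto simp: u_def v_def min_def max_def split: if_splits)
    then have d0: "dt x = 0" "u = t1" using t by (auto simp: u_def)
    have yd: "(y has_real_derivative (- ln q * q powr (- u) + \<alpha> * \<beta> * (ln q * q powr u))) (at u within {0..L})"
    proof (rule has_field_derivative_at_within)
      show "(y has_real_derivative (- ln q * q powr (- u) + \<alpha> * \<beta> * (ln q * q powr u))) (at u)"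
        unfolding yy_def[abs_def] using q by (auto intro!: derivative_eq_intros)
    qed
    have "(y u)\<^sup>2 - 4 * \<alpha> * \<beta> \<noteq> 0" using K(2)[of u] t d0 by auto
    then have kd: "((\<lambda>\<xi>. - (K / ((y \<xi>)\<^sup>2 - 4 * \<alpha> * \<beta>))) has_real_derivative
       (K * (2 * y u * (- ln q * q powr (- u) + \<alpha> * \<beta> * (ln q * q powr u))) / ((y u)\<^sup>2 - 4 * \<alpha> * \<beta>)\<^sup>2)) (at u within {0..L})"
      by (auto intro!: derivative_eq_intros yd simp: power2_eq_square)
    show ?thesis
    proof (rule has_real_derivative_0_of_square_factor[OF _ _ yd kd])
      fix s assume s: "s \<in> {0..L}"
      show "char_fun q \<alpha> \<beta> \<gamma> \<delta> x s = (y s - y u)\<^sup>2 * - (K / ((y s)\<^sup>2 - 4 * \<alpha> * \<beta>))"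
        unfolding cF[OF s] using K(3)[of s] s d(2) d0 t by simp
    qed (use t d0 in auto)
  qed
  ultimately show ?thesis using t unfolding roots_ok_def
    by (intro exI[of _ u] exI[of _ v]) (auto simp: u_def v_def)
qed

end

section \<open>Asymptotics of the spectral measures\<close>

lemma tendsto_nat_floor_mult:
  assumes "x \<ge> 0"
  shows "(\<lambda>n. real (nat \<lfloor>x * real n\<rfloor>) / real n) \<longlonglongrightarrow> x"
proof (rule tendsto_sandwich)
  show "\<forall>\<^sub>F n in sequentially. x - 1 / real n \<le> real (nat \<lfloor>x * real n\<rfloor>) / real n"
    using eventually_gt_at_top[of 0]
  proof eventually_elim
    case (elim n)
    have "x * real n - 1 \<le> real (nat \<lfloor>x * real n\<rfloor>)" using assms by (simp; linarith)
    then have "(x * real n - 1) / real n \<le> real (nat \<lfloor>x * real n\<rfloor>) / real n" by (rule divide_right_mono) simp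
    then show ?case using elim by (simp add: diff_divide_distrib)
  qed
  show "\<forall>\<^sub>F n in sequentially. real (nat \<lfloor>x * real n\<rfloor>) / real n \<le> x"
    using eventually_gt_at_top[of 0] by eventually_elim (use assms in \<open>simp add: field_simps; linarith\<close>)
  show "(\<lambda>n. x - 1 / real n) \<longlonglongrightarrow> x"
    using tendsto_diff[OF tendsto_const lim_1_over_n, of x] by simp
qed simp

text \<open>As x > 0, \<open>int (v n) + j\<close> is eventually positive and \<open>nat\<close>
  does not truncate.\<close>

lemma tendsto_shift_divide:
  assumes "(\<lambda>n. real (v n) / real n) \<longlonglongrightarrow> x" "x > 0"
  shows "(\<lambda>n. real (nat (int (v n) + j)) / real n) \<longlonglongrightarrow> x"
proof -
  have lim: "(\<lambda>n. real (v n) / real n + of_int j * (1 / real n)) \<longlonglongrightarrow> x"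
    using tendsto_add[OF assms(1) tendsto_mult[OF tendsto_const lim_1_over_n, of "of_int j"]] by simp
  have "\<forall>\<^sub>F n in sequentially. real (v n) / real n + of_int j * (1 / real n) > 0"
    using lim assms(2) by (rule order_tendstoD)
  then have "\<forall>\<^sub>F n in sequentially. real (v n) / real n + of_int j * (1 / real n) = real (nat (int (v n) + j)) / real n"
    using eventually_gt_at_top[of 0]
  proof eventually_elim
    case (elim n)
    then have "real (v n) + of_int j > 0" by (simp add: add_divide_distrib[symmetric] zero_less_divide_iff)
    then show ?case by (simp add: add_divide_distrib[symmetric])
  qed
  with lim show ?thesis by (rule Lim_transform_eventually)
qed

locale racah_seq =
  fixes q \<alpha> \<beta> \<gamma> \<delta> L :: real and M :: "nat \<Rightarrow> nat"
    and E :: "nat \<Rightarrow> nat \<Rightarrow> real poly" and e :: "nat \<Rightarrow> nat \<Rightarrow> nat \<Rightarrow> real"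
  assumes q: "q > 0" "q \<noteq> 1"
    and gam_lim: "(\<lambda>n. gam q M n) \<longlonglongrightarrow> \<gamma>"
    and L_def: "L = - log q \<gamma>"
    and L: "L > 1"
    and supp: "\<And>\<xi>. 0 < \<xi> \<Longrightarrow> \<xi> < L \<Longrightarrow>
      \<forall>\<^sub>F n in sequentially. \<xi> * real n < real (card {y\<in>{0..M n}. weight q \<alpha> \<beta> \<delta> M n y > 0})"
    and ab: "\<alpha> * \<beta> \<le> 0 \<or> log q (\<alpha> * \<beta>) < 2 * log q \<gamma>"
    and basis: "\<And>n. n \<ge> 1 \<Longrightarrow> racah_basis q \<alpha> \<beta> \<delta> M n (E n) (e n)"
begin

lemma racah: "n \<ge> 1 \<Longrightarrow> racah q \<alpha> \<beta> \<delta> M n"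
  using basis racah_basis.axioms(1) by blast

abbreviation "p n \<equiv> qbase q n"
abbreviation "g n \<equiv> gam q M n"
abbreviation "w n \<equiv> weight q \<alpha> \<beta> \<delta> M n"
definition m where "m n = card {y\<in>{0..M n}. w n y > 0}"
definition Lm where "Lm n k = inverse (p n ^ k) + \<alpha> * \<beta> * p n ^ Suc k"
definition B where "B n v = qB \<alpha> \<beta> \<delta> (p n) (g n) (p n ^ v)"
definition D where "D n v = qD \<alpha> \<beta> \<delta> (p n) (g n) (p n ^ v)"
definition C where "C n v = qc \<alpha> \<beta> \<delta> (p n) (g n) (p n ^ v)"

lemma m_eq: "n \<ge> 1 \<Longrightarrow> m n = card (racah.S q \<alpha> \<beta> \<delta> M n)"
  by (simp add: m_def racah.S_def[OF racah])

lemma in_S_iff: "n \<ge> 1 \<Longrightarrow> y \<in> racah.S q \<alpha> \<beta> \<delta> M n \<longleftrightarrow> y < m n"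
  unfolding m_eq by (subst racah.S_eq[OF racah]) auto

lemma eigen:
  assumes "n \<ge> 1" "k < m n" "v < m n"
  shows "Lm n k * e n k v = B n v * e n k (Suc v) + C n v * e n k v + D n v * e n k (v - 1)"
  using racah_basis.eigen[OF basis[OF assms(1)], of k v] assms
  unfolding Lm_def B_def C_def D_def racah.Lam_def[OF racah[OF assms(1)]] racah.Bc_def[OF racah[OF assms(1)]]
    racah.Cc_def[OF racah[OF assms(1)]] racah.Dc_def[OF racah[OF assms(1)]] m_eq[OF assms(1)] by simp

lemma op_basis: "n \<ge> 1 \<Longrightarrow> op_basis (racah.S q \<alpha> \<beta> \<delta> M n) (node q \<delta> M n) (w n) (E n) (e n)"
  by (rule racah_basis.basis[OF basis])

lemma complete:
  assumes "n \<ge> 1" "y < m n" "z < m n"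
  shows "(\<Sum>k<m n. e n k y * e n k z * w n y) = (if y = z then 1 else 0)"
  unfolding m_eq[OF assms(1)]
  by (rule op_basis.complete[OF op_basis[OF assms(1)]]) (use assms in_S_iff in auto)

lemma w_pos: "n \<ge> 1 \<Longrightarrow> y < m n \<Longrightarrow> w n y > 0"
  using racah.w_pos[OF racah, of n y] in_S_iff by auto

lemma normalized:
  assumes "n \<ge> 1" "k < m n"
  shows "(\<Sum>y<m n. (e n k y)\<^sup>2 * w n y) = 1"
proof -
  have S: "racah.S q \<alpha> \<beta> \<delta> M n = {..<m n}" using in_S_iff[OF assms(1)] by auto
  show ?thesis
    using op_basis.orthonormal[OF op_basis[OF assms(1)], of k k] assms
      op_system.ip_def[OF op_basis.axioms(1)[OF op_basis[OF assms(1)]], of "e n k" "e n k"]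
    unfolding S by (simp add: power2_eq_square)
qed

lemma B_D_nonneg: "n \<ge> 1 \<Longrightarrow> Suc y < m n \<Longrightarrow> B n y * D n (Suc y) \<ge> 0"
  using racah.Bc_Dc_nonneg[OF racah, of n y] in_S_iff
  by (auto simp: B_def D_def racah.Bc_def[OF racah] racah.Dc_def[OF racah])

lemma m_le: "n \<ge> 1 \<Longrightarrow> m n \<le> Suc (M n)"
  using racah.card_S_le[OF racah] by (simp add: m_eq)

lemma gam_pos: "\<gamma> > 0"
proof -
  have "\<gamma> \<ge> 0" by (rule LIMSEQ_le_const[OF gam_lim]) (use q in \<open>auto simp: gam_def\<close>)
  \<comment> \<open>\<open>ln 0\<close> is 0, so \<gamma> = 0 would give L = 0.\<close>
  moreover have "\<gamma> \<noteq> 0" using L_def L by (auto simp: log_def)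
  ultimately show ?thesis by simp
qed

lemma gam_eq: "\<gamma> = q powr (- L)"
  using gam_pos q by (simp add: L_def powr_log_cancel)

sublocale lim: racah_limit q \<alpha> \<beta> \<gamma> \<delta> L
  using q gam_eq L ab by unfold_locales (auto simp: L_def)

lemma M_lim: "(\<lambda>n. (real (M n) + 1) / real n) \<longlonglongrightarrow> L"
proof -
  have "(\<lambda>n. - (ln (g n) / ln q)) \<longlonglongrightarrow> - (ln \<gamma> / ln q)"
    using gam_pos q gam_lim by (intro tendsto_intros) auto
  moreover have "- (ln (g n) / ln q) = (real (M n) + 1) / real n" for n
    using q by (simp add: gam_def ln_powr) (simp add: add_divide_distrib diff_divide_distrib)
  ultimately show ?thesis by (simp add: L_def log_def)
qed

text \<open>The support assumption bounds the size from below, the number of nodes from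
  above.\<close>

lemma m_lim: "(\<lambda>n. real (m n) / real n) \<longlonglongrightarrow> L"
proof (rule order_tendstoI)
  fix a assume "a < L"
  then have "max a (1/2) < L" using L by auto
  then obtain \<xi> where \<xi>: "max a (1/2) < \<xi>" "\<xi> < L" using dense by blast
  have "\<forall>\<^sub>F n in sequentially. \<xi> * real n < real (m n)" unfolding m_def using \<xi> by (intro supp) auto
  then show "\<forall>\<^sub>F n in sequentially. a < real (m n) / real n"
    using eventually_gt_at_top[of 0]
  proof eventually_elim
    case (elim n)
    then have "\<xi> < real (m n) / real n" by (simp add: field_simps)
    then show ?case using \<xi> by simp
  qed
next
  fix a assume "L < a"
  then have "\<forall>\<^sub>F n in sequentially. (real (M n) + 1) / real n < a" using M_lim by (intro order_tendstoD)
  then show "\<forall>\<^sub>F n in sequentially. real (m n) / real n < a"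
    using eventually_gt_at_top[of 0]
  proof eventually_elim
    case (elim n)
    have "real (m n) / real n \<le> (real (M n) + 1) / real n"
      using m_le[of n] elim by (intro divide_right_mono) auto
    then show ?case using elim by simp
  qed
qed

lemma ev_less_m:
  assumes "(\<lambda>n. real (v n) / real n) \<longlonglongrightarrow> x" "x < L"
  shows "\<forall>\<^sub>F n in sequentially. v n < m n"
proof -
  obtain c where c: "x < c" "c < L" using assms(2) dense by blast
  have "\<forall>\<^sub>F n in sequentially. real (v n) / real n < c" using assms(1) c(1) by (rule order_tendstoD)
  moreover have "\<forall>\<^sub>F n in sequentially. c < real (m n) / real n" using m_lim c(2) by (rule order_tendstoD)
  ultimately show ?thesis using eventually_gt_at_top[of 0]
  proof eventually_elim
    case (elim n)
    then have "real (v n) / real n < real (m n) / real n" by simp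
    then show ?case using elim(3) by (simp add: divide_less_cancel)
  qed
qed

lemma n_less_m: "\<forall>\<^sub>F n in sequentially. n < m n"
proof (rule ev_less_m[of "\<lambda>n. n" 1])
  show "(\<lambda>n. real n / real n) \<longlonglongrightarrow> 1"
    by (rule tendsto_eventually, use eventually_gt_at_top[of 0] in eventually_elim) simp
qed (rule L)

lemma p_pow: "n \<ge> 1 \<Longrightarrow> p n ^ y = q powr (real y / real n)"
  using racah.p_pow[OF racah] .

lemma p_lim: "p \<longlonglongrightarrow> 1"
proof -
  have "(\<lambda>n. q powr (1 / real n)) \<longlonglongrightarrow> q powr 0"
    using q by (intro tendsto_intros lim_1_over_n) auto
  then show ?thesis using q by (simp add: qbase_def[abs_def])
qed

lemma p_pow_lim:
  assumes "(\<lambda>n. real (v n) / real n) \<longlonglongrightarrow> x"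
  shows "(\<lambda>n. p n ^ v n) \<longlonglongrightarrow> q powr x"
proof (rule Lim_transform_eventually)
  show "(\<lambda>n. q powr (real (v n) / real n)) \<longlonglongrightarrow> q powr x" using assms q by (intro tendsto_intros) auto
  show "\<forall>\<^sub>F n in sequentially. q powr (real (v n) / real n) = p n ^ v n"
    using eventually_ge_at_top[of 1] by eventually_elim (simp add: p_pow)
qed

lemma Lm_lim:
  assumes "(\<lambda>n. real (v n) / real n) \<longlonglongrightarrow> x"
  shows "(\<lambda>n. Lm n (v n)) \<longlonglongrightarrow> lim.y x"
proof -
  have "(\<lambda>n. inverse (p n ^ v n) + \<alpha> * \<beta> * (p n * p n ^ v n)) \<longlonglongrightarrow> inverse (q powr x) + \<alpha> * \<beta> * (1 * q powr x)"
    using q by (intro tendsto_intros p_pow_lim assms p_lim) auto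
  then show ?thesis by (simp add: Lm_def[abs_def] yy_def powr_minus)
qed

text \<open>At a zero x the strictly monotone \<open>f\<close> changes sign. Then for large
  \<open>n\<close> the factors \<open>h\<close> of the node differences would have opposite signs
  near x1 n and x2 n, against the monotonicity of the nodes.\<close>

lemma limit_factor_nonzero:
  assumes x: "0 < x" "x < L"
  shows "1 - \<gamma> * \<delta> * q powr (2 * x) \<noteq> 0"
proof
  assume zero: "1 - \<gamma> * \<delta> * q powr (2 * x) = 0"
  define f where "f t = 1 - \<gamma> * \<delta> * q powr (2 * t)" for t
  have gd: "\<gamma> * \<delta> = q powr (- (2 * x))" using zero q by (simp add: powr_minus field_simps)
  have f: "f t = 1 - q powr (2 * (t - x))" for t
    unfolding f_def gd using q by (simp add: powr_add[symmetric] algebra_simps)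
  obtain x1 x2 where x12: "0 < x1" "x1 < x" "x < x2" "x2 < L" using x dense by metis
  have opp: "f x1 * f x2 < 0"
  proof (cases "q > 1")
    case True
    have "q powr (2 * (x1 - x)) < q powr 0" "q powr 0 < q powr (2 * (x2 - x))"
      by (rule powr_less_mono; use x12 True in simp)+
    then show ?thesis using q by (simp add: f mult_less_0_iff)
  next
    case False
    have "q powr (2 * (x1 - x)) > q powr 0" "q powr 0 > q powr (2 * (x2 - x))"
      by (rule powr_less_mono'; use x12 q False in simp)+
    then show ?thesis using q by (simp add: f mult_less_0_iff)
  qed
  define h where "h n y = 1 - g n * \<delta> * p n ^ (2 * y + 2)" for n y
  have hl: "(\<lambda>n. h n (nat \<lfloor>t * real n\<rfloor>)) \<longlonglongrightarrow> f t" if "t > 0" for t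
  proof -
    have "(\<lambda>n. real (2 * nat \<lfloor>t * real n\<rfloor> + 2) / real n) \<longlonglongrightarrow> 2 * t"
    proof -
      have "(\<lambda>n. 2 * (real (nat \<lfloor>t * real n\<rfloor>) / real n) + 2 * (1 / real n)) \<longlonglongrightarrow> 2 * t + 2 * 0"
        using that by (intro tendsto_intros tendsto_nat_floor_mult lim_1_over_n) auto
      then show ?thesis by (simp add: add_divide_distrib add.commute)
    qed
    from p_pow_lim[OF this] have "(\<lambda>n. 1 - g n * \<delta> * p n ^ (2 * nat \<lfloor>t * real n\<rfloor> + 2)) \<longlonglongrightarrow> 1 - \<gamma> * \<delta> * q powr (2 * t)"
      by (intro tendsto_intros gam_lim)
    then show ?thesis by (simp add: h_def f_def)
  qed
  have "(\<lambda>n. h n (nat \<lfloor>x1 * real n\<rfloor>) * h n (nat \<lfloor>x2 * real n\<rfloor>)) \<longlonglongrightarrow> f x1 * f x2"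
    using x12 by (intro tendsto_mult hl) auto
  then have "\<forall>\<^sub>F n in sequentially. h n (nat \<lfloor>x1 * real n\<rfloor>) * h n (nat \<lfloor>x2 * real n\<rfloor>) < 0"
    using opp by (rule order_tendstoD)
  moreover have "\<forall>\<^sub>F n in sequentially. nat \<lfloor>x2 * real n\<rfloor> + 1 < m n"
  proof (rule ev_less_m)
    show "(\<lambda>n. real (nat \<lfloor>x2 * real n\<rfloor> + 1) / real n) \<longlonglongrightarrow> x2"
      using tendsto_shift_divide[OF tendsto_nat_floor_mult, of x2 1] x12 by (simp add: nat_add_distrib)
  qed (use x12 in auto)
  ultimately have "\<forall>\<^sub>F n in sequentially. False"
    using eventually_ge_at_top[of 1]
  proof eventually_elim
    case (elim n)
    note h_sign = racah.h_sign[OF racah[OF elim(3)], unfolded racah.h_def[OF racah[OF elim(3)]], folded h_def]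
    obtain s where s: "s \<noteq> 0" "\<And>y. y < M n \<Longrightarrow> s * h n y > 0" using h_sign by blast
    have "nat \<lfloor>x2 * real n\<rfloor> < M n" using elim m_le[of n] by simp
    moreover have "nat \<lfloor>x1 * real n\<rfloor> \<le> nat \<lfloor>x2 * real n\<rfloor>"
      using x12 by (intro nat_mono floor_mono mult_right_mono) auto
    ultimately have "s * h n (nat \<lfloor>x1 * real n\<rfloor>) > 0" "s * h n (nat \<lfloor>x2 * real n\<rfloor>) > 0"
      using s(2) by auto
    then have "(s * s) * (h n (nat \<lfloor>x1 * real n\<rfloor>) * h n (nat \<lfloor>x2 * real n\<rfloor>)) > 0"
      by (metis mult.assoc mult.left_commute mult_pos_pos)
    then have "h n (nat \<lfloor>x1 * real n\<rfloor>) * h n (nat \<lfloor>x2 * real n\<rfloor>) > 0"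
      using s(1) by (simp add: zero_less_mult_iff)
    then show ?case using elim(1) by simp
  qed
  then show False by simp
qed

end

section \<open>Local limits of the coefficients and of the spectral moments\<close>

context racah_seq
begin

lemma coefficient_limits:
  assumes v: "(\<lambda>n. real (v n) / real n) \<longlonglongrightarrow> x" and x: "0 < x" "x < L"
  shows "(\<lambda>n. B n (v n)) \<longlonglongrightarrow> lim.Bt x" "(\<lambda>n. D n (v n)) \<longlonglongrightarrow> lim.Dt x" "(\<lambda>n. C n (v n)) \<longlonglongrightarrow> lim.ct x"
proof -
  have X2: "(q powr x)\<^sup>2 = q powr (2 * x)" using q by (simp add: power2_eq_square powr_add[symmetric])
  have nz: "1 - \<gamma> * \<delta> * (q powr x)\<^sup>2 \<noteq> 0" using limit_factor_nonzero[OF x] unfolding X2 .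
  note X = p_pow_lim[OF v]
  show B: "(\<lambda>n. B n (v n)) \<longlonglongrightarrow> lim.Bt x"
    unfolding B_def lim.Bt_def qB_def by (intro tendsto_intros p_lim X gam_lim) (use nz in auto)
  show D: "(\<lambda>n. D n (v n)) \<longlonglongrightarrow> lim.Dt x"
    unfolding D_def lim.Dt_def qD_def by (intro tendsto_intros p_lim X gam_lim) (use nz in auto)
  have "(\<lambda>n. 1 + \<alpha> * \<beta> * p n - B n (v n) - D n (v n)) \<longlonglongrightarrow> 1 + \<alpha> * \<beta> * 1 - lim.Bt x - lim.Dt x"
    by (intro tendsto_intros p_lim B D)
  then show "(\<lambda>n. C n (v n)) \<longlonglongrightarrow> lim.ct x"
    unfolding C_def B_def D_def lim.ct_def lim.Bt_def lim.Dt_def qc_def by simp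
qed

text \<open>For finite size the nonnegative product pairs B at \<open>v\<close> with D at
  \<open>v + 1\<close>; the shift disappears in the limit.\<close>

lemma Bt_Dt_nonneg:
  assumes x: "0 < x" "x < L"
  shows "lim.Bt x * lim.Dt x \<ge> 0"
proof -
  define v where "v n = nat \<lfloor>x * real n\<rfloor>" for n
  have v: "(\<lambda>n. real (v n) / real n) \<longlonglongrightarrow> x" unfolding v_def using x by (intro tendsto_nat_floor_mult) auto
  have v1: "(\<lambda>n. real (Suc (v n)) / real n) \<longlonglongrightarrow> x"
    using tendsto_shift_divide[OF v x(1), of 1] by (simp add: nat_add_distrib)
  have "(\<lambda>n. B n (v n) * D n (Suc (v n))) \<longlonglongrightarrow> lim.Bt x * lim.Dt x"
    by (intro tendsto_mult coefficient_limits v v1 x)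
  moreover have "\<forall>\<^sub>F n in sequentially. B n (v n) * D n (Suc (v n)) \<ge> 0"
    using ev_less_m[OF v1 x(2)] eventually_ge_at_top[of 1] by eventually_elim (rule B_D_nonneg)
  ultimately show ?thesis by (rule tendsto_lowerbound) simp
qed

text \<open>The total weight of the paths of \<open>r\<close> steps from \<open>j\<close> to 0, with
  the coefficients frozen at x: \<open>Bt\<close> for a step up, \<open>Dt\<close> for a step down,
  \<open>ct\<close> for staying.\<close>

primrec path_moment :: "real \<Rightarrow> nat \<Rightarrow> int \<Rightarrow> real" where
  "path_moment x 0 = (\<lambda>j. if j = 0 then 1 else 0)"
| "path_moment x (Suc r) = (\<lambda>j. lim.Bt x * path_moment x r (j + 1) + lim.ct x * path_moment x r j
      + lim.Dt x * path_moment x r (j - 1))"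

text \<open>The eigenvalue equation at the point \<open>v n + j\<close> trades one power of the
  eigenvalue for the neighbouring \<open>j\<close>, so the induction runs over all \<open>j\<close>
  at once. A fixed shift does not change the limits of the coefficients; the base case is
  completeness.\<close>

lemma moment_limit:
  assumes v: "(\<lambda>n. real (v n) / real n) \<longlonglongrightarrow> x" and x: "0 < x" "x < L"
  shows "(\<lambda>n. \<Sum>k<m n. Lm n k ^ r * (e n k (v n) * e n k (nat (int (v n) + j)) * w n (v n))) \<longlonglongrightarrow> path_moment x r j"
proof (induction r arbitrary: j)
  case 0
  have "\<forall>\<^sub>F n in sequentially. (\<Sum>k<m n. Lm n k ^ 0 * (e n k (v n) * e n k (nat (int (v n) + j)) * w n (v n)))
     = (if j = 0 then 1 else 0)"
    using eventually_ge_at_top[of 1] ev_less_m[OF v x(2)]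
      ev_less_m[OF tendsto_shift_divide[OF v x(1), of j] x(2)]
      order_tendstoD(1)[OF tendsto_shift_divide[OF v x(1), of j] x(1)]
  proof eventually_elim
    case (elim n)
    have "int (v n) + j > 0" using elim(4) by (simp add: zero_less_divide_iff)
    then have "v n = nat (int (v n) + j) \<longleftrightarrow> j = 0" by auto
    then show ?case using complete[OF elim(1-3)] by simp
  qed
  then show ?case unfolding path_moment.simps by (rule tendsto_eventually)
next
  case (Suc r)
  define z where "z n = nat (int (v n) + j)" for n
  define t where "t n j = (\<Sum>k<m n. Lm n k ^ r * (e n k (v n) * e n k (nat (int (v n) + j)) * w n (v n)))" for n j
  have z: "(\<lambda>n. real (z n) / real n) \<longlonglongrightarrow> x" unfolding z_def by (rule tendsto_shift_divide[OF v x(1)])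
  have "(\<lambda>n. B n (z n) * t n (j + 1) + C n (z n) * t n j + D n (z n) * t n (j - 1)) \<longlonglongrightarrow> path_moment x (Suc r) j"
    unfolding path_moment.simps t_def by (intro tendsto_intros coefficient_limits[OF z x] Suc.IH)
  moreover have "\<forall>\<^sub>F n in sequentially. B n (z n) * t n (j + 1) + C n (z n) * t n j + D n (z n) * t n (j - 1)
    = (\<Sum>k<m n. Lm n k ^ Suc r * (e n k (v n) * e n k (z n) * w n (v n)))"
    using eventually_ge_at_top[of 1] ev_less_m[OF z x(2)]
      order_tendstoD(1)[OF tendsto_shift_divide[OF v x(1), of "j - 1"] x(1)]
  proof eventually_elim
    case (elim n)
    \<comment> \<open>This keeps \<open>nat\<close> and the subtraction in \<open>z n - 1\<close>
      from truncating.\<close>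
    have "int (v n) + (j - 1) > 0" using elim(3) by (simp add: zero_less_divide_iff)
    then have zz: "nat (int (v n) + (j + 1)) = Suc (z n)" "nat (int (v n) + (j - 1)) = z n - 1"
      "nat (int (v n) + j) = z n" by (auto simp: z_def)
    have "(\<Sum>k<m n. Lm n k ^ Suc r * (e n k (v n) * e n k (z n) * w n (v n)))
      = (\<Sum>k<m n. Lm n k ^ r * (e n k (v n) * (Lm n k * e n k (z n)) * w n (v n)))"
      by (simp add: mult_ac)
    also have "\<dots> = (\<Sum>k<m n. B n (z n) * (Lm n k ^ r * (e n k (v n) * e n k (Suc (z n)) * w n (v n)))
        + C n (z n) * (Lm n k ^ r * (e n k (v n) * e n k (z n) * w n (v n)))
        + D n (z n) * (Lm n k ^ r * (e n k (v n) * e n k (z n - 1) * w n (v n))))"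
      using eigen[OF elim(1) _ elim(2)] by (intro sum.cong refl) (simp add: algebra_simps)
    also have "\<dots> = B n (z n) * t n (j + 1) + C n (z n) * t n j + D n (z n) * t n (j - 1)"
      unfolding t_def zz by (simp only: sum.distrib sum_distrib_left)
    finally show ?case by simp
  qed
  ultimately show ?case unfolding z_def[symmetric] by (rule Lim_transform_eventually)
qed

text \<open>Conjugating with powers of \<open>\<kappa>\<close> makes the limiting three-term operator symmetric.\<close>

lemma path_moment_eq_arc_fourier:
  assumes d: "lim.dt x > 0"
  shows "path_moment x r j = (lim.dt x / lim.Bt x) powi j * arc_fourier (lim.ct x) (lim.dt x) r j"
proof (induction r arbitrary: j)
  case (Suc r)
  define \<kappa> where "\<kappa> = lim.dt x / lim.Bt x"
  have BD: "lim.Bt x * lim.Dt x > 0" using d by (simp add: lim.dt_def)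
  then have d2: "lim.dt x * lim.dt x = lim.Bt x * lim.Dt x" by (simp add: lim.dt_def)
  have B: "lim.Bt x \<noteq> 0" using BD by auto
  have \<kappa>: "\<kappa> \<noteq> 0" "lim.Bt x * \<kappa> = lim.dt x" "lim.Dt x = lim.dt x * \<kappa>"
    using B d d2 by (auto simp: \<kappa>_def field_simps)
  have "lim.Bt x * \<kappa> powi (j + 1) = lim.dt x * \<kappa> powi j" "lim.Dt x * \<kappa> powi (j - 1) = lim.dt x * \<kappa> powi j"
    using \<kappa> by (simp_all add: power_int_add power_int_diff)
  then have "lim.Bt x * (\<kappa> powi (j + 1) * a) + c * (\<kappa> powi j * b) + lim.Dt x * (\<kappa> powi (j - 1) * f)
    = \<kappa> powi j * (lim.dt x * f + c * b + lim.dt x * a)" for a b c f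
    unfolding mult.assoc[symmetric] by (simp add: algebra_simps)
  then show ?case unfolding path_moment.simps Suc.IH arc_fourier_Suc \<kappa>_def[symmetric] by simp
qed (simp add: arc_fourier_0)

text \<open>Pulling out p^(1/2) splits the extra factor p in the second summand evenly. The
  eigenvalue is then exactly a multiple of y at a half-integer point, and inherits the monotonicity
  of y.\<close>

lemma Lm_eq:
  assumes "n \<ge> 1"
  shows "Lm n k = q powr (1 / (2 * real n)) * lim.y ((real k + 1 / 2) / real n)"
proof -
  have "p n ^ Suc k = q powr (1 / (2 * real n)) * q powr ((real k + 1 / 2) / real n)"
  proof -
    have "real (Suc k) / real n = 1 / (2 * real n) + (real k + 1 / 2) / real n"
      using assms by (simp add: field_simps)
    then show ?thesis unfolding p_pow[OF assms] powr_add[symmetric] by (rule arg_cong)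
  qed
  moreover have "inverse (p n ^ k) = q powr (1 / (2 * real n)) * q powr (- ((real k + 1 / 2) / real n))"
    unfolding p_pow[OF assms] powr_add[symmetric] powr_minus[symmetric] using assms by (simp add: field_simps)
  ultimately show ?thesis by (simp add: Lm_def yy_def distrib_left)
qed

text \<open>The points (k + 1/2) / n may exceed L slightly, as (M n + 1) / n may approach L from
  above; the strict inequality on \<alpha>\<beta> keeps y monotone a little further.\<close>

lemma larger_L: obtains L1 where "L1 > L" "\<alpha> * \<beta> \<le> 0 \<or> log q (\<alpha> * \<beta>) < - 2 * L1"
proof (cases "\<alpha> * \<beta> \<le> 0")
  case True
  then show ?thesis using that[of "L + 1"] by simp
next
  case False
  then have "log q (\<alpha> * \<beta>) < - 2 * L" using ab by (auto simp: L_def)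
  then have "L < - log q (\<alpha> * \<beta>) / 2" by simp
  then obtain L1 where "L < L1" "L1 < - log q (\<alpha> * \<beta>) / 2" using dense by blast
  then show ?thesis using that[of L1] by simp
qed

lemma ev_index_bound:
  assumes "L < L'"
  shows "\<forall>\<^sub>F n in sequentially. \<forall>k<m n. (real k + 1 / 2) / real n < L'"
  using order_tendstoD(2)[OF M_lim assms] eventually_ge_at_top[of 1]
proof eventually_elim
  case (elim n)
  show ?case
  proof (intro allI impI)
    fix k assume "k < m n"
    then have "(real k + 1 / 2) / real n \<le> (real (M n) + 1) / real n"
      using m_le[OF elim(2)] by (intro divide_right_mono) auto
    then show "(real k + 1 / 2) / real n < L'" using elim by simp
  qed
qed

lemma Lm_strict_mono:
  "\<forall>\<^sub>F n in sequentially. \<forall>l<m n. \<forall>k<l. if lim.decreasing then Lm n l < Lm n k else Lm n k < Lm n l"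
proof -
  obtain L1 where L1: "L1 > L" "\<alpha> * \<beta> \<le> 0 \<or> log q (\<alpha> * \<beta>) < - 2 * L1" by (rule larger_L)
  show ?thesis using ev_index_bound[OF L1(1)] eventually_ge_at_top[of 1]
  proof eventually_elim
    case (elim n)
    show ?case
    proof (intro allI impI)
      fix l k assume kl: "l < m n" "k < l"
      have "(real k + 1 / 2) / real n < (real l + 1 / 2) / real n"
        using kl elim(2) by (intro divide_strict_right_mono) auto
      from yy_strict_mono[OF q L1(2) this] elim kl q
      show "if lim.decreasing then Lm n l < Lm n k else Lm n k < Lm n l"
        unfolding Lm_eq[OF elim(2)] lim.decreasing_def by (auto intro!: less_imp_le)
    qed
  qed
qed

lemma yy_between:
  assumes "\<alpha> * \<beta> \<le> 0 \<or> log q (\<alpha> * \<beta>) < - 2 * L1" "0 < s" "s < L1"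
  shows "min (lim.y 0) (lim.y L1) \<le> lim.y s \<and> lim.y s \<le> max (lim.y 0) (lim.y L1)"
  using yy_strict_mono[OF q assms(1), of 0 s] yy_strict_mono[OF q assms(1), of s L1] assms
  by (auto split: if_splits)

lemma Lm_between:
  assumes "L < L'" "\<alpha> * \<beta> \<le> 0 \<or> log q (\<alpha> * \<beta>) < - 2 * L'"
  shows "\<forall>\<^sub>F n in sequentially. \<forall>k<m n. q powr (1 / (2 * real n)) * min (lim.y 0) (lim.y L') \<le> Lm n k
      \<and> Lm n k \<le> q powr (1 / (2 * real n)) * max (lim.y 0) (lim.y L')"
  using ev_index_bound[OF assms(1)] eventually_ge_at_top[of 1]
proof eventually_elim
  case (elim n)
  show ?case
  proof (intro allI impI)
    fix k assume "k < m n"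
    then have "min (lim.y 0) (lim.y L') \<le> lim.y ((real k + 1 / 2) / real n) \<and> lim.y ((real k + 1 / 2) / real n) \<le> max (lim.y 0) (lim.y L')"
      using elim by (intro yy_between assms(2)) auto
    then show "q powr (1 / (2 * real n)) * min (lim.y 0) (lim.y L') \<le> Lm n k
      \<and> Lm n k \<le> q powr (1 / (2 * real n)) * max (lim.y 0) (lim.y L')"
      unfolding Lm_eq[OF elim(2)] by (intro conjI mult_left_mono) auto
  qed
qed

lemma q_half_lim: "(\<lambda>n. q powr (1 / (2 * real n))) \<longlonglongrightarrow> 1"
proof -
  have "(\<lambda>n. q powr (1 / 2 * (1 / real n))) \<longlonglongrightarrow> q powr (1 / 2 * 0)"
    using q by (intro tendsto_intros lim_1_over_n) auto
  then show ?thesis using q by simp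
qed

lemma Lm_bounded: "\<exists>R. \<forall>\<^sub>F n in sequentially. \<forall>k<m n. \<bar>Lm n k\<bar> \<le> R"
proof -
  obtain L1 where L1: "L1 > L" "\<alpha> * \<beta> \<le> 0 \<or> log q (\<alpha> * \<beta>) < - 2 * L1" by (rule larger_L)
  define R where "R = \<bar>lim.y 0\<bar> + \<bar>lim.y L1\<bar>"
  have "\<forall>\<^sub>F n in sequentially. q powr (1 / (2 * real n)) < 2" using q_half_lim by (rule order_tendstoD) simp
  with Lm_between[OF L1] have "\<forall>\<^sub>F n in sequentially. \<forall>k<m n. \<bar>Lm n k\<bar> \<le> 2 * R"
  proof eventually_elim
    case (elim n)
    show ?case
    proof (intro allI impI)
      fix k assume "k < m n"
      let ?s = "q powr (1 / (2 * real n))"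
      have "?s * R \<le> 2 * R" using elim(2) by (intro mult_right_mono) (auto simp: R_def)
      moreover have "?s * max (lim.y 0) (lim.y L1) \<le> ?s * R" "?s * - R \<le> ?s * min (lim.y 0) (lim.y L1)"
        by (rule mult_left_mono, auto simp: R_def)+
      ultimately show "\<bar>Lm n k\<bar> \<le> 2 * R" using elim(1) \<open>k < m n\<close> by force
    qed
  qed
  then show ?thesis by blast
qed

section \<open>The spectral measure at a macroscopic position\<close>

definition N where "N x n k = (e n k (nat \<lfloor>x * real n\<rfloor>))\<^sup>2 * w n (nat \<lfloor>x * real n\<rfloor>)"

lemma floor_lim: "x > 0 \<Longrightarrow> (\<lambda>n. real (nat \<lfloor>x * real n\<rfloor>) / real n) \<longlonglongrightarrow> x"
  by (intro tendsto_nat_floor_mult) simp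

lemma N_nonneg:
  assumes x: "0 < x" "x < L"
  shows "\<forall>\<^sub>F n in sequentially. \<forall>k<m n. N x n k \<ge> 0"
  using eventually_ge_at_top[of 1] ev_less_m[OF floor_lim[OF x(1)] x(2)]
  by eventually_elim (auto simp: N_def intro!: mult_nonneg_nonneg less_imp_le[OF w_pos])

lemma N_total:
  assumes x: "0 < x" "x < L"
  shows "\<forall>\<^sub>F n in sequentially. (\<Sum>k<m n. N x n k) = 1"
  using eventually_ge_at_top[of 1] ev_less_m[OF floor_lim[OF x(1)] x(2)]
proof eventually_elim
  case (elim n)
  then show ?case using complete[OF elim elim(2)] by (simp add: N_def power2_eq_square)
qed

lemma N_moments:
  assumes x: "0 < x" "x < L"
  shows "(\<lambda>n. \<Sum>k<m n. N x n k * Lm n k ^ r) \<longlonglongrightarrow> path_moment x r 0"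
  using moment_limit[OF floor_lim[OF x(1)] x, of r 0, unfolded add_0_right nat_int]
  by (simp add: N_def power2_eq_square mult_ac)

text \<open>By the first moment, c(x) is a limit of averages of eigenvalues and so cannot leave
  their hull. \<open>ct_hull\<close> then lets L' decrease to L.\<close>

lemma ct_hull_extended:
  assumes x: "0 < x" "x < L" and L': "L < L'" "\<alpha> * \<beta> \<le> 0 \<or> log q (\<alpha> * \<beta>) < - 2 * L'"
  shows "min (lim.y 0) (lim.y L') \<le> lim.ct x \<and> lim.ct x \<le> max (lim.y 0) (lim.y L')"
proof -
  let ?s = "\<lambda>n. q powr (1 / (2 * real n))" and ?t = "\<lambda>n. \<Sum>k<m n. N x n k * Lm n k"
  have t: "?t \<longlonglongrightarrow> lim.ct x" using N_moments[OF x, of 1] by simp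
  have s: "(\<lambda>n. ?s n * c) \<longlonglongrightarrow> c" for c using tendsto_mult_right[OF q_half_lim, of c] by simp
  have "\<forall>\<^sub>F n in sequentially. ?s n * min (lim.y 0) (lim.y L') \<le> ?t n \<and> ?t n \<le> ?s n * max (lim.y 0) (lim.y L')"
    using Lm_between[OF L'] N_nonneg[OF x] N_total[OF x]
  proof eventually_elim
    case (elim n)
    have "(\<Sum>k<m n. N x n k * (?s n * min (lim.y 0) (lim.y L'))) \<le> ?t n"
      using elim(1,2) by (intro sum_mono mult_left_mono) auto
    moreover have "?t n \<le> (\<Sum>k<m n. N x n k * (?s n * max (lim.y 0) (lim.y L')))"
      using elim(1,2) by (intro sum_mono mult_left_mono) auto
    ultimately show ?case by (simp only: sum_distrib_right[symmetric] elim(3)) simp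
  qed
  then have "\<forall>\<^sub>F n in sequentially. ?s n * min (lim.y 0) (lim.y L') \<le> ?t n"
    "\<forall>\<^sub>F n in sequentially. ?t n \<le> ?s n * max (lim.y 0) (lim.y L')" by (auto elim: eventually_mono)
  from tendsto_le[OF _ t s this(1)] tendsto_le[OF _ s t this(2)] show ?thesis by simp
qed

lemma ct_hull:
  assumes x: "0 < x" "x < L"
  shows "min (lim.y 0) (lim.y L) \<le> lim.ct x \<and> lim.ct x \<le> max (lim.y 0) (lim.y L)"
proof -
  obtain L1 where L1: "L1 > L" "\<alpha> * \<beta> \<le> 0 \<or> log q (\<alpha> * \<beta>) < - 2 * L1" by (rule larger_L)
  have ev: "\<forall>\<^sub>F L' in at_right L. min (lim.y 0) (lim.y L') \<le> lim.ct x \<and> lim.ct x \<le> max (lim.y 0) (lim.y L')"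
  proof -
    have "\<forall>\<^sub>F L' in at_right L. L < L' \<and> L' < L1"
      using L1(1) by (auto simp: eventually_at_right_field)
    then show ?thesis by eventually_elim (rule ct_hull_extended[OF x], use L1(2) in auto)
  qed
  have y: "(lim.y \<longlongrightarrow> lim.y L) (at_right L)"
    using lim.isCont_yy[of L] by (auto simp: isCont_def intro: filterlim_at_split[THEN iffD1, THEN conjunct2])
  have "min (lim.y 0) (lim.y L) \<le> lim.ct x"
    by (rule tendsto_upperbound[OF tendsto_min[OF tendsto_const y]]) (use ev in \<open>auto elim: eventually_mono\<close>)
  moreover have "lim.ct x \<le> max (lim.y 0) (lim.y L)"
    by (rule tendsto_lowerbound[OF tendsto_max[OF tendsto_const y]]) (use ev in \<open>auto elim: eventually_mono\<close>)
  ultimately show ?thesis by simp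
qed

lemma N_arc_convergence:
  assumes x: "0 < x" "x < L" and d: "lim.dt x > 0"
  shows "\<exists>R. arc_convergence m (N x) Lm R (lim.ct x) (lim.dt x)"
proof -
  obtain R where "\<forall>\<^sub>F n in sequentially. \<forall>k<m n. \<bar>Lm n k\<bar> \<le> R" using Lm_bounded by blast
  then have "arc_convergence m (N x) Lm R (lim.ct x) (lim.dt x)"
    using N_nonneg[OF x] N_total[OF x] N_moments[OF x] path_moment_eq_arc_fourier[OF d, of _ 0]
    by unfold_locales auto
  then show ?thesis by blast
qed

definition Kn where "Kn n y = (\<Sum>k<n. (e n k y)\<^sup>2) * w n y"

definition density where
  "density x = (let a = arccos (clamp1 ((lim.y 1 - lim.ct x) / (2 * lim.dt x))) / pi
     in if lim.decreasing then a else 1 - a)"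

text \<open>If the eigenvalues decrease, the indices below \<open>n\<close> are those above the n-th
  eigenvalue. Otherwise the indices from \<open>n\<close> on are taken and their mass is subtracted
  from 1.\<close>

lemma Kn_limit:
  assumes x: "0 < x" "x < L" and d: "lim.dt x > 0"
  shows "(\<lambda>n. Kn n (nat \<lfloor>x * real n\<rfloor>)) \<longlonglongrightarrow> density x"
proof -
  obtain R where "arc_convergence m (N x) Lm R (lim.ct x) (lim.dt x)" using N_arc_convergence[OF x d] by blast
  then interpret ac: arc_convergence m "N x" Lm R "lim.ct x" "lim.dt x" .
  have tau: "(\<lambda>n. Lm n n) \<longlonglongrightarrow> lim.y 1"
    by (rule Lm_lim, rule tendsto_eventually, use eventually_gt_at_top[of 0] in eventually_elim) simp
  have K: "Kn n (nat \<lfloor>x * real n\<rfloor>) = (\<Sum>k<n. N x n k)" for n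
    by (simp add: Kn_def N_def sum_distrib_right)
  show ?thesis
  proof (cases lim.decreasing)
    case True
    have "\<forall>\<^sub>F n in sequentially. {..<n} \<subseteq> {..<m n} \<and> (\<forall>k<m n. Lm n k > Lm n n \<longrightarrow> k \<in> {..<n}) \<and> (\<forall>k\<in>{..<n}. Lm n k \<ge> Lm n n)"
      using Lm_strict_mono n_less_m
    proof eventually_elim
      case (elim n)
      have mono: "Lm n l < Lm n k" if "k < l" "l < m n" for k l using elim(1) True that by auto
      have "k < n" if "k < m n" "Lm n k > Lm n n" for k
        using mono[of n k] that by (cases k n rule: linorder_cases) auto
      then show ?case using mono[of _ n] elim(2) by (auto intro!: less_imp_le)
    qed
    from ac.threshold[OF d tau this] show ?thesis unfolding K density_def using True by simp
  next
    case False
    have *: "\<forall>\<^sub>F n in sequentially. {n..<m n} \<subseteq> {..<m n} \<and> (\<forall>k<m n. Lm n k > Lm n n \<longrightarrow> k \<in> {n..<m n}) \<and> (\<forall>k\<in>{n..<m n}. Lm n k \<ge> Lm n n)"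
      using Lm_strict_mono n_less_m
    proof eventually_elim
      case (elim n)
      have mono: "Lm n k < Lm n l" if "k < l" "l < m n" for k l using elim(1) False that by auto
      have "n \<le> k" if "k < m n" "Lm n k > Lm n n" for k
        using mono[of k n] that elim(2) by (cases k n rule: linorder_cases) auto
      moreover have "Lm n n \<le> Lm n k" if "n \<le> k" "k < m n" for k
        using mono[of n k] that by (cases "k = n") auto
      ultimately show ?case by auto
    qed
    have "density x = 1 - arccos (clamp1 ((lim.y 1 - lim.ct x) / (2 * lim.dt x))) / pi"
      unfolding density_def Let_def using False by simp
    with tendsto_diff[OF tendsto_const ac.threshold[OF d tau *], of 1]
    have "(\<lambda>n. 1 - (\<Sum>k\<in>{n..<m n}. N x n k)) \<longlonglongrightarrow> density x" by simp
    moreover have "\<forall>\<^sub>F n in sequentially. 1 - (\<Sum>k\<in>{n..<m n}. N x n k) = (\<Sum>k<n. N x n k)"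
      using N_total[OF x] n_less_m
    proof eventually_elim
      case (elim n)
      have "{..<m n} = {..<n} \<union> {n..<m n}" using elim(2) by auto
      then have "(\<Sum>k<m n. N x n k) = (\<Sum>k<n. N x n k) + (\<Sum>k\<in>{n..<m n}. N x n k)"
        by (simp add: sum.union_disjoint ivl_disj_int)
      then show ?case using elim(1) by simp
    qed
    ultimately show ?thesis unfolding K by (rule Lim_transform_eventually)
  qed
qed

end

section \<open>Exceptional points, the sign of A C, and the explicit density\<close>

context racah_seq
begin

text \<open>If d = 0, one of the eight numerator factors of B D vanishes at X = q^x, and each is
  affine in X with at most one zero.\<close>

lemma finite_zeros: "finite {x. \<not> lim.dt x > 0 \<and> 0 < x \<and> x < L}"
proof -
  define R where "R = {1 / \<alpha>, 1 / (\<beta> * \<delta>), 1 / \<gamma>, 1 / (\<gamma> * \<delta>), 1, 1 / \<delta>, \<beta> / \<gamma>, \<alpha> / (\<gamma> * \<delta>)}"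
  have nz: "\<alpha> \<noteq> 0" "\<beta> \<noteq> 0" using racah.nz[OF racah, of 1] by auto
  have "x \<in> log q ` R" if x: "\<not> lim.dt x > 0" "0 < x" "x < L" for x
  proof -
    define X where "X = q powr x"
    have X2: "X\<^sup>2 = q powr (2 * x)" using q by (simp add: X_def power2_eq_square powr_add[symmetric])
    have v: "1 - \<gamma> * \<delta> * X\<^sup>2 \<noteq> 0" unfolding X2 using x by (intro limit_factor_nonzero) auto
    have "lim.Bt x * lim.Dt x = 0" using Bt_Dt_nonneg[of x] x by (auto simp: lim.dt_def not_less)
    then have "1 - \<alpha> * X = 0 \<or> 1 - \<beta> * \<delta> * X = 0 \<or> 1 - \<gamma> * X = 0 \<or> 1 - \<gamma> * \<delta> * X = 0 \<or>
        1 - X = 0 \<or> 1 - \<delta> * X = 0 \<or> \<beta> - \<gamma> * X = 0 \<or> \<alpha> - \<gamma> * \<delta> * X = 0"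
      unfolding lim.Bt_def lim.Dt_def qB_def qD_def X_def[symmetric] using v by simp
    moreover have r1: "X = 1 / a" if "1 - a * X = 0" for a
      using that by (cases "a = 0") (auto simp: field_simps)
    moreover have "X = \<beta> / \<gamma>" if "\<beta> - \<gamma> * X = 0" using that gam_pos by (simp add: field_simps)
    moreover have "X = \<alpha> / (\<gamma> * \<delta>)" if "\<alpha> - \<gamma> * \<delta> * X = 0"
      using that nz by (cases "\<gamma> * \<delta> = 0") (auto simp: field_simps)
    moreover have "X = 1" if "1 - X = 0" using that by simp
    ultimately have "X \<in> R" unfolding R_def by fast
    moreover have "x = log q X" using q by (simp add: X_def)
    ultimately show ?thesis by blast
  qed
  then have "{x. \<not> lim.dt x > 0 \<and> 0 < x \<and> x < L} \<subseteq> log q ` R" by auto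
  then show ?thesis by (rule finite_subset) (simp add: R_def)
qed

text \<open>The trace of h of the operator, computed in two ways: over the eigenvalues it gives the
  integral of h(y(x)), over the points it gives the integral of the arcsine means.\<close>

lemma spectral_integral_eq_0:
  assumes h: "continuous_on UNIV h" and hb: "\<And>t. \<bar>h t\<bar> \<le> H"
    and zero: "\<And>x. 0 < x \<Longrightarrow> x < L \<Longrightarrow> arc_mean (lim.ct x) (lim.dt x) h = 0"
  shows "(LBINT x:{0..L}. h (lim.y x)) = 0"
proof -
  define Z where "Z = {x. \<not> lim.dt x > 0 \<and> 0 < x \<and> x < L}"
  have Z: "finite Z" unfolding Z_def by (rule finite_zeros)
  have 1: "(\<lambda>n. 1 / real n * (\<Sum>k<m n. h (Lm n k))) \<longlonglongrightarrow> (LBINT x:{0..L}. h (lim.y x))"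
  proof (rule riemann_sum_limit(2)[OF m_lim finite.emptyI, where C = H])
    fix x assume x: "0 < x" "x < L"
    show "(\<lambda>n. h (Lm n (nat \<lfloor>x * real n\<rfloor>))) \<longlonglongrightarrow> h (lim.y x)"
      using h by (intro isCont_tendsto_compose[OF _ Lm_lim[OF floor_lim[OF x(1)]]])
        (simp add: continuous_on_eq_continuous_at)
  qed (use hb in auto)
  define G where "G n v = (\<Sum>k<m n. h (Lm n k) * ((e n k v)\<^sup>2 * w n v))" for n v
  have "(\<lambda>n. 1 / real n * (\<Sum>v<m n. G n v)) \<longlonglongrightarrow> (LBINT x:{0..L}. 0)"
  proof (rule riemann_sum_limit(2)[OF m_lim Z, where C = H])
    fix x assume x: "0 < x" "x < L" "x \<notin> Z"
    then have d: "lim.dt x > 0" by (auto simp: Z_def)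
    obtain R where "arc_convergence m (N x) Lm R (lim.ct x) (lim.dt x)" using N_arc_convergence[OF x(1,2) d] by blast
    from arc_convergence.continuous_mean[OF this h]
    show "(\<lambda>n. G n (nat \<lfloor>x * real n\<rfloor>)) \<longlonglongrightarrow> 0" using zero[OF x(1,2)] by (simp add: G_def N_def mult_ac)
  next
    show "\<forall>\<^sub>F n in sequentially. \<forall>v<m n. \<bar>G n v\<bar> \<le> H"
      using eventually_ge_at_top[of 1]
    proof eventually_elim
      case (elim n)
      show ?case
      proof (intro allI impI)
        fix v assume v: "v < m n"
        have w0: "w n v \<ge> 0" using w_pos[OF elim v] by simp
        have "\<bar>G n v\<bar> \<le> (\<Sum>k<m n. H * ((e n k v)\<^sup>2 * w n v))"
          unfolding G_def using hb w0
          by (intro order.trans[OF sum_abs] sum_mono) (auto simp: abs_mult intro!: mult_right_mono)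
        also have "\<dots> = H" using complete[OF elim v v] by (simp add: sum_distrib_left[symmetric] power2_eq_square)
        finally show "\<bar>G n v\<bar> \<le> H" .
      qed
    qed
  qed
  moreover have "\<forall>\<^sub>F n in sequentially. 1 / real n * (\<Sum>v<m n. G n v) = 1 / real n * (\<Sum>k<m n. h (Lm n k))"
    using eventually_ge_at_top[of 1]
  proof eventually_elim
    case (elim n)
    have "(\<Sum>v<m n. G n v) = (\<Sum>k<m n. h (Lm n k) * (\<Sum>v<m n. (e n k v)\<^sup>2 * w n v))"
      unfolding G_def sum_distrib_left by (rule sum.swap)
    then show ?case by (simp add: normalized[OF elim])
  qed
  ultimately have "(\<lambda>n. 1 / real n * (\<Sum>k<m n. h (Lm n k))) \<longlonglongrightarrow> (LBINT x:{0..L}. 0)"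
    by (rule Lim_transform_eventually)
  from LIMSEQ_unique[OF 1 this] show ?thesis by (simp add: set_lebesgue_integral_def)
qed

lemma isCont_AC: "\<xi> \<le> L \<Longrightarrow> isCont lim.AC \<xi>"
  unfolding coefA_def coefC_def using q lim.yy_factor_nonzero[of "2 * \<xi>"]
  by (intro continuous_intros) auto

text \<open>Needed because \<open>sqrt\<close> of a negative number is negative here, so that \<open>(rec_a \<xi>)\<^sup>2\<close> is \<open>\<bar>AC\<bar>\<close>. Where
  \<open>AC < 0\<close>, the spectrum would have a gap around \<open>y \<xi>\<close>, but the eigenvalues are distributed like \<open>y\<close>.\<close>

lemma AC_nonneg:
  assumes \<xi>: "\<xi> \<in> {0..L}"
  shows "lim.AC \<xi> \<ge> 0"
proof (rule ccontr)
  assume neg: "\<not> lim.AC \<xi> \<ge> 0"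
  then have "\<xi> \<noteq> 0" "\<xi> \<noteq> L" using lim.coefC_0 lim.coefA_L by auto
  then have x0: "0 < \<xi>" "\<xi> < L" using \<xi> by auto
  have "\<forall>\<^sub>F t in at \<xi>. lim.AC t < 0"
    using isCont_AC[of \<xi>] \<xi> neg by (intro order_tendstoD(2)[of _ "lim.AC \<xi>"]) (auto simp: isCont_def)
  then obtain \<epsilon>' where \<epsilon>': "\<epsilon>' > 0" "\<And>t. t \<noteq> \<xi> \<Longrightarrow> \<bar>t - \<xi>\<bar> < \<epsilon>' \<Longrightarrow> lim.AC t < 0"
    by (auto simp: eventually_at dist_real_def)
  define \<epsilon> where "\<epsilon> = Min {\<epsilon>' / 2, \<xi> / 2, (L - \<xi>) / 2}"
  have \<epsilon>: "\<epsilon> > 0" "\<epsilon> < \<epsilon>'" "\<epsilon> < \<xi>" "\<epsilon> < L - \<xi>" using \<epsilon>'(1) x0 by (auto simp: \<epsilon>_def min_less_iff_disj)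
  have ACneg: "lim.AC t < 0" if "\<bar>t - \<xi>\<bar> \<le> \<epsilon>" for t
    using \<epsilon>'(2)[of t] that \<epsilon> neg by (cases "t = \<xi>") auto
  define lo where "lo = min (lim.y (\<xi> - \<epsilon>)) (lim.y (\<xi> + \<epsilon>))"
  define hi where "hi = max (lim.y (\<xi> - \<epsilon>)) (lim.y (\<xi> + \<epsilon>))"
  have mid: "lo < lim.y \<xi>" "lim.y \<xi> < hi"
    using lim.yy_less[of "\<xi> - \<epsilon>" \<xi>] lim.yy_less[of \<xi> "\<xi> + \<epsilon>"] \<epsilon> x0
    unfolding lo_def hi_def by (auto split: if_splits)
  \<comment> \<open>A tent over the values of y near \<xi>, which are to be shown to miss the
    support of every arcsine law.\<close>
  define h where "h t = max 0 (min (t - lo) (hi - t))" for t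
  have hc: "continuous_on UNIV h" unfolding h_def by (intro continuous_intros)
  have h0: "h t \<ge> 0" for t by (simp add: h_def)
  have "arc_mean (lim.ct x) (lim.dt x) h = 0" if x: "0 < x" "x < L" for x
  proof -
    have "h (lim.ct x + 2 * lim.dt x * cos \<theta>) = 0" for \<theta>
    proof (rule ccontr)
      let ?u = "lim.ct x + 2 * lim.dt x * cos \<theta>"
      assume "h ?u \<noteq> 0"
      then have u: "lo < ?u" "?u < hi" unfolding h_def by linarith+
      have "connected (lim.y ` {\<xi> - \<epsilon>..\<xi> + \<epsilon>})" by (intro connected_continuous_image lim.continuous_yy) auto
      moreover have "lo \<in> lim.y ` {\<xi> - \<epsilon>..\<xi> + \<epsilon>}" "hi \<in> lim.y ` {\<xi> - \<epsilon>..\<xi> + \<epsilon>}"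
        using \<epsilon>(1) by (auto simp: lo_def hi_def min_def max_def)
      ultimately have "?u \<in> lim.y ` {\<xi> - \<epsilon>..\<xi> + \<epsilon>}"
        using u less_imp_le unfolding connected_iff_interval by meson
      then obtain t where t: "t \<in> {\<xi> - \<epsilon>..\<xi> + \<epsilon>}" "lim.y t = ?u" by auto
      have tL: "t \<le> L" using t \<epsilon> by auto
      obtain K where K: "K > 0" "(lim.y t)\<^sup>2 - 4 * \<alpha> * \<beta> > 0"
        "lim.Fc x t = (4 * (lim.Bt x * lim.Dt x) - (lim.y t - lim.ct x)\<^sup>2) * (K / ((lim.y t)\<^sup>2 - 4 * \<alpha> * \<beta>))"
        using lim.Fc_dual[OF limit_factor_nonzero[OF x]] tL by auto
      have "lim.Bt x * lim.Dt x = (lim.dt x)\<^sup>2" using Bt_Dt_nonneg[OF x] by (simp add: lim.dt_def)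
      then have "4 * (lim.Bt x * lim.Dt x) - (lim.y t - lim.ct x)\<^sup>2 = 4 * (lim.dt x)\<^sup>2 * (1 - (cos \<theta>)\<^sup>2)"
        unfolding t(2) by (simp add: power2_eq_square algebra_simps)
      also have "\<dots> \<ge> 0" by (simp add: abs_square_le_1)
      \<comment> \<open>A point of the arcsine support has a nonnegative dual discriminant, hence
        \<open>Fc\<close> \<ge> 0. But \<open>Fc\<close> is at most 4 A C, which is negative at
        t.\<close>
      finally have "lim.Fc x t \<ge> 0" unfolding K(3) using K(1,2) by simp
      moreover have "lim.AC t < 0" using t by (intro ACneg) auto
      ultimately show False unfolding lim.Fc_def using zero_le_power2[of "mu q \<gamma> \<delta> x - rec_b q \<alpha> \<beta> \<gamma> \<delta> t"] by linarith
    qed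
    then show ?thesis by (simp add: arc_mean_def)
  qed
  moreover have "\<bar>h t\<bar> \<le> hi - lo" for t
    using mid by (auto simp: h_def)
  ultimately have "(LBINT x:{0..L}. h (lim.y x)) = 0" by (intro spectral_integral_eq_0 hc)
  moreover have hy: "continuous_on {0..L} (\<lambda>x. h (lim.y x))"
    by (intro continuous_on_compose2[OF hc lim.continuous_yy]) auto
  then have "set_integrable lborel {0..L} (\<lambda>x. h (lim.y x))"
    by (rule borel_integrable_atLeastAtMost')
  then have "(LBINT x:{0..L}. h (lim.y x)) = integral {0..L} (\<lambda>x. h (lim.y x))"
    by (rule set_borel_integral_eq_integral)
  ultimately have "integral {0..L} (\<lambda>x. h (lim.y x)) = 0" by simp
  then have "h (lim.y \<xi>) = 0"
    using integral_eq_0_iff[OF hy] h0 L \<xi> by auto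
  then show False using mid by (simp add: h_def)
qed

text \<open>Both facts extend from the open interval by continuity; at an end point the denominators
  of the coefficients are nonzero only by the hypothesis on x.\<close>

lemma coefficients_on_closed_interval:
  assumes x: "x \<in> {0..L}" and v: "1 - \<gamma> * \<delta> * q powr (2 * x) \<noteq> 0"
  shows "lim.Bt x * lim.Dt x \<ge> 0"
    and "min (lim.y 0) (lim.y L) \<le> lim.ct x \<and> lim.ct x \<le> max (lim.y 0) (lim.y L)"
proof -
  have X2: "(q powr x)\<^sup>2 = q powr (2 * x)" using q by (simp add: power2_eq_square powr_add[symmetric])
  have cB: "isCont lim.Bt x" and cD: "isCont lim.Dt x"
    unfolding lim.Bt_def[abs_def] lim.Dt_def[abs_def] qB_def qD_def
    using q v X2 by (auto intro!: continuous_intros)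
  have cc: "isCont lim.ct x"
    unfolding lim.ct_def[abs_def] qc_def lim.Bt_def[symmetric] lim.Dt_def[symmetric]
    by (intro continuous_intros cB cD)
  have nb: "at x within {0<..<L} \<noteq> bot"
  proof -
    consider "x = 0" | "x = L" | "x \<in> interior {0<..<L}" using x by fastforce
    then have "x islimpt {0<..<L}"
      by cases (use L in \<open>auto intro: islimpt_greaterThanLessThan1 islimpt_greaterThanLessThan2 interior_limit_point\<close>)
    then show ?thesis by (simp add: trivial_limit_within)
  qed
  have ev: "\<forall>\<^sub>F t in at x within {0<..<L}. t \<in> {0<..<L}" by (simp add: eventually_at_filter)
  have lB: "((\<lambda>t. lim.Bt t * lim.Dt t) \<longlongrightarrow> lim.Bt x * lim.Dt x) (at x within {0<..<L})"
    using cB cD by (intro tendsto_mult) (auto simp: isCont_def intro: tendsto_within_subset)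
  have lc: "(lim.ct \<longlongrightarrow> lim.ct x) (at x within {0<..<L})"
    using cc by (auto simp: isCont_def intro: tendsto_within_subset)
  show "lim.Bt x * lim.Dt x \<ge> 0"
    by (rule tendsto_lowerbound[OF lB _ nb], rule eventually_mono[OF ev]) (auto intro: Bt_Dt_nonneg)
  have "min (lim.y 0) (lim.y L) \<le> lim.ct x"
    by (rule tendsto_lowerbound[OF lc _ nb], rule eventually_mono[OF ev]) (use ct_hull in auto)
  moreover have "lim.ct x \<le> max (lim.y 0) (lim.y L)"
    by (rule tendsto_upperbound[OF lc _ nb], rule eventually_mono[OF ev]) (use ct_hull in auto)
  ultimately show "min (lim.y 0) (lim.y L) \<le> lim.ct x \<and> lim.ct x \<le> max (lim.y 0) (lim.y L)" ..
qed

lemma roots_exist: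
  assumes x: "x \<in> {0..L}" and v: "1 - \<gamma> * \<delta> * q powr (2 * x) \<noteq> 0"
  shows "\<exists>u v. lim.roots_ok x u v"
  using coefficients_on_closed_interval[OF x v] AC_nonneg
  by (intro lim.roots_exist v) (auto simp: min_def max_def split: if_splits)

text \<open>The sign \<sigma> makes \<sigma> y decreasing in both cases, and arccos(-t) = pi -
  arccos(t) absorbs the complement. The three cases of the density then say whether \<open>z\<close>
  is clamped at -1, unclamped, or clamped at 1.\<close>

lemma density_eq_rho_of:
  assumes ok: "lim.roots_ok x u v" and d: "lim.dt x > 0"
  shows "density x = rho_of q \<alpha> \<beta> u v"
proof -
  define \<sigma> :: real where "\<sigma> = (if lim.decreasing then 1 else - 1)"
  define z where "z = \<sigma> * ((lim.y 1 - lim.ct x) / (2 * lim.dt x))"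
  have uv: "0 \<le> u" "u \<le> v" "v \<le> L" and yuv: "{lim.y u, lim.y v} = {lim.ct x - 2 * lim.dt x, lim.ct x + 2 * lim.dt x}"
    using ok by (auto simp: lim.roots_ok_def)
  have ne: "lim.y u \<noteq> lim.y v" using yuv d by (auto simp: doubleton_eq_iff)
  then have lt: "u < v" using uv by (cases "u = v") auto
  have \<sigma>: "\<sigma> = 1 \<or> \<sigma> = - 1" "\<sigma> * \<sigma> = 1" by (auto simp: \<sigma>_def)
  have le: "\<sigma> * lim.y a \<le> \<sigma> * lim.y b \<longleftrightarrow> b \<le> a" if "a \<le> L" "b \<le> L" for a b
    using lim.yy_le_iff[of a b] lim.yy_le_iff[of b a] that by (simp add: \<sigma>_def)
  have y: "\<sigma> * lim.y u = \<sigma> * lim.ct x + 2 * lim.dt x" "\<sigma> * lim.y v = \<sigma> * lim.ct x - 2 * lim.dt x"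
    using lim.yy_less[OF lt uv(3)] yuv d by (auto simp: doubleton_eq_iff \<sigma>_def split: if_splits)
  have z: "2 * lim.dt x * z = \<sigma> * lim.y 1 - \<sigma> * lim.ct x"
  proof -
    have "2 * lim.dt x * (\<sigma> * (t / (2 * lim.dt x))) = \<sigma> * t" for t using d by simp
    then show ?thesis unfolding z_def by (simp only: right_diff_distrib)
  qed
  have D: "density x = arccos (clamp1 z) / pi"
  proof (cases lim.decreasing)
    case False
    have "clamp1 (- t) = - clamp1 t" for t by (simp add: clamp1_def max_def min_def)
    then have "arccos (clamp1 (- t)) = pi - arccos (clamp1 t)" for t
      using clamp1_bounds[of t] by (simp only: arccos_minus)
    moreover have "z = - ((lim.y 1 - lim.ct x) / (2 * lim.dt x))" unfolding z_def \<sigma>_def using False by (simp only: if_False mult_minus1)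
    ultimately show ?thesis using False by (simp only: density_def Let_def if_False diff_divide_distrib) simp
  qed (simp add: density_def z_def \<sigma>_def)
  have L1: "1 \<le> L" "u \<le> L" using L uv by auto
  have scale: "z \<le> c" if "\<sigma> * lim.y 1 - \<sigma> * lim.ct x \<le> 2 * lim.dt x * c" for c
    using that d unfolding z[symmetric] by simp
  have scale': "c \<le> z" if "2 * lim.dt x * c \<le> \<sigma> * lim.y 1 - \<sigma> * lim.ct x" for c
    using that d unfolding z[symmetric] by simp
  consider "v \<le> 1" | "u < 1" "1 < v" | "1 \<le> u" by linarith
  then show ?thesis
  proof cases
    case 1
    then have "z \<le> - 1" using le[of 1 v] L1 uv y by (intro scale) simp
    then have "clamp1 z = - 1" by (simp add: clamp1_def)
    then show ?thesis using 1 lt by (simp add: D rho_of_def)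
  next
    case 2
    have "- 1 \<le> z" using le[of v 1] L1 uv y 2 by (intro scale') simp
    moreover have "z \<le> 1" using le[of 1 u] L1 y 2 by (intro scale) simp
    ultimately have "clamp1 z = z" by (simp add: clamp1_def)
    moreover have "(2 * lim.y 1 - lim.y u - lim.y v) / (lim.y u - lim.y v) = z"
    proof -
      have "\<sigma> * (2 * lim.y 1 - lim.y u - lim.y v) = z * (\<sigma> * (lim.y u - lim.y v))"
      proof -
        have "\<sigma> * (2 * lim.y 1 - lim.y u - lim.y v) = 2 * (\<sigma> * lim.y 1 - \<sigma> * lim.ct x)"
          "\<sigma> * (lim.y u - lim.y v) = 4 * lim.dt x"
          using y by (simp_all add: right_diff_distrib)
        moreover have "z * (4 * lim.dt x) = 2 * (2 * lim.dt x * z)" by simp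
        ultimately show ?thesis unfolding z by (simp only:)
      qed
      then have "2 * lim.y 1 - lim.y u - lim.y v = z * (lim.y u - lim.y v)" using \<sigma>(1) by auto
      then show ?thesis using ne by simp
    qed
    ultimately show ?thesis using 2 by (simp add: D rho_of_def)
  next
    case 3
    then have "1 \<le> z" using le[of u 1] L1 y by (intro scale') simp
    then have "clamp1 z = 1" by (simp add: clamp1_def)
    then show ?thesis using 3 lt by (simp add: D rho_of_def)
  qed
qed

end

section \<open>The law of large numbers\<close>

context racah_seq
begin

abbreviation "nu n \<equiv> node q \<delta> M n"
abbreviation "\<mu> \<equiv> mu q \<gamma> \<delta>"

lemma isCont_mu: "isCont \<mu> x"
  unfolding mu_def[abs_def] using q by (intro continuous_intros) auto

lemma continuous_mu: "continuous_on A \<mu>"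
  using isCont_mu by (simp add: continuous_at_imp_continuous_on)

text \<open>The difference of two values contains the limiting node factor at the midpoint, which is
  interior even if s or t is an end point.\<close>

lemma inj_mu: "inj_on \<mu> {0..L}"
proof (rule linorder_inj_onI')
  fix s t assume st: "s \<in> {0..L}" "t \<in> {0..L}" "s < t"
  have "\<mu> s - \<mu> t = (q powr (- s) - q powr (- t)) * (1 - \<gamma> * \<delta> * q powr (s + t))"
    using q by (simp add: mu_def powr_add powr_minus field_simps)
  moreover have "1 - \<gamma> * \<delta> * q powr (s + t) \<noteq> 0"
  proof -
    have "1 - \<gamma> * \<delta> * q powr (2 * ((s + t) / 2)) \<noteq> 0" using st by (intro limit_factor_nonzero) auto
    moreover have "2 * ((s + t) / 2) = s + t" by simp
    ultimately show ?thesis by metis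
  qed
  moreover have "q powr (- s) \<noteq> q powr (- t)" using st q by (simp add: powr_inj)
  ultimately show "\<mu> s \<noteq> \<mu> t" by auto
qed

lemma ev_M_bound: "L < L' \<Longrightarrow> \<forall>\<^sub>F n in sequentially. \<forall>v\<le>M n. real v / real n < L'"
  using order_tendstoD(2)[OF M_lim, of L']
proof (rule eventually_mono)
  fix n assume n: "(real (M n) + 1) / real n < L'"
  have "real v / real n \<le> (real (M n) + 1) / real n" if "v \<le> M n" for v
    using that by (intro divide_right_mono) auto
  then show "\<forall>v\<le>M n. real v / real n < L'" using n by fastforce
qed

lemma node_close:
  assumes "\<epsilon> > 0"
  shows "\<forall>\<^sub>F n in sequentially. \<forall>v\<le>M n. \<bar>nu n v - \<mu> (real v / real n)\<bar> < \<epsilon>"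
proof -
  define Q where "Q = 1 + q powr (L + 1)"
  have Q: "q powr s \<le> Q" if "0 \<le> s" "s \<le> L + 1" for s
  proof (cases "q > 1")
    case True
    then have "q powr s \<le> q powr (L + 1)" using that by (intro powr_mono) auto
    then show ?thesis by (simp add: Q_def)
  next
    case False
    then have "q powr s \<le> q powr 0" using that q by (intro powr_mono') auto
    then have "q powr s \<le> 1" using q by simp
    then show ?thesis unfolding Q_def using powr_ge_zero[of q "L + 1"] by linarith
  qed
  have "(\<lambda>n. \<bar>\<delta> * (g n * p n - \<gamma>)\<bar> * Q) \<longlonglongrightarrow> \<bar>\<delta> * (\<gamma> * 1 - \<gamma>)\<bar> * Q"
    by (intro tendsto_intros gam_lim p_lim)
  then have "\<forall>\<^sub>F n in sequentially. \<bar>\<delta> * (g n * p n - \<gamma>)\<bar> * Q < \<epsilon>"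
    using assms by (intro order_tendstoD(2)) auto
  then show ?thesis using ev_M_bound[OF less_add_one] eventually_ge_at_top[of 1]
  proof eventually_elim
    case (elim n)
    show ?case
    proof (intro allI impI)
      fix v assume "v \<le> M n"
      then have v: "real v / real n < L + 1" using elim(2) by simp
      have "nu n v - \<mu> (real v / real n) = \<delta> * (g n * p n - \<gamma>) * q powr (real v / real n)"
        unfolding node_def mu_def power_add power_one_right p_pow[OF elim(3)]
        by (simp add: powr_minus algebra_simps)
      then have "\<bar>nu n v - \<mu> (real v / real n)\<bar> \<le> \<bar>\<delta> * (g n * p n - \<gamma>)\<bar> * Q"
        using Q[of "real v / real n"] v by (simp add: abs_mult mult_left_mono)
      then show "\<bar>nu n v - \<mu> (real v / real n)\<bar> < \<epsilon>" using elim(1) by simp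
    qed
  qed
qed

lemma mu_bounded: obtains R where "\<And>x. 0 \<le> x \<Longrightarrow> x \<le> L + 1 \<Longrightarrow> \<bar>\<mu> x\<bar> \<le> R"
proof -
  have "compact (\<mu> ` {0..L + 1})" by (intro compact_continuous_image continuous_mu) auto
  from compact_imp_bounded[OF this] obtain R where "\<forall>y\<in>\<mu> ` {0..L + 1}. norm y \<le> R"
    unfolding bounded_iff by blast
  then have "\<bar>\<mu> x\<bar> \<le> R" if "0 \<le> x" "x \<le> L + 1" for x using that by simp
  then show ?thesis using that by blast
qed

lemma node_bounded: "\<exists>R. \<forall>\<^sub>F n in sequentially. \<forall>v\<le>M n. \<bar>nu n v\<bar> \<le> R"
proof -
  obtain R where R: "\<And>x. 0 \<le> x \<Longrightarrow> x \<le> L + 1 \<Longrightarrow> \<bar>\<mu> x\<bar> \<le> R" using mu_bounded by blast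
  have one: "(1::real) > 0" by simp
  have "\<forall>\<^sub>F n in sequentially. \<forall>v\<le>M n. \<bar>nu n v\<bar> \<le> R + 1"
    using node_close[OF one] ev_M_bound[OF less_add_one]
  proof eventually_elim
    case (elim n)
    show ?case
    proof (intro allI impI)
      fix v assume v: "v \<le> M n"
      then have "\<bar>\<mu> (real v / real n)\<bar> \<le> R" using elim(2) by (intro R) (auto intro: less_imp_le)
      moreover have "\<bar>nu n v - \<mu> (real v / real n)\<bar> < 1" using elim(1) v by blast
      ultimately show "\<bar>nu n v\<bar> \<le> R + 1" by linarith
    qed
  qed
  then show ?thesis by blast
qed

text \<open>On [0, L] the function f is continuous in \<mu>(x), which Weierstrass turns into a
  polynomial. One third of \<epsilon> pays for this, one for replacing \<mu> by the nodes, one for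
  particles beyond L.\<close>

lemma uniform_approximation:
  assumes f: "continuous_on UNIV f" and \<epsilon>: "\<epsilon> > 0"
  shows "\<exists>a K. \<forall>\<^sub>F n in sequentially. \<forall>v\<le>M n. \<bar>f (real v / real n) - (\<Sum>i\<le>K. a i * nu n v ^ i)\<bar> < \<epsilon>"
proof -
  let ?I = "\<mu> ` {0..L}"
  have "continuous_on ?I (inv_into {0..L} \<mu>)"
    by (rule continuous_on_inv[OF continuous_mu]) (auto simp: inv_into_f_f[OF inj_mu])
  then have "continuous_on ?I (\<lambda>s. f (inv_into {0..L} \<mu> s))"
    by (intro continuous_on_compose2[OF f]) auto
  moreover have "compact ?I" by (intro compact_continuous_image continuous_mu) auto
  ultimately obtain G where G: "real_polynomial_function G" "\<And>s. s \<in> ?I \<Longrightarrow> \<bar>f (inv_into {0..L} \<mu> s) - G s\<bar> < \<epsilon> / 3"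
    using Stone_Weierstrass_real_polynomial_function[of ?I _ "\<epsilon> / 3"] \<epsilon> by auto
  obtain a K where aK: "G = (\<lambda>x. \<Sum>i\<le>K. a i * x ^ i)"
    using G(1) by (auto simp: real_polynomial_function_iff_sum)
  have Gc: "continuous_on A G" for A unfolding aK by (intro continuous_intros)
  \<comment> \<open>Rescaled particles may exceed L slightly, where the approximation says nothing;
    uniform continuity of this error compares x with \<open>min x L\<close>.\<close>
  define \<phi> where "\<phi> x = f x - G (\<mu> x)" for x
  have \<phi>: "\<bar>\<phi> x\<bar> < \<epsilon> / 3" if "x \<in> {0..L}" for x
    using G(2)[of "\<mu> x"] that by (simp add: \<phi>_def inv_into_f_f[OF inj_mu])
  have "continuous_on {0..L + 1} \<phi>"
    unfolding \<phi>_def by (intro continuous_intros continuous_on_compose2[OF Gc continuous_mu] continuous_on_subset[OF f]) auto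
  then have "uniformly_continuous_on {0..L + 1} \<phi>" by (intro compact_uniformly_continuous) auto
  then obtain \<eta> where \<eta>: "\<eta> > 0" "\<And>x x'. x \<in> {0..L + 1} \<Longrightarrow> x' \<in> {0..L + 1} \<Longrightarrow> \<bar>x' - x\<bar> < \<eta> \<Longrightarrow> \<bar>\<phi> x' - \<phi> x\<bar> < \<epsilon> / 3"
    using \<epsilon> unfolding uniformly_continuous_on_def dist_real_def by (metis divide_pos_pos zero_less_numeral)
  obtain R where R: "\<And>x. 0 \<le> x \<Longrightarrow> x \<le> L + 1 \<Longrightarrow> \<bar>\<mu> x\<bar> \<le> R" using mu_bounded by blast
  have "uniformly_continuous_on {- R - 1..R + 1} G" using Gc by (intro compact_uniformly_continuous) auto
  then obtain \<eta>' where \<eta>': "\<eta>' > 0" "\<And>x x'. x \<in> {- R - 1..R + 1} \<Longrightarrow> x' \<in> {- R - 1..R + 1} \<Longrightarrow> \<bar>x' - x\<bar> < \<eta>' \<Longrightarrow> \<bar>G x' - G x\<bar> < \<epsilon> / 3"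
    using \<epsilon> unfolding uniformly_continuous_on_def dist_real_def by (metis divide_pos_pos zero_less_numeral)
  have min: "min 1 \<eta>' > 0" and minL: "L < L + min 1 \<eta>" using \<eta>(1) \<eta>'(1) by auto
  have "\<forall>\<^sub>F n in sequentially. \<forall>v\<le>M n. \<bar>f (real v / real n) - (\<Sum>i\<le>K. a i * nu n v ^ i)\<bar> < \<epsilon>"
    using node_close[OF min] ev_M_bound[OF minL]
  proof eventually_elim
    case (elim n)
    show ?case
    proof (intro allI impI)
      fix v assume v: "v \<le> M n"
      define x where "x = real v / real n"
      have x: "0 \<le> x" "x < L + min 1 \<eta>" using elim(2) v by (auto simp: x_def)
      have mx: "\<bar>\<mu> x\<bar> \<le> R" using x by (intro R) auto
      have nx: "\<bar>nu n v - \<mu> x\<bar> < min 1 \<eta>'" using elim(1) v by (auto simp: x_def)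
      have "\<bar>G (nu n v) - G (\<mu> x)\<bar> < \<epsilon> / 3" using mx nx by (intro \<eta>'(2)) auto
      moreover have "\<bar>\<phi> x - \<phi> (min x L)\<bar> < \<epsilon> / 3" using x L \<eta>(1) by (intro \<eta>(2)) auto
      moreover have "\<bar>\<phi> (min x L)\<bar> < \<epsilon> / 3" using x L by (intro \<phi>) auto
      ultimately have "\<bar>f x - G (nu n v)\<bar> < \<epsilon>" unfolding \<phi>_def[of x] by linarith
      then show "\<bar>f (real v / real n) - (\<Sum>i\<le>K. a i * nu n v ^ i)\<bar> < \<epsilon>" by (simp add: x_def aK)
    qed
  qed
  then show ?thesis by blast
qed

lemma Kn_nonneg: "n \<ge> 1 \<Longrightarrow> v < m n \<Longrightarrow> Kn n v \<ge> 0"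
  unfolding Kn_def by (intro mult_nonneg_nonneg sum_nonneg less_imp_le[OF w_pos]) auto

lemma Kn_le_1:
  assumes "n \<ge> 1" "n \<le> m n" "v < m n"
  shows "Kn n v \<le> 1"
proof -
  have "(\<Sum>k<n. (e n k v)\<^sup>2) \<le> (\<Sum>k<m n. (e n k v)\<^sup>2)" using assms by (intro sum_mono2) auto
  then have "Kn n v \<le> (\<Sum>k<m n. (e n k v)\<^sup>2) * w n v"
    unfolding Kn_def using w_pos[OF assms(1,3)] by (intro mult_right_mono) auto
  also have "\<dots> = 1" using complete[OF assms(1,3,3)] by (simp add: sum_distrib_right power2_eq_square)
  finally show ?thesis .
qed

lemma Kn_total:
  assumes "n \<ge> 1" "n \<le> m n"
  shows "(\<Sum>v<m n. Kn n v) = real n"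
proof -
  have "(\<Sum>v<m n. Kn n v) = (\<Sum>k<n. \<Sum>v<m n. (e n k v)\<^sup>2 * w n v)"
    unfolding Kn_def sum_distrib_right by (rule sum.swap)
  also have "\<dots> = (\<Sum>k<n. 1)" using assms by (intro sum.cong) (auto simp: normalized)
  finally show ?thesis by simp
qed

text \<open>Agreement with \<open>density\<close> off the finite set where d vanishes determines all
  integrals.\<close>

lemma density_riemann:
  assumes f: "continuous_on UNIV f" and \<rho>: "\<And>x. 0 < x \<Longrightarrow> x < L \<Longrightarrow> lim.dt x > 0 \<Longrightarrow> \<rho> x = density x"
  shows "set_integrable lborel {0..L} (\<lambda>x. f x * \<rho> x)"
    and "(\<lambda>n. 1 / real n * (\<Sum>v<m n. f (real v / real n) * Kn n v)) \<longlonglongrightarrow> (LBINT x:{0..L}. f x * \<rho> x)"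
proof -
  define Z where "Z = {x. \<not> lim.dt x > 0 \<and> 0 < x \<and> x < L}"
  have Z: "finite Z" unfolding Z_def by (rule finite_zeros)
  have "compact (f ` {0..L + 1})" by (intro compact_continuous_image continuous_on_subset[OF f]) auto
  from compact_imp_bounded[OF this] obtain R where "\<forall>y\<in>f ` {0..L + 1}. norm y \<le> R"
    unfolding bounded_iff by blast
  then have R: "\<bar>f x\<bar> \<le> R" if "0 \<le> x" "x \<le> L + 1" for x using that by simp
  have conv: "(\<lambda>n. f (real (nat \<lfloor>x * real n\<rfloor>) / real n) * Kn n (nat \<lfloor>x * real n\<rfloor>)) \<longlonglongrightarrow> f x * \<rho> x"
    if x: "0 < x" "x < L" "x \<notin> Z" for x
  proof -
    have d: "lim.dt x > 0" using x by (auto simp: Z_def)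
    have "isCont f x" using f by (simp add: continuous_on_eq_continuous_at)
    then show ?thesis unfolding \<rho>[OF x(1,2) d]
      by (intro tendsto_mult isCont_tendsto_compose[OF _ floor_lim] Kn_limit x d)
  qed
  have bound: "\<forall>\<^sub>F n in sequentially. \<forall>v<m n. \<bar>f (real v / real n) * Kn n v\<bar> \<le> R"
    using ev_M_bound[OF less_add_one] n_less_m eventually_ge_at_top[of 1]
  proof eventually_elim
    case (elim n)
    show ?case
    proof (intro allI impI)
      fix v assume v: "v < m n"
      then have "real v / real n < L + 1" using elim m_le[of n] by simp
      then have "\<bar>f (real v / real n)\<bar> \<le> R" by (intro R) auto
      moreover have "0 \<le> Kn n v" "Kn n v \<le> 1" using Kn_nonneg[of n v] Kn_le_1[of n v] v elim by auto
      ultimately have "\<bar>f (real v / real n)\<bar> * \<bar>Kn n v\<bar> \<le> R * 1" by (intro mult_mono) auto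
      then show "\<bar>f (real v / real n) * Kn n v\<bar> \<le> R" by (simp add: abs_mult)
    qed
  qed
  from riemann_sum_limit[OF m_lim Z conv bound]
  show "set_integrable lborel {0..L} (\<lambda>x. f x * \<rho> x)"
    "(\<lambda>n. 1 / real n * (\<Sum>v<m n. f (real v / real n) * Kn n v)) \<longlonglongrightarrow> (LBINT x:{0..L}. f x * \<rho> x)" by auto
qed

lemma power_sum_concentration:
  assumes Y: "\<And>n. n \<ge> 1 \<Longrightarrow> Y n \<in> measurable P (ensemble q \<alpha> \<beta> \<delta> M n)"
    and law: "\<And>n. n \<ge> 1 \<Longrightarrow> distr P (ensemble q \<alpha> \<beta> \<delta> M n) (Y n) = ensemble q \<alpha> \<beta> \<delta> M n"
  shows "AE \<omega> in P. (\<lambda>n. 1 / real n * ((\<Sum>j=1..n. nu n (Y n \<omega> j) ^ r) - (\<Sum>v<m n. nu n v ^ r * Kn n v))) \<longlonglongrightarrow> 0"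
proof -
  obtain R where "\<forall>\<^sub>F n in sequentially. \<forall>v\<le>M n. \<bar>nu n v\<bar> \<le> R" using node_bounded by blast
  then have "\<forall>\<^sub>F n in sequentially. n \<ge> 1 \<and> n < m n \<and> (\<forall>v\<le>M n. \<bar>nu n v\<bar> \<le> R)"
    using n_less_m eventually_ge_at_top[of 1] by eventually_elim auto
  then obtain n0 where n0: "\<And>n. n \<ge> n0 \<Longrightarrow> n \<ge> 1 \<and> n < m n \<and> (\<forall>v\<le>M n. \<bar>nu n v\<bar> \<le> R)"
    by (auto simp: eventually_sequentially)
  define S where "S n y = (\<Sum>j=1..n. nu n (y j) ^ r) - (\<Sum>v<m n. nu n v ^ r * Kn n v)" for n and y :: "nat \<Rightarrow> nat"
  have "AE \<omega> in P. (\<lambda>n. 1 / real n * S n (Y n \<omega>)) \<longlonglongrightarrow> 0"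
  proof (rule AE_tendsto_0_of_second_moments[where C = "real r * (R ^ r)\<^sup>2" and ?n0.0 = n0])
    fix n assume n: "n \<ge> n0"
    note nn = n0[OF n]
    have rb: "racah_basis q \<alpha> \<beta> \<delta> M n (E n) (e n)" using nn by (intro basis) auto
    have ns: "n \<le> card (racah.S q \<alpha> \<beta> \<delta> M n)" using nn m_eq[of n] by simp
    let ?ens = "ensemble q \<alpha> \<beta> \<delta> M n"
    have meas: "h \<in> borel_measurable ?ens" for h :: "(nat \<Rightarrow> nat) \<Rightarrow> real"
      by (rule racah_basis.measurable_ensemble[OF rb ns])
    have Yn: "Y n \<in> measurable P ?ens" using Y nn by blast
    show "(\<lambda>\<omega>. 1 / real n * S n (Y n \<omega>)) \<in> borel_measurable P"
      using measurable_compose[OF Yn meas] by (intro borel_measurable_times) auto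
    have "integrable (distr P ?ens (Y n)) (\<lambda>y. (1 / real n * S n y)\<^sup>2)"
      using law nn racah_basis.integrable_ensemble[OF rb ns] by simp
    then show "integrable P (\<lambda>\<omega>. (1 / real n * S n (Y n \<omega>))\<^sup>2)"
      by (rule integrable_distr[OF Yn])
    have Sn: "racah.S q \<alpha> \<beta> \<delta> M n = {..<m n}" using in_S_iff[of n] nn by auto
    have Kn: "racah_basis.K q \<alpha> \<beta> \<delta> M n (e n) = Kn n"
      unfolding Kn_def[abs_def] racah_basis.K_def[OF rb, abs_def] ..
    have "(\<integral>\<omega>. (1 / real n * S n (Y n \<omega>))\<^sup>2 \<partial>P) = (\<integral>y. (1 / real n * S n y)\<^sup>2 \<partial>distr P ?ens (Y n))"
      by (rule integral_distr[OF Yn meas, symmetric])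
    also have "\<dots> = (\<integral>y. (1 / real n)\<^sup>2 * (S n y)\<^sup>2 \<partial>?ens)" using law nn by (simp add: power_mult_distrib power_divide)
    also have "\<dots> = (1 / real n)\<^sup>2 * (\<integral>y. (S n y)\<^sup>2 \<partial>?ens)" by simp
    also have "(\<integral>y. (S n y)\<^sup>2 \<partial>?ens) \<le> real r * (R ^ r)\<^sup>2"
      unfolding racah_basis.integral_ensemble[OF rb ns] S_def
    proof (rule racah_basis.expect_variance[OF rb ns, unfolded Sn Kn])
      fix v assume "v \<in> {..<m n}"
      then have "\<bar>nu n v\<bar> \<le> R" using nn m_le[of n] by auto
      then show "\<bar>nu n v ^ r\<bar> \<le> R ^ r" by (simp add: power_abs power_mono)
    qed
    finally show "(\<integral>\<omega>. (1 / real n * S n (Y n \<omega>))\<^sup>2 \<partial>P) \<le> real r * (R ^ r)\<^sup>2 / (real n)\<^sup>2"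
      by (simp add: power_divide divide_right_mono mult_left_mono)
  qed
  then show ?thesis by (simp add: S_def)
qed

text \<open>Only the countably many power sums are treated almost surely, so the null set does not
  depend on f. Outside it the argument is deterministic, by polynomial approximation in the
  nodes.\<close>

lemma strong_law:
  assumes Y: "\<And>n. n \<ge> 1 \<Longrightarrow> Y n \<in> measurable P (ensemble q \<alpha> \<beta> \<delta> M n)"
    and law: "\<And>n. n \<ge> 1 \<Longrightarrow> distr P (ensemble q \<alpha> \<beta> \<delta> M n) (Y n) = ensemble q \<alpha> \<beta> \<delta> M n"
    and \<rho>: "\<And>x. 0 < x \<Longrightarrow> x < L \<Longrightarrow> lim.dt x > 0 \<Longrightarrow> \<rho> x = density x"
  shows "limiting_density P Y L \<rho>"
  unfolding limiting_density_def
proof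
  show "set_integrable lborel {0..L} \<rho>"
    using density_riemann(1)[of "\<lambda>_. 1" \<rho>] \<rho> by simp
  have "AE \<omega> in P. \<forall>r. (\<lambda>n. 1 / real n * ((\<Sum>j=1..n. nu n (Y n \<omega> j) ^ r) - (\<Sum>v<m n. nu n v ^ r * Kn n v))) \<longlonglongrightarrow> 0"
    unfolding AE_all_countable using power_sum_concentration[OF Y law] by blast
  then show "AE \<omega> in P. \<forall>f. continuous_on UNIV f \<longrightarrow>
      (\<lambda>n. 1 / real n * (\<Sum>j=1..n. f (real (Y n \<omega> j) / real n))) \<longlonglongrightarrow> (LBINT x:{0..L}. f x * \<rho> x)"
    using AE_space
  proof (eventually_elim, intro allI impI)
    fix \<omega> and f :: "real \<Rightarrow> real"
    assume \<omega>: "\<omega> \<in> space P" and f: "continuous_on UNIV f"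
      and pw: "\<forall>r. (\<lambda>n. 1 / real n * ((\<Sum>j=1..n. nu n (Y n \<omega> j) ^ r) - (\<Sum>v<m n. nu n v ^ r * Kn n v))) \<longlonglongrightarrow> 0"
    have YM: "Y n \<omega> j \<le> M n" if "n \<ge> 1" "j \<in> {1..n}" for n j
    proof -
      have "Y n \<omega> \<in> configs M n" using measurable_space[OF Y[OF that(1)] \<omega>] by (simp add: ensemble_def space_point_measure)
      then show ?thesis using that(2) by (auto simp: configs_def)
    qed
    define F where "F n = 1 / real n * (\<Sum>j=1..n. f (real (Y n \<omega> j) / real n))" for n
    define H where "H n = 1 / real n * (\<Sum>v<m n. f (real v / real n) * Kn n v)" for n
    have H: "H \<longlonglongrightarrow> (LBINT x:{0..L}. f x * \<rho> x)" unfolding H_def by (rule density_riemann(2)[OF f \<rho>])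
    have "(\<lambda>n. F n - H n) \<longlonglongrightarrow> 0"
    proof (rule tendstoI)
      fix \<epsilon> :: real assume \<epsilon>: "\<epsilon> > 0"
      obtain a K where aK: "\<forall>\<^sub>F n in sequentially. \<forall>v\<le>M n. \<bar>f (real v / real n) - (\<Sum>i\<le>K. a i * nu n v ^ i)\<bar> < \<epsilon> / 3"
        using uniform_approximation[OF f, of "\<epsilon> / 3"] \<epsilon> by auto
      define G where "G n v = (\<Sum>i\<le>K. a i * nu n v ^ i)" for n v
      define D where "D n = 1 / real n * ((\<Sum>j=1..n. G n (Y n \<omega> j)) - (\<Sum>v<m n. G n v * Kn n v))" for n
      have "(\<lambda>n. \<Sum>i\<le>K. a i * (1 / real n * ((\<Sum>j=1..n. nu n (Y n \<omega> j) ^ i) - (\<Sum>v<m n. nu n v ^ i * Kn n v)))) \<longlonglongrightarrow> (\<Sum>i\<le>K. a i * 0)"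
        using pw by (intro tendsto_intros) auto
      moreover have "(\<Sum>i\<le>K. a i * (1 / real n * ((\<Sum>j=1..n. nu n (Y n \<omega> j) ^ i) - (\<Sum>v<m n. nu n v ^ i * Kn n v)))) = D n" for n
      proof -
        have "(\<Sum>j=1..n. G n (Y n \<omega> j)) = (\<Sum>i\<le>K. a i * (\<Sum>j=1..n. nu n (Y n \<omega> j) ^ i))"
          unfolding G_def sum_distrib_left by (rule sum.swap)
        moreover have "(\<Sum>v<m n. G n v * Kn n v) = (\<Sum>i\<le>K. a i * (\<Sum>v<m n. nu n v ^ i * Kn n v))"
          unfolding G_def sum_distrib_left sum_distrib_right mult.assoc by (rule sum.swap)
        ultimately show ?thesis unfolding D_def
          by (simp add: sum_subtractf[symmetric] sum_distrib_left right_diff_distrib mult_ac)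
      qed
      ultimately have "D \<longlonglongrightarrow> 0" by simp
      then have "\<forall>\<^sub>F n in sequentially. dist (D n) 0 < \<epsilon> / 3" using \<epsilon> by (intro tendstoD) auto
      then show "\<forall>\<^sub>F n in sequentially. dist (F n - H n) 0 < \<epsilon>"
        using aK n_less_m eventually_ge_at_top[of 1]
      proof eventually_elim
        case (elim n)
        have close: "\<bar>f (real v / real n) - G n v\<bar> \<le> \<epsilon> / 3" if "v \<le> M n" for v
          using elim(2) that by (auto simp: G_def intro: less_imp_le)
        have n: "real n > 0" using elim(4) by simp
        have "\<bar>(\<Sum>j=1..n. f (real (Y n \<omega> j) / real n)) - (\<Sum>j=1..n. G n (Y n \<omega> j))\<bar> \<le> (\<Sum>j=1..n. \<epsilon> / 3)"
          unfolding sum_subtractf[symmetric]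
          by (intro order.trans[OF sum_abs] sum_mono close YM elim(4))
        then have 1: "\<bar>(\<Sum>j=1..n. f (real (Y n \<omega> j) / real n)) - (\<Sum>j=1..n. G n (Y n \<omega> j))\<bar> \<le> real n * (\<epsilon> / 3)" by simp
        have "\<bar>(\<Sum>v<m n. f (real v / real n) * Kn n v) - (\<Sum>v<m n. G n v * Kn n v)\<bar> \<le> (\<Sum>v<m n. \<epsilon> / 3 * Kn n v)"
          unfolding sum_subtractf[symmetric] left_diff_distrib[symmetric]
        proof (intro order.trans[OF sum_abs] sum_mono)
          fix v assume v: "v \<in> {..<m n}"
          then have "v \<le> M n" using m_le[OF elim(4)] by auto
          then show "\<bar>(f (real v / real n) - G n v) * Kn n v\<bar> \<le> \<epsilon> / 3 * Kn n v"
          proof -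
            have K0: "Kn n v \<ge> 0" using v by (intro Kn_nonneg elim(4)) simp
            show ?thesis unfolding abs_mult abs_of_nonneg[OF K0]
              by (rule mult_right_mono[OF close[OF \<open>v \<le> M n\<close>] K0])
          qed
        qed
        also have "\<dots> = real n * (\<epsilon> / 3)"
          unfolding sum_distrib_left[symmetric] using Kn_total[OF elim(4)] elim(3) by (simp add: mult.commute)
        finally have 2: "\<bar>(\<Sum>v<m n. f (real v / real n) * Kn n v) - (\<Sum>v<m n. G n v * Kn n v)\<bar> \<le> real n * (\<epsilon> / 3)" .
        have "\<bar>real n * D n\<bar> < real n * (\<epsilon> / 3)" using elim(1) n by (simp add: abs_mult)
        moreover have "real n * D n = (\<Sum>j=1..n. G n (Y n \<omega> j)) - (\<Sum>v<m n. G n v * Kn n v)" using n by (simp add: D_def)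
        moreover have "real n * (F n - H n) = (\<Sum>j=1..n. f (real (Y n \<omega> j) / real n)) - (\<Sum>v<m n. f (real v / real n) * Kn n v)"
          using n by (simp add: F_def H_def right_diff_distrib)
        ultimately have "\<bar>real n * (F n - H n)\<bar> < real n * (\<epsilon> / 3) + real n * (\<epsilon> / 3) + real n * (\<epsilon> / 3)"
          using 1 2 by linarith
        also have "\<dots> = real n * \<epsilon>" by simp
        finally show ?case using n by (simp add: abs_mult dist_real_def)
      qed
    qed
    from tendsto_add[OF this H] show "F \<longlonglongrightarrow> (LBINT x:{0..L}. f x * \<rho> x)" by simp
  qed
qed

end

theorem theorem3p1:
  fixes q \<alpha> \<beta> \<gamma> \<delta> L :: real
    and M :: "nat \<Rightarrow> nat"
    and P :: "'w measure"
    and Y :: "nat \<Rightarrow> 'w \<Rightarrow> nat \<Rightarrow> nat"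
  assumes q: "q \<in> {0<..<1} \<union> {1<..}"
    and M: "\<And>n. n \<ge> 1 \<Longrightarrow> M n > n"
    and gam_lim: "(\<lambda>n. gam q M n) \<longlonglongrightarrow> \<gamma>"
    and L_def: "L = - log q \<gamma>"
    and L: "L > 1"
    and adm: "\<And>n. n \<ge> 1 \<Longrightarrow> admissible q \<alpha> \<beta> \<delta> M n"
    \<comment> \<open>orthonormal polynomials exist at the indices \<open>j\<close> with \<open>j / n \<rightarrow> \<xi>\<close>, for all \<open>0 < \<xi> < L\<close>\<close>
    and supp: "\<And>\<xi>. 0 < \<xi> \<Longrightarrow> \<xi> < L \<Longrightarrow>
      \<forall>\<^sub>F n in sequentially. \<xi> * real n < real (card {y\<in>{0..M n}. weight q \<alpha> \<beta> \<delta> M n y > 0})"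
    and prob: "prob_space P"
    and Y: "\<And>n. n \<ge> 1 \<Longrightarrow> Y n \<in> measurable P (ensemble q \<alpha> \<beta> \<delta> M n)"
    and law: "\<And>n. n \<ge> 1 \<Longrightarrow> distr P (ensemble q \<alpha> \<beta> \<delta> M n) (Y n) = ensemble q \<alpha> \<beta> \<delta> M n"
    and ab: "\<alpha> * \<beta> \<le> 0 \<or> log q (\<alpha> * \<beta>) < 2 * log q \<gamma>"
  shows "\<exists>\<xi>m \<xi>p :: real \<Rightarrow> real.
    (\<forall>x\<in>{0..L}. deriv (mu q \<gamma> \<delta>) x \<noteq> 0 \<longrightarrow>
       {\<xi>\<in>{0..L}. char_fun q \<alpha> \<beta> \<gamma> \<delta> x \<xi> = 0} = {\<xi>m x, \<xi>p x} \<and> \<xi>m x \<le> \<xi>p x \<and>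
       \<comment> \<open>if the two solutions coincide, it is a double solution\<close>
       (\<xi>m x = \<xi>p x \<longrightarrow>
          (char_fun q \<alpha> \<beta> \<gamma> \<delta> x has_real_derivative 0) (at (\<xi>m x) within {0..L}))) \<and>
    limiting_density P Y L (\<lambda>x. rho_of q \<alpha> \<beta> (\<xi>m x) (\<xi>p x))"
proof -
  have q': "q > 0" "q \<noteq> 1" using q by auto
  have "racah q \<alpha> \<beta> \<delta> M n" if "n \<ge> 1" for n
    using q' that M[OF that] adm[OF that] by unfold_locales auto
  then have "\<exists>Ee. n \<ge> 1 \<longrightarrow> racah_basis q \<alpha> \<beta> \<delta> M n (fst Ee) (snd Ee)" for n
    using racah.basis_exists[of q \<alpha> \<beta> \<delta> M n] by (cases "n \<ge> 1") auto
  then obtain Ee where Ee: "\<And>n. n \<ge> 1 \<Longrightarrow> racah_basis q \<alpha> \<beta> \<delta> M n (fst (Ee n)) (snd (Ee n))" by metis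
  interpret rs: racah_seq q \<alpha> \<beta> \<gamma> \<delta> L M "\<lambda>n. fst (Ee n)" "\<lambda>n. snd (Ee n)"
    by (rule racah_seq.intro) (fact q' gam_lim L_def L supp ab Ee)+
  \<comment> \<open>Where \<mu>' vanishes, which is possible only at 0 or L, the chosen pair is
    arbitrary.\<close>
  have "\<forall>x. \<exists>uv. x \<in> {0..L} \<longrightarrow> 1 - \<gamma> * \<delta> * q powr (2 * x) \<noteq> 0 \<longrightarrow> rs.lim.roots_ok x (fst uv) (snd uv)"
    using rs.roots_exist by (metis fst_conv snd_conv)
  then obtain uv where uv: "\<And>x. x \<in> {0..L} \<Longrightarrow> 1 - \<gamma> * \<delta> * q powr (2 * x) \<noteq> 0 \<Longrightarrow> rs.lim.roots_ok x (fst (uv x)) (snd (uv x))"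
    by metis
  show ?thesis
  proof (rule exI[of _ "\<lambda>x. fst (uv x)"], rule exI[of _ "\<lambda>x. snd (uv x)"], intro conjI ballI impI)
    fix x assume x: "x \<in> {0..L}" "deriv (mu q \<gamma> \<delta>) x \<noteq> 0"
    then have "rs.lim.roots_ok x (fst (uv x)) (snd (uv x))"
      by (intro uv) (simp_all add: rs.lim.derivative_mu_nonzero_iff)
    note ok = this[unfolded rs.lim.roots_ok_def]
    show "{\<xi>\<in>{0..L}. char_fun q \<alpha> \<beta> \<gamma> \<delta> x \<xi> = 0} = {fst (uv x), snd (uv x)}" using ok by blast
    show "fst (uv x) \<le> snd (uv x)" using ok by blast
    show "(char_fun q \<alpha> \<beta> \<gamma> \<delta> x has_real_derivative 0) (at (fst (uv x)) within {0..L})"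
      if "fst (uv x) = snd (uv x)" using ok that by blast
  next
    show "limiting_density P Y L (\<lambda>x. rho_of q \<alpha> \<beta> (fst (uv x)) (snd (uv x)))"
    proof (rule rs.strong_law[OF Y law])
      fix x assume x: "0 < x" "x < L" "rs.lim.dt x > 0"
      have "rs.lim.roots_ok x (fst (uv x)) (snd (uv x))"
        using x rs.limit_factor_nonzero[OF x(1,2)] by (intro uv) auto
      then show "rho_of q \<alpha> \<beta> (fst (uv x)) (snd (uv x)) = rs.density x"
        using rs.density_eq_rho_of x(3) by simp
    qed
  qed
qed

end
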